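(* Let $\mathcal{P}$ be a filtered poset and $R$ be a unital commutative ring. Let $F\colon\mathcal{P}^{\mathrm{op}}\to R\text{-Mod}$ be a functor. If there exists an integer $n\ge 0$ such that for every $p\in\mathcal{P}$, $H^k(\mathcal{P}_{<p};F)=0$ for all $k\ge n$, then $$H^k(\mathcal{P};F)=0$$ for all $k>n$.
   Context: A poset $\mathcal{P}$ is viewed as a category with a unique arrow $p\to q$ iff $p\le q$. It is filtered if there is a strictly order-preserving map $d\colon\mathcal{P}\to\mathbb{N}$. Write $\mathcal{P}_{<p}=\{q\in\mathcal{P}\mid q<p\}$. For a poset $\mathcal{Q}$ and a functor $F\colon\mathcal{Q}^{\mathrm{op}}\to R\text{-Mod}$, $H^k(\mathcal{Q};F)=\mathrm{R}^k\lim(F)$ is the $k$-th right derived functor of $\lim\colon\mathrm{Fun}(\mathcal{Q}^{\mathrm{op}},R\text{-Mod})\to R\text{-Mod}$; $H^k(\mathcal{P}_{<p};F)$ refers to the restriction of $F$ to $\mathcal{P}_{<p}$. *)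

theory Defs
  imports "HOL-Algebra.Module" "HOL-Algebra.QuotRing"
begin

text \<open>
  A poset is a subset of a type of class \<open>order\<close>, with the induced order; the empty poset is
  allowed.
\<close>

definition filtered_poset :: "'p::order set \<Rightarrow> bool" where
  "filtered_poset P \<longleftrightarrow> (\<exists>d :: 'p \<Rightarrow> nat. strict_mono_on P d)"

definition below :: "'p::order set \<Rightarrow> 'p \<Rightarrow> 'p set" where
  "below P p = {q \<in> P. q < p}"


section \<open>Modules\<close>

definition module_hom ::
  "('r, 'x) ring_scheme \<Rightarrow> ('r, 'm) module \<Rightarrow> ('r, 'n) module \<Rightarrow> ('m \<Rightarrow> 'n) set" where
  "module_hom R M N = {h \<in> carrier M \<rightarrow> carrier N.
     (\<forall>x\<in>carrier M. \<forall>y\<in>carrier M. h (x \<oplus>\<^bsub>M\<^esub> y) = h x \<oplus>\<^bsub>N\<^esub> h y) \<and>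
     (\<forall>a\<in>carrier R. \<forall>x\<in>carrier M. h (a \<odot>\<^bsub>M\<^esub> x) = a \<odot>\<^bsub>N\<^esub> h x)}"

text \<open>
  The quotient of a module by a submodule, formed in the same way as \<^const>\<open>FactRing\<close>. The fields
  \<open>mult\<close> and \<open>one\<close> play no role in a module.
\<close>

definition quot_module :: "('r, 'm) module \<Rightarrow> 'm set \<Rightarrow> ('r, 'm set) module" where
  "quot_module M N =
     \<lparr>carrier = a_rcosets\<^bsub>M\<^esub> N, mult = undefined, one = undefined,
      zero = N, add = set_add M,
      smult = (\<lambda>a C. \<Union>x\<in>C. N +>\<^bsub>M\<^esub> (a \<odot>\<^bsub>M\<^esub> x))\<rparr>"

definition zero_module :: "('r, 'm) module \<Rightarrow> bool" where
  "zero_module M \<longleftrightarrow> carrier M = {\<zero>\<^bsub>M\<^esub>}"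


section \<open>The category of functors from the opposite of a poset to R-modules\<close>

text \<open>
  \<open>res F q p\<close> is the value of \<open>F\<close> on the arrow from \<open>p\<close> to \<open>q\<close>, that is, for \<open>p \<le> q\<close>, a map
  from \<open>F(q)\<close> to \<open>F(p)\<close>. All predicates below only look at the values of a functor on the given
  poset \<open>Q\<close>. Hence the restriction of \<open>F\<close> to a smaller poset is represented by \<open>F\<close> itself.
\<close>

record ('p, 'r, 'm) pfunctor =
  obj :: "'p \<Rightarrow> ('r, 'm) module"
  res :: "'p \<Rightarrow> 'p \<Rightarrow> 'm \<Rightarrow> 'm"

definition is_functor ::
  "('r, 'x) ring_scheme \<Rightarrow> 'p::order set \<Rightarrow> ('p, 'r, 'm) pfunctor \<Rightarrow> bool" where
  "is_functor R Q F \<longleftrightarrow>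
     (\<forall>p\<in>Q. module R (obj F p)) \<and>
     (\<forall>p\<in>Q. \<forall>q\<in>Q. p \<le> q \<longrightarrow> res F q p \<in> module_hom R (obj F q) (obj F p)) \<and>
     (\<forall>p\<in>Q. \<forall>x\<in>carrier (obj F p). res F p p x = x) \<and>
     (\<forall>p\<in>Q. \<forall>q\<in>Q. \<forall>r\<in>Q. p \<le> q \<longrightarrow> q \<le> r \<longrightarrow>
        (\<forall>x\<in>carrier (obj F r). res F q p (res F r q x) = res F r p x))"

definition nat_trans ::
  "('r, 'x) ring_scheme \<Rightarrow> 'p::order set \<Rightarrow> ('p, 'r, 'm) pfunctor \<Rightarrow> ('p, 'r, 'n) pfunctor
     \<Rightarrow> ('p \<Rightarrow> 'm \<Rightarrow> 'n) \<Rightarrow> bool" where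
  "nat_trans R Q F G \<eta> \<longleftrightarrow>
     (\<forall>p\<in>Q. \<eta> p \<in> module_hom R (obj F p) (obj G p)) \<and>
     (\<forall>p\<in>Q. \<forall>q\<in>Q. p \<le> q \<longrightarrow>
        (\<forall>x\<in>carrier (obj F q). \<eta> p (res F q p x) = res G q p (\<eta> q x)))"

text \<open>
  Monomorphisms and exactness in the functor category are pointwise.
\<close>

definition mono_trans ::
  "'p set \<Rightarrow> ('p, 'r, 'm) pfunctor \<Rightarrow> ('p \<Rightarrow> 'm \<Rightarrow> 'n) \<Rightarrow> bool" where
  "mono_trans Q F \<eta> \<longleftrightarrow> (\<forall>p\<in>Q. inj_on (\<eta> p) (carrier (obj F p)))"

text \<open>
  Injective objects. The test objects \<open>A\<close> and \<open>B\<close> take their elements from the same type \<open>'u\<close> as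
  \<open>I\<close>. This is no restriction as soon as \<open>'r\<close> embeds into \<open>'u\<close>: by Baer's criterion it suffices
  to test on the inclusions of subfunctors of the free functors on one generator, whose values are
  \<open>R\<close> at the elements below a given one and zero elsewhere.
\<close>

definition injective_functor ::
  "('r, 'x) ring_scheme \<Rightarrow> 'p::order set \<Rightarrow> ('p, 'r, 'u) pfunctor \<Rightarrow> bool" where
  "injective_functor R Q I \<longleftrightarrow> is_functor R Q I \<and>
     (\<forall>(A :: ('p, 'r, 'u) pfunctor) (B :: ('p, 'r, 'u) pfunctor) i f.
        is_functor R Q A \<longrightarrow> is_functor R Q B \<longrightarrow>
        nat_trans R Q A B i \<longrightarrow> mono_trans Q A i \<longrightarrow> nat_trans R Q A I f \<longrightarrow>
        (\<exists>g. nat_trans R Q B I g \<and> (\<forall>p\<in>Q. \<forall>x\<in>carrier (obj A p). g p (i p x) = f p x)))"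

text \<open>
  An injective resolution \<open>0 \<rightarrow> F \<rightarrow> I 0 \<rightarrow> I 1 \<rightarrow> \<dots>\<close> with augmentation \<open>e\<close> and differentials
  \<open>d k\<close> from \<open>I k\<close> to \<open>I (Suc k)\<close>.
\<close>

definition injective_resolution ::
  "('r, 'x) ring_scheme \<Rightarrow> 'p::order set \<Rightarrow> ('p, 'r, 'm) pfunctor \<Rightarrow> ('p \<Rightarrow> 'm \<Rightarrow> 'u)
     \<Rightarrow> (nat \<Rightarrow> ('p, 'r, 'u) pfunctor) \<Rightarrow> (nat \<Rightarrow> 'p \<Rightarrow> 'u \<Rightarrow> 'u) \<Rightarrow> bool" where
  "injective_resolution R Q F e I d \<longleftrightarrow>
     (\<forall>k. injective_functor R Q (I k)) \<and>
     nat_trans R Q F (I 0) e \<and>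
     (\<forall>k. nat_trans R Q (I k) (I (Suc k)) (d k)) \<and>
     mono_trans Q F e \<and>
     (\<forall>p\<in>Q. e p ` carrier (obj F p) = a_kernel (obj (I 0) p) (obj (I 1) p) (d 0 p)) \<and>
     (\<forall>k. \<forall>p\<in>Q. d k p ` carrier (obj (I k) p)
        = a_kernel (obj (I (Suc k)) p) (obj (I (Suc (Suc k))) p) (d (Suc k) p))"


section \<open>The limit functor and its right derived functors\<close>

text \<open>
  The limit of \<open>F\<close> is the module of compatible families. Families are extensional, that is, they
  have the value \<open>undefined\<close> outside \<open>Q\<close>.
\<close>

definition lim_module :: "'p::order set \<Rightarrow> ('p, 'r, 'm) pfunctor \<Rightarrow> ('r, 'p \<Rightarrow> 'm) module" where
  "lim_module Q F =
     \<lparr>carrier = {s \<in> (\<Pi>\<^sub>E p\<in>Q. carrier (obj F p)).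
                  \<forall>p\<in>Q. \<forall>q\<in>Q. p \<le> q \<longrightarrow> res F q p (s q) = s p},
      mult = undefined, one = undefined,
      zero = (\<lambda>p\<in>Q. \<zero>\<^bsub>obj F p\<^esub>),
      add = (\<lambda>s t. \<lambda>p\<in>Q. s p \<oplus>\<^bsub>obj F p\<^esub> t p),
      smult = (\<lambda>a s. \<lambda>p\<in>Q. a \<odot>\<^bsub>obj F p\<^esub> s p)\<rparr>"

definition lim_map :: "'p set \<Rightarrow> ('p \<Rightarrow> 'm \<Rightarrow> 'n) \<Rightarrow> ('p \<Rightarrow> 'm) \<Rightarrow> ('p \<Rightarrow> 'n)" where
  "lim_map Q \<eta> s = (\<lambda>p\<in>Q. \<eta> p (s p))"

definition lim_cocycles ::
  "'p::order set \<Rightarrow> (nat \<Rightarrow> ('p, 'r, 'm) pfunctor) \<Rightarrow> (nat \<Rightarrow> 'p \<Rightarrow> 'm \<Rightarrow> 'm) \<Rightarrow> nat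
     \<Rightarrow> ('p \<Rightarrow> 'm) set" where
  "lim_cocycles Q I d k =
     a_kernel (lim_module Q (I k)) (lim_module Q (I (Suc k))) (lim_map Q (d k))"

fun lim_coboundaries ::
  "'p::order set \<Rightarrow> (nat \<Rightarrow> ('p, 'r, 'm) pfunctor) \<Rightarrow> (nat \<Rightarrow> 'p \<Rightarrow> 'm \<Rightarrow> 'm) \<Rightarrow> nat
     \<Rightarrow> ('p \<Rightarrow> 'm) set" where
  "lim_coboundaries Q I d 0 = {\<zero>\<^bsub>lim_module Q (I 0)\<^esub>}"
| "lim_coboundaries Q I d (Suc k) = lim_map Q (d k) ` carrier (lim_module Q (I k))"

definition lim_cohomology ::
  "'p::order set \<Rightarrow> (nat \<Rightarrow> ('p, 'r, 'm) pfunctor) \<Rightarrow> (nat \<Rightarrow> 'p \<Rightarrow> 'm \<Rightarrow> 'm) \<Rightarrow> nat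
     \<Rightarrow> ('r, ('p \<Rightarrow> 'm) set) module" where
  "lim_cohomology Q I d k =
     quot_module ((lim_module Q (I k))\<lparr>carrier := lim_cocycles Q I d k\<rparr>) (lim_coboundaries Q I d k)"

text \<open>
  The type from which the elements of injective resolutions are taken. With
  \<open>\<kappa> = |'p \<times> 'r \<times> nat|\<close>, its cardinality \<open>\<lambda>\<close> is infinite, at least \<open>|'p|\<close>, \<open>|'r|\<close> and \<open>|'m|\<close>, and
  satisfies \<open>\<lambda>^\<kappa> = \<lambda>\<close>. Therefore every functor \<open>G\<close> with values of cardinality at most \<open>\<lambda>\<close> embeds
  into an injective functor of the same kind, namely the one sending \<open>p\<close> to the product over
  \<open>q \<le> p\<close> of \<open>Hom(R, D(q))\<close>, where \<open>Hom\<close> denotes additive maps and \<open>D(q)\<close> is a divisible abelian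
  group containing \<open>G(q)\<close>, of cardinality at most \<open>\<lambda>\<close>. So every functor with values in \<open>'m\<close> has an
  injective resolution with values in this type.
\<close>

type_synonym ('p, 'r, 'm) resolvent = "'p \<times> 'r \<times> nat \<Rightarrow> 'm option"

text \<open>
  \<open>Rlim R Q F k\<close> is the \<open>k\<close>-th right derived functor of the limit over \<open>Q\<close>, evaluated at (the
  restriction to \<open>Q\<close> of) \<open>F\<close>. It is computed, as usual, from a chosen injective resolution in the
  category of functors on \<open>Q\<close>.
\<close>

definition Rlim ::
  "('r, 'x) ring_scheme \<Rightarrow> 'p::order set \<Rightarrow> ('p, 'r, 'm) pfunctor \<Rightarrow> nat
     \<Rightarrow> ('r, ('p \<Rightarrow> ('p, 'r, 'm) resolvent) set) module" where
  "Rlim R Q F k =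
     (let (I, d) = (SOME (I, d). \<exists>e. injective_resolution R Q F e I d)
      in lim_cohomology Q I d k)"

end

theory Submission
  imports Defs "HOL-Algebra.Free_Abelian_Groups"
begin

text \<open>
  Let \<open>I\<close> be an injective resolution of \<open>F\<close> on \<open>P\<close>. Restriction to a down-closed subset has an exact
  left adjoint, extension by zero, so \<open>I\<close> restricts to an injective resolution on \<open>below P p\<close> for every
  \<open>p\<close> (\<open>injective_resolution_restrict\<close>). Thus the hypothesis says that the limits of \<open>I\<close> over
  \<open>below P p\<close> form a complex that is exact in all degrees \<open>\<ge> n\<close>. Moreover, injective functors are
  flasque: every compatible family of elements of \<open>I j\<close> below \<open>p\<close> is the restriction of an element at
  \<open>p\<close> (\<open>injective_functor_flasque\<close>).

  Now let \<open>s\<close> be a cocycle of degree \<open>k > n\<close> in the limit over \<open>P\<close>. A cochain \<open>t\<close> with \<open>d t = s\<close> is built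
  by recursion along \<open>P\<close>, which is well-founded because \<open>P\<close> is filtered. Suppose that \<open>t\<close> is known below
  \<open>p\<close>. As the resolution is exact at \<open>p\<close>, there is some \<open>u\<close> with \<open>d u = s p\<close>. The difference between
  \<open>t\<close> and the restriction of \<open>u\<close> is a cocycle below \<open>p\<close> of degree \<open>k - 1 \<ge> n\<close>, hence it is \<open>d w\<close> for a
  family \<open>w\<close> below \<open>p\<close>, or zero if \<open>k = 1\<close>. Lift \<open>w\<close> to an element \<open>z\<close> at \<open>p\<close> and let \<open>t p\<close> be
  \<open>u + d z\<close>. This is \<open>cochain_extend_at\<close>, and the recursion is \<open>lim_exact_from_below\<close>.

  Since \<open>Rlim\<close> is computed from a chosen resolution, possibly a different one for every \<open>p\<close>, two facts
  of homological algebra are needed as well. Vanishing of the cohomology does not depend on the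
  injective resolution (\<open>zero_module_Rlim_iff\<close>), by the comparison theorem. And an injective
  resolution with values in the resolvent type exists (\<open>injective_resolution_exists\<close>): a functor embeds
  into the one coinduced from divisible hulls of its values, and the resolvent type is so large that
  this does not lead out of it (\<open>resolvent_absorbs\<close>).
\<close>

section \<open>Divisible abelian groups\<close>

definition divisible :: "('a, 'b) monoid_scheme \<Rightarrow> bool" where
  "divisible G \<longleftrightarrow> (\<forall>x\<in>carrier G. \<forall>n>0. \<exists>y\<in>carrier G. y [^]\<^bsub>G\<^esub> (n::nat) = x)"

lemma int_pow_DirProd:
  assumes "group G" "group H" "x \<in> carrier G" "y \<in> carrier H"
  shows "(x, y) [^]\<^bsub>G \<times>\<times> H\<^esub> (k::int) = (x [^]\<^bsub>G\<^esub> k, y [^]\<^bsub>H\<^esub> k)"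
proof -
  interpret E: group "G \<times>\<times> H" by (rule DirProd_group[OF assms(1,2)])
  have f: "fst \<in> hom (G \<times>\<times> H) G" "snd \<in> hom (G \<times>\<times> H) H"
    by (auto simp: hom_def mult_DirProd')
  have xy: "(x, y) \<in> carrier (G \<times>\<times> H)" using assms by simp
  have "fst ((x, y) [^]\<^bsub>G \<times>\<times> H\<^esub> k) = x [^]\<^bsub>G\<^esub> k" "snd ((x, y) [^]\<^bsub>G \<times>\<times> H\<^esub> k) = y [^]\<^bsub>H\<^esub> k"
    using hom_int_pow[OF f(1) xy E.is_group assms(1)] hom_int_pow[OF f(2) xy E.is_group assms(2)]
    by simp_all
  then show ?thesis by (metis prod.collapse)
qed

text \<open>
  The exponents \<open>k\<close> for which \<open>x^k\<close> lies in the domain of \<open>\<Gamma>\<close> form a subgroup of the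
  integers, which is generated by a single \<open>m\<close>. An \<open>m\<close>-th root \<open>y\<close> of the value at \<open>x^m\<close> is therefore
  compatible with \<open>\<Gamma>\<close> at all powers of \<open>x\<close>, and divisibility of \<open>D\<close> supplies such a root.
\<close>

lemma graph_root:
  assumes B: "group B" and D: "group D" and div: "divisible D"
    and \<Gamma>: "subgroup \<Gamma> (B \<times>\<times> D)" and fn: "\<And>d. (\<one>\<^bsub>B\<^esub>, d) \<in> \<Gamma> \<Longrightarrow> d = \<one>\<^bsub>D\<^esub>"
    and x: "x \<in> carrier B"
  shows "\<exists>y\<in>carrier D. \<forall>(k::int) d. (x [^]\<^bsub>B\<^esub> k, d) \<in> \<Gamma> \<longrightarrow> d = y [^]\<^bsub>D\<^esub> k"
proof -
  interpret B: group B by (rule B)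
  interpret D: group D by (rule D)
  interpret E: group "B \<times>\<times> D" by (rule DirProd_group[OF B D])
  interpret \<Gamma>: subgroup \<Gamma> "B \<times>\<times> D" by (rule \<Gamma>)
  have in\<Gamma>: "b \<in> carrier B \<and> d \<in> carrier D" if "(b, d) \<in> \<Gamma>" for b d
    using \<Gamma>.mem_carrier[OF that] by simp
  \<comment> \<open>The positive exponents in the subgroup; its least element is the generator.\<close>
  define M where "M = {m::nat. m > 0 \<and> (\<exists>d. (x [^]\<^bsub>B\<^esub> int m, d) \<in> \<Gamma>)}"
  have inv\<Gamma>: "(x [^]\<^bsub>B\<^esub> (- k), inv\<^bsub>D\<^esub> d) \<in> \<Gamma>" if "(x [^]\<^bsub>B\<^esub> k, d) \<in> \<Gamma>" for k :: int and d
    using \<Gamma>.m_inv_closed[OF that] in\<Gamma>[OF that] x by (simp add: B.int_pow_neg inv_DirProd B D)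
  show ?thesis
  proof (cases "M = {}")
    case True
    have "d = \<one>\<^bsub>D\<^esub> [^]\<^bsub>D\<^esub> k" if kd: "(x [^]\<^bsub>B\<^esub> k, d) \<in> \<Gamma>" for k :: int and d
    proof -
      have "k = 0"
      proof (rule ccontr)
        assume "k \<noteq> 0"
        then have "nat k \<in> M \<or> nat (- k) \<in> M"
          using kd inv\<Gamma>[OF kd] unfolding M_def by (cases "k > 0") auto
        then show False using True by auto
      qed
      then show ?thesis using kd fn by simp
    qed
    \<comment> \<open>Only \<open>k = 0\<close> occurs, so every \<open>y\<close> would do.\<close>
    then show ?thesis using D.one_closed by blast
  next
    case False
    define m where "m = (LEAST m. m \<in> M)"
    have mM: "m \<in> M" unfolding m_def using False by (auto intro: LeastI)
    have least: "m \<le> l" if "l \<in> M" for l unfolding m_def using that by (rule Least_le)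
    from mM obtain c where m0: "m > 0" and c: "(x [^]\<^bsub>B\<^esub> int m, c) \<in> \<Gamma>" unfolding M_def by auto
    from div in\<Gamma>[OF c] m0 obtain y where y: "y \<in> carrier D" "y [^]\<^bsub>D\<^esub> m = c"
      unfolding divisible_def by blast
    have "d = y [^]\<^bsub>D\<^esub> k" if kd: "(x [^]\<^bsub>B\<^esub> k, d) \<in> \<Gamma>" for k :: int and d
    proof -
      define q r where "q = k div int m" and "r = k mod int m"
      have k: "k = int m * q + r" unfolding q_def r_def by simp
      have r: "0 \<le> r" "r < int m" unfolding r_def using m0 by auto
      have "(x [^]\<^bsub>B\<^esub> int m, c) [^]\<^bsub>B \<times>\<times> D\<^esub> (- q) \<in> \<Gamma>"
        using c by (meson E.subgroup_int_pow_closed \<Gamma>)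
      then have cq: "(x [^]\<^bsub>B\<^esub> (int m * - q), c [^]\<^bsub>D\<^esub> (- q)) \<in> \<Gamma>"
        using in\<Gamma>[OF c] x by (simp add: int_pow_DirProd B D B.int_pow_pow)
      have "(x [^]\<^bsub>B\<^esub> k \<otimes>\<^bsub>B\<^esub> x [^]\<^bsub>B\<^esub> (int m * - q), d \<otimes>\<^bsub>D\<^esub> c [^]\<^bsub>D\<^esub> (- q)) \<in> \<Gamma>"
        using \<Gamma>.m_closed[OF kd cq] by simp
      then have rd: "(x [^]\<^bsub>B\<^esub> r, d \<otimes>\<^bsub>D\<^esub> c [^]\<^bsub>D\<^esub> (- q)) \<in> \<Gamma>"
        using x by (simp add: B.int_pow_mult[symmetric] k)
      have "r = 0"
      proof (rule ccontr)
        assume "r \<noteq> 0"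
        then have "nat r \<in> M" using rd r unfolding M_def by auto
        then show False using least[of "nat r"] r by linarith
      qed
      then have "d \<otimes>\<^bsub>D\<^esub> c [^]\<^bsub>D\<^esub> (- q) = \<one>\<^bsub>D\<^esub>" using rd fn by simp
      then have "d \<otimes>\<^bsub>D\<^esub> inv\<^bsub>D\<^esub> (c [^]\<^bsub>D\<^esub> q) = \<one>\<^bsub>D\<^esub>"
        using in\<Gamma>[OF c] by (simp add: D.int_pow_neg)
      then have "d = c [^]\<^bsub>D\<^esub> q"
        using in\<Gamma>[OF c] in\<Gamma>[OF kd] by (metis D.inv_equality D.inv_inv D.int_pow_closed D.inv_closed)
      also have "\<dots> = (y [^]\<^bsub>D\<^esub> int m) [^]\<^bsub>D\<^esub> q" using y by (simp add: int_pow_int)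
      also have "\<dots> = y [^]\<^bsub>D\<^esub> k" using y \<open>r = 0\<close> k by (simp add: D.int_pow_pow)
      finally show ?thesis .
    qed
    then show ?thesis using y by blast
  qed
qed

text \<open>
  A partial homomorphism from \<open>B\<close> to \<open>D\<close> is represented by its graph, a subgroup \<open>\<Gamma>\<close> of the product
  that meets the second factor trivially. To enlarge its domain by \<open>x\<close>, adjoin the cyclic group
  generated by \<open>(x, y)\<close>, with \<open>y\<close> taken from the previous lemma.
\<close>

lemma graph_extend:
  assumes B: "comm_group B" and D: "comm_group D" and div: "divisible D"
    and \<Gamma>: "subgroup \<Gamma> (B \<times>\<times> D)" and fn: "\<And>d. (\<one>\<^bsub>B\<^esub>, d) \<in> \<Gamma> \<Longrightarrow> d = \<one>\<^bsub>D\<^esub>"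
    and x: "x \<in> carrier B"
  shows "\<exists>\<Gamma>' y. subgroup \<Gamma>' (B \<times>\<times> D) \<and> (\<forall>d. (\<one>\<^bsub>B\<^esub>, d) \<in> \<Gamma>' \<longrightarrow> d = \<one>\<^bsub>D\<^esub>) \<and> \<Gamma> \<subseteq> \<Gamma>' \<and> (x, y) \<in> \<Gamma>'"
proof -
  interpret B: comm_group B by (rule B)
  interpret D: comm_group D by (rule D)
  interpret E: group "B \<times>\<times> D" by (rule DirProd_group) unfold_locales
  interpret E: comm_group "B \<times>\<times> D"
    by (rule E.group_comm_groupI) (auto simp: mult_DirProd' B.m_comm D.m_comm)
  interpret \<Gamma>: subgroup \<Gamma> "B \<times>\<times> D" by (rule \<Gamma>)
  obtain y where y: "y \<in> carrier D" and root: "\<And>(k::int) d. (x [^]\<^bsub>B\<^esub> k, d) \<in> \<Gamma> \<Longrightarrow> d = y [^]\<^bsub>D\<^esub> k"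
    using graph_root[OF B.is_group D.is_group div \<Gamma> fn x] by blast
  have xy: "(x, y) \<in> carrier (B \<times>\<times> D)" using x y by simp
  define C where "C = generate (B \<times>\<times> D) {(x, y)}"
  have C: "subgroup C (B \<times>\<times> D)" unfolding C_def using xy by (intro E.generate_is_subgroup) simp
  have Cpow: "C = {(x [^]\<^bsub>B\<^esub> k, y [^]\<^bsub>D\<^esub> k) | k. k \<in> (UNIV :: int set)}"
    unfolding C_def E.generate_pow[OF xy]
    using int_pow_DirProd[OF B.is_group D.is_group x y] by simp
  show ?thesis
  proof (intro exI[of _ "\<Gamma> <#>\<^bsub>B \<times>\<times> D\<^esub> C"] exI[of _ y] conjI allI impI)
    show "subgroup (\<Gamma> <#>\<^bsub>B \<times>\<times> D\<^esub> C) (B \<times>\<times> D)" by (rule E.mult_subgroups[OF \<Gamma> C])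
  next
    fix d assume "(\<one>\<^bsub>B\<^esub>, d) \<in> \<Gamma> <#>\<^bsub>B \<times>\<times> D\<^esub> C"
    then obtain b c k where bc: "(b, c) \<in> \<Gamma>" and 1: "\<one>\<^bsub>B\<^esub> = b \<otimes>\<^bsub>B\<^esub> x [^]\<^bsub>B\<^esub> (k::int)"
      and d: "d = c \<otimes>\<^bsub>D\<^esub> y [^]\<^bsub>D\<^esub> k"
      unfolding set_mult_def Cpow by auto
    have car: "b \<in> carrier B" "c \<in> carrier D" using \<Gamma>.mem_carrier[OF bc] by auto
    have "b = x [^]\<^bsub>B\<^esub> (- k)"
      using 1 car x by (metis B.int_pow_closed B.int_pow_neg B.inv_equality B.inv_inv)
    then have "c = y [^]\<^bsub>D\<^esub> (- k)" using root bc by blast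
    then show "d = \<one>\<^bsub>D\<^esub>" using d y by (simp add: D.int_pow_neg)
  next
    have "g \<otimes>\<^bsub>B \<times>\<times> D\<^esub> \<one>\<^bsub>B \<times>\<times> D\<^esub> \<in> \<Gamma> <#>\<^bsub>B \<times>\<times> D\<^esub> C" if "g \<in> \<Gamma>" for g
      using that subgroup.one_closed[OF C] unfolding set_mult_def by blast
    then show "\<Gamma> \<subseteq> \<Gamma> <#>\<^bsub>B \<times>\<times> D\<^esub> C"
      using \<Gamma>.mem_carrier E.r_one by (metis subsetI)
    have "(x, y) \<in> C" unfolding C_def by (rule generate.incl) simp
    then have "\<one>\<^bsub>B \<times>\<times> D\<^esub> \<otimes>\<^bsub>B \<times>\<times> D\<^esub> (x, y) \<in> \<Gamma> <#>\<^bsub>B \<times>\<times> D\<^esub> C"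
      using \<Gamma>.one_closed unfolding set_mult_def by blast
    then show "(x, y) \<in> \<Gamma> <#>\<^bsub>B \<times>\<times> D\<^esub> C" using E.l_one[OF xy] by simp
  qed
qed

text \<open>
  Divisible groups are injective. By Zorn's lemma there is a maximal graph of a partial homomorphism
  that contains all pairs \<open>(i a, f a)\<close>; by \<open>graph_extend\<close> its domain is all of \<open>B\<close>.
\<close>

lemma divisible_extension:
  assumes A: "group A" and B: "comm_group B" and D: "comm_group D" and div: "divisible D"
    and i: "i \<in> hom A B" "inj_on i (carrier A)" and f: "f \<in> hom A D"
  obtains g where "g \<in> hom B D" "\<And>x. x \<in> carrier A \<Longrightarrow> g (i x) = f x"
proof -
  interpret A: group A by (rule A)
  interpret B: comm_group B by (rule B)
  interpret D: comm_group D by (rule D)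
  interpret E: group "B \<times>\<times> D" by (rule DirProd_group) unfold_locales
  interpret i: group_hom A B i using i by unfold_locales
  interpret f: group_hom A D f using f by unfold_locales
  define \<Gamma>0 where "\<Gamma>0 = (\<lambda>a. (i a, f a)) ` carrier A"
  define \<S> where "\<S> = {\<Gamma>. subgroup \<Gamma> (B \<times>\<times> D) \<and> (\<forall>d. (\<one>\<^bsub>B\<^esub>, d) \<in> \<Gamma> \<longrightarrow> d = \<one>\<^bsub>D\<^esub>) \<and> \<Gamma>0 \<subseteq> \<Gamma>}"
  have "(\<lambda>a. (i a, f a)) \<in> hom A (B \<times>\<times> D)" by (auto simp: hom_def)
  then interpret i_f: group_hom A "B \<times>\<times> D" "\<lambda>a. (i a, f a)" by unfold_locales
  have "subgroup \<Gamma>0 (B \<times>\<times> D)" unfolding \<Gamma>0_def by (rule i_f.img_is_subgroup)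
  moreover have "d = \<one>\<^bsub>D\<^esub>" if "(\<one>\<^bsub>B\<^esub>, d) \<in> \<Gamma>0" for d
  proof -
    from that obtain a where a: "a \<in> carrier A" "i a = \<one>\<^bsub>B\<^esub>" "d = f a" unfolding \<Gamma>0_def by auto
    then have "a = \<one>\<^bsub>A\<^esub>" using inj_onD[OF i(2), of a "\<one>\<^bsub>A\<^esub>"] by simp
    then show ?thesis using a by simp
  qed
  ultimately have \<Gamma>0: "\<Gamma>0 \<in> \<S>" unfolding \<S>_def by blast
  have "\<exists>M\<in>\<S>. \<forall>X\<in>\<S>. M \<subseteq> X \<longrightarrow> X = M"
  proof (rule subset_Zorn_nonempty)
    show "\<S> \<noteq> {}" using \<Gamma>0 by blast
    fix \<C> assume \<C>0: "\<C> \<noteq> {}" and ch: "subset.chain \<S> \<C>"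
    from ch have \<C>: "\<C> \<subseteq> \<S>" and lin: "\<And>X Y. X \<in> \<C> \<Longrightarrow> Y \<in> \<C> \<Longrightarrow> X \<subseteq> Y \<or> Y \<subseteq> X"
      unfolding subset.chain_def by auto
    have sub: "subgroup X (B \<times>\<times> D)" if "X \<in> \<C>" for X using that \<C> unfolding \<S>_def by blast
    have "subgroup (\<Union>\<C>) (B \<times>\<times> D)"
    proof (rule E.subgroupI)
      show "\<Union>\<C> \<subseteq> carrier (B \<times>\<times> D)" using subgroup.subset[OF sub] by auto
      show "\<Union>\<C> \<noteq> {}" using \<C>0 subgroup.one_closed[OF sub] by auto
      show "inv\<^bsub>B \<times>\<times> D\<^esub> a \<in> \<Union>\<C>" if "a \<in> \<Union>\<C>" for a
      proof -
        from that obtain X where X: "X \<in> \<C>" "a \<in> X" by blast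
        show ?thesis using subgroup.m_inv_closed[OF sub[OF X(1)] X(2)] X(1) by (rule UnionI[rotated])
      qed
      show "a \<otimes>\<^bsub>B \<times>\<times> D\<^esub> b \<in> \<Union>\<C>" if "a \<in> \<Union>\<C>" "b \<in> \<Union>\<C>" for a b
      proof -
        from that obtain X Y where "X \<in> \<C>" "a \<in> X" "Y \<in> \<C>" "b \<in> Y" by blast
        then obtain Z where Z: "Z \<in> \<C>" "a \<in> Z" "b \<in> Z" using lin by blast
        show ?thesis using subgroup.m_closed[OF sub[OF Z(1)] Z(2,3)] Z(1) by (rule UnionI[rotated])
      qed
    qed
    moreover have "\<Gamma>0 \<subseteq> \<Union>\<C>" using \<C> \<C>0 unfolding \<S>_def by auto
    moreover have "d = \<one>\<^bsub>D\<^esub>" if "(\<one>\<^bsub>B\<^esub>, d) \<in> \<Union>\<C>" for d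
      using that \<C> unfolding \<S>_def by auto
    ultimately show "\<Union>\<C> \<in> \<S>" unfolding \<S>_def by simp
  qed
  then obtain M where M: "M \<in> \<S>" and max: "\<And>X. X \<in> \<S> \<Longrightarrow> M \<subseteq> X \<Longrightarrow> X = M" by blast
  from M interpret M: subgroup M "B \<times>\<times> D" unfolding \<S>_def by blast
  from M have fn: "\<And>d. (\<one>\<^bsub>B\<^esub>, d) \<in> M \<Longrightarrow> d = \<one>\<^bsub>D\<^esub>" and M0: "\<Gamma>0 \<subseteq> M" unfolding \<S>_def by blast+
  have total: "\<exists>y. (x, y) \<in> M" if x: "x \<in> carrier B" for x
  proof -
    obtain \<Gamma>' y where \<Gamma>': "subgroup \<Gamma>' (B \<times>\<times> D)" "\<forall>d. (\<one>\<^bsub>B\<^esub>, d) \<in> \<Gamma>' \<longrightarrow> d = \<one>\<^bsub>D\<^esub>" "M \<subseteq> \<Gamma>'" "(x, y) \<in> \<Gamma>'"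
      using graph_extend[OF B D div M.subgroup_axioms fn x] by blast
    then have "\<Gamma>' \<in> \<S>" using M0 unfolding \<S>_def by blast
    then show ?thesis using max \<Gamma>' by blast
  qed
  have uniq: "c = d" if "(b, c) \<in> M" "(b, d) \<in> M" for b c d
  proof -
    have car: "b \<in> carrier B" "c \<in> carrier D" "d \<in> carrier D"
      using M.mem_carrier[OF that(1)] M.mem_carrier[OF that(2)] by auto
    have "(b, c) \<otimes>\<^bsub>B \<times>\<times> D\<^esub> inv\<^bsub>B \<times>\<times> D\<^esub> (b, d) \<in> M"
      using that by blast
    then have "(\<one>\<^bsub>B\<^esub>, c \<otimes>\<^bsub>D\<^esub> inv\<^bsub>D\<^esub> d) \<in> M"
      using car by (simp add: inv_DirProd B.is_group D.is_group)
    then have "c \<otimes>\<^bsub>D\<^esub> inv\<^bsub>D\<^esub> d = \<one>\<^bsub>D\<^esub>" by (rule fn)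
    then show ?thesis using car by (metis D.inv_equality D.inv_inv D.inv_closed)
  qed
  define g where "g x = (SOME y. (x, y) \<in> M)" for x
  have g: "(x, g x) \<in> M" if "x \<in> carrier B" for x
    unfolding g_def using total[OF that] by (rule someI_ex)
  show thesis
  proof
    show "g \<in> hom B D"
    proof (rule homI)
      show "g x \<in> carrier D" if "x \<in> carrier B" for x using M.mem_carrier[OF g[OF that]] by simp
      fix x y assume xy: "x \<in> carrier B" "y \<in> carrier B"
      have "(x \<otimes>\<^bsub>B\<^esub> y, g x \<otimes>\<^bsub>D\<^esub> g y) \<in> M"
        using M.m_closed[OF g[OF xy(1)] g[OF xy(2)]] by simp
      then show "g (x \<otimes>\<^bsub>B\<^esub> y) = g x \<otimes>\<^bsub>D\<^esub> g y"
        using uniq g xy by blast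
    qed
    show "g (i x) = f x" if "x \<in> carrier A" for x
    proof -
      have "(i x, f x) \<in> M" using M0 that unfolding \<Gamma>0_def by auto
      then show ?thesis using uniq g[of "i x"] that by simp
    qed
  qed
qed

text \<open>
  Write \<open>G\<close> as the free abelian group on its elements modulo the relations \<open>K\<close>. Passing to
  rational coefficients embeds this quotient into \<open>\<rat>^(G) / K\<close>, which is divisible because
  \<open>\<rat>^(G)\<close> is. The last conjunct bounds the size of \<open>D\<close>: cosets are determined by chosen
  representatives, which are finitely supported rational functions on \<open>'a\<close>.
\<close>

lemma divisible_embedding:
  fixes G :: "('a, 'b) monoid_scheme"
  assumes "comm_group G"
  shows "\<exists>(D :: ('a \<Rightarrow>\<^sub>0 rat) set monoid) e. comm_group D \<and> divisible D \<and> e \<in> hom G D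
    \<and> inj_on e (carrier G) \<and> inj_on (\<lambda>C. SOME c. c \<in> C) (carrier D)"
proof -
  interpret G: comm_group G by (rule assms)
  define S where "S = carrier G"
  define A :: "('a \<Rightarrow>\<^sub>0 rat) monoid" where "A = \<lparr>carrier = UNIV, mult = (+), one = 0\<rparr>"
  have Asimps: "carrier A = UNIV" "mult A = (+)" "\<one>\<^bsub>A\<^esub> = 0" by (simp_all add: A_def)
  interpret A: comm_group A
  proof (rule comm_groupI)
    fix x assume "x \<in> carrier A"
    have "- x \<otimes>\<^bsub>A\<^esub> x = \<one>\<^bsub>A\<^esub>" by (simp add: Asimps)
    then show "\<exists>y\<in>carrier A. y \<otimes>\<^bsub>A\<^esub> x = \<one>\<^bsub>A\<^esub>" unfolding Asimps by blast
  qed (auto simp: Asimps ac_simps)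
  interpret Z: comm_group "free_Abelian_group S" by (rule abelian_free_Abelian_group)
  obtain h where h: "h \<in> hom (free_Abelian_group S) G" and hf: "\<And>x. x \<in> S \<Longrightarrow> h (frag_of x) = x"
    using G.free_Abelian_group_universal[of "\<lambda>x. x" S] unfolding S_def by auto
  interpret h: group_hom "free_Abelian_group S" G h using h by unfold_locales
  \<comment> \<open>Extension of scalars from the integers to the rationals.\<close>
  define \<iota> :: "('a \<Rightarrow>\<^sub>0 int) \<Rightarrow> ('a \<Rightarrow>\<^sub>0 rat)" where "\<iota> = Poly_Mapping.map of_int"
  have l\<iota>: "Poly_Mapping.lookup (\<iota> z) x = of_int (Poly_Mapping.lookup z x)" for z x
    unfolding \<iota>_def by (simp add: Poly_Mapping.map.rep_eq when_def)
  have \<iota>_diff: "\<iota> (y - z) = \<iota> y - \<iota> z" for y z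
    by (rule poly_mapping_eqI) (simp add: l\<iota> lookup_minus)
  have \<iota>_add: "\<iota> (y + z) = \<iota> y + \<iota> z" for y z
    by (rule poly_mapping_eqI) (simp add: l\<iota> lookup_add)
  have \<iota>_inj: "y = z" if "\<iota> y = \<iota> z" for y z
    by (rule poly_mapping_eqI) (metis l\<iota> of_int_eq_iff that)
  have "\<iota> \<in> hom (free_Abelian_group S) A" by (auto simp: hom_def Asimps \<iota>_add)
  then interpret \<iota>: group_hom "free_Abelian_group S" A \<iota> by unfold_locales
  define K where "K = \<iota> ` kernel (free_Abelian_group S) G h"
  have K: "subgroup K A" unfolding K_def by (rule \<iota>.subgroup_img_is_subgroup[OF h.subgroup_kernel])
  interpret K: normal K A by (simp add: A.normal_iff_subgroup K)
  interpret D: comm_group "A Mod K" by (rule A.abelian_FactGroup[OF K])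
  have Kmem: "K #>\<^bsub>A\<^esub> a = K #>\<^bsub>A\<^esub> b \<longleftrightarrow> b - a \<in> K" for a b
  proof -
    have inv: "inv\<^bsub>A\<^esub> a = - a" by (rule A.inv_equality) (auto simp: Asimps)
    have "K #>\<^bsub>A\<^esub> a = K #>\<^bsub>A\<^esub> b \<longleftrightarrow> b \<in> K #>\<^bsub>A\<^esub> a"
      using A.repr_independence[of b K a] A.rcos_self[of b K] K by (auto simp: Asimps)
    also have "\<dots> \<longleftrightarrow> b - a \<in> K"
      using K.rcos_module[OF A.is_group, of a b] by (simp add: Asimps inv)
    finally show ?thesis .
  qed
  define e where "e g = K #>\<^bsub>A\<^esub> \<iota> (frag_of g)" for g
  show ?thesis
  proof (intro exI conjI)
    show "comm_group (A Mod K)" by (rule D.comm_group_axioms)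
    show "divisible (A Mod K)" unfolding divisible_def
    proof (intro ballI allI impI)
      fix X and n :: nat assume "X \<in> carrier (A Mod K)" and n: "n > 0"
      then obtain a where a: "X = K #>\<^bsub>A\<^esub> a" unfolding carrier_FactGroup by blast
      define b where "b = Poly_Mapping.map (\<lambda>c. c / of_nat n) a"
      have pow: "Poly_Mapping.lookup (c [^]\<^bsub>A\<^esub> k) x = of_nat k * Poly_Mapping.lookup c x" for c x and k :: nat
        by (induction k) (auto simp: Asimps lookup_add algebra_simps)
      have "b [^]\<^bsub>A\<^esub> n = a"
        by (rule poly_mapping_eqI) (use n in \<open>simp add: pow b_def Poly_Mapping.map.rep_eq when_def\<close>)
      then have "(K #>\<^bsub>A\<^esub> b) [^]\<^bsub>A Mod K\<^esub> n = X" using K.FactGroup_pow[of b n] a by (simp add: Asimps)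
      then show "\<exists>Y\<in>carrier (A Mod K). Y [^]\<^bsub>A Mod K\<^esub> n = X"
        unfolding carrier_FactGroup by (auto simp: Asimps)
    qed
    show "e \<in> hom G (A Mod K)"
    proof (rule homI)
      show "e x \<in> carrier (A Mod K)" for x unfolding e_def carrier_FactGroup by (auto simp: Asimps)
      fix x y assume xy: "x \<in> carrier G" "y \<in> carrier G"
      let ?z = "frag_of x + frag_of y - frag_of (x \<otimes>\<^bsub>G\<^esub> y)"
      have keys: "Poly_Mapping.keys (frag_of x) \<subseteq> S" "Poly_Mapping.keys (frag_of y) \<subseteq> S"
        "Poly_Mapping.keys (frag_of (x \<otimes>\<^bsub>G\<^esub> y)) \<subseteq> S" using xy by (auto simp: S_def)
      have "h (frag_of x + frag_of y) = x \<otimes>\<^bsub>G\<^esub> y"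
        using h.hom_mult[of "frag_of x" "frag_of y"] keys hf xy by (simp add: S_def)
      moreover have "h ?z \<otimes>\<^bsub>G\<^esub> h (frag_of (x \<otimes>\<^bsub>G\<^esub> y)) = h (frag_of x + frag_of y)"
        using h.hom_mult[of ?z "frag_of (x \<otimes>\<^bsub>G\<^esub> y)"] keys
        by (simp add: subset_trans[OF keys_diff] subset_trans[OF keys_add])
      moreover have zc: "Poly_Mapping.keys ?z \<subseteq> S"
        using keys keys_diff[of "frag_of x + frag_of y" "frag_of (x \<otimes>\<^bsub>G\<^esub> y)"] keys_add[of "frag_of x" "frag_of y"] by blast
      ultimately have "h ?z = \<one>\<^bsub>G\<^esub>"
        using hf[of "x \<otimes>\<^bsub>G\<^esub> y"] xy h.hom_closed[of ?z] by (simp add: S_def)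
      then have "\<iota> ?z \<in> K" unfolding K_def kernel_def using zc by auto
      then have "e (x \<otimes>\<^bsub>G\<^esub> y) = K #>\<^bsub>A\<^esub> (\<iota> (frag_of x) \<otimes>\<^bsub>A\<^esub> \<iota> (frag_of y))"
        unfolding e_def Kmem by (simp add: Asimps \<iota>_add \<iota>_diff)
      then show "e (x \<otimes>\<^bsub>G\<^esub> y) = e x \<otimes>\<^bsub>A Mod K\<^esub> e y"
        unfolding e_def by (simp add: K.rcos_sum Asimps)
    qed
    show "inj_on e (carrier G)"
    proof (rule inj_onI)
      fix x y assume xy: "x \<in> carrier G" "y \<in> carrier G" and "e x = e y"
      then have "\<iota> (frag_of y - frag_of x) \<in> K" unfolding e_def Kmem \<iota>_diff by simp
      then obtain z where z: "z \<in> kernel (free_Abelian_group S) G h" "frag_of y - frag_of x = z"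
        unfolding K_def using \<iota>_inj by blast
      have zc: "Poly_Mapping.keys z \<subseteq> S" and hz: "h z = \<one>\<^bsub>G\<^esub>" using z(1) unfolding kernel_def by auto
      have "h (frag_of y) = h (z + frag_of x)" using z(2) by (metis diff_add_cancel)
      also have "\<dots> = h z \<otimes>\<^bsub>G\<^esub> h (frag_of x)"
        using h.hom_mult[of z "frag_of x"] zc xy by (simp add: S_def)
      finally show "x = y" using hz hf xy by (simp add: S_def)
    qed
    show "inj_on (\<lambda>C. SOME c. c \<in> C) (carrier (A Mod K))"
    proof (rule inj_onI)
      fix X Y assume X: "X \<in> carrier (A Mod K)" and Y: "Y \<in> carrier (A Mod K)"
        and eq: "(SOME c. c \<in> X) = (SOME c. c \<in> Y)"
      from X Y obtain a b where ab: "X = K #>\<^bsub>A\<^esub> a" "Y = K #>\<^bsub>A\<^esub> b" unfolding carrier_FactGroup by blast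
      have "a \<in> X" "b \<in> Y" unfolding ab using A.rcos_self[of _ K] K by (auto simp: Asimps)
      then have "(SOME c. c \<in> X) \<in> X" "(SOME c. c \<in> Y) \<in> Y" by (auto intro: someI)
      then show "X = Y" using eq ab K.rcos_module[OF A.is_group] A.repr_independence[of "SOME c. c \<in> X" K] K
        by (metis A.repr_independence Asimps(1) UNIV_I)
    qed
  qed
qed

section \<open>Modules, functors and natural transformations\<close>

lemma (in abelian_group) minus_eq_zero_iff:
  assumes "x \<in> carrier G" "y \<in> carrier G"
  shows "x \<ominus> y = \<zero> \<longleftrightarrow> x = y"
  using assms by (metis a_minus_def add.inv_closed minus_equality minus_minus r_neg)

lemma module_homI:
  assumes "\<And>x. x \<in> carrier M \<Longrightarrow> h x \<in> carrier N"
    and "\<And>x y. x \<in> carrier M \<Longrightarrow> y \<in> carrier M \<Longrightarrow> h (x \<oplus>\<^bsub>M\<^esub> y) = h x \<oplus>\<^bsub>N\<^esub> h y"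
    and "\<And>a x. a \<in> carrier R \<Longrightarrow> x \<in> carrier M \<Longrightarrow> h (a \<odot>\<^bsub>M\<^esub> x) = a \<odot>\<^bsub>N\<^esub> h x"
  shows "h \<in> module_hom R M N"
  using assms unfolding module_hom_def by auto

lemma module_homD:
  assumes "h \<in> module_hom R M N"
  shows "x \<in> carrier M \<Longrightarrow> h x \<in> carrier N"
    and "x \<in> carrier M \<Longrightarrow> y \<in> carrier M \<Longrightarrow> h (x \<oplus>\<^bsub>M\<^esub> y) = h x \<oplus>\<^bsub>N\<^esub> h y"
    and "a \<in> carrier R \<Longrightarrow> x \<in> carrier M \<Longrightarrow> h (a \<odot>\<^bsub>M\<^esub> x) = a \<odot>\<^bsub>N\<^esub> h x"
  using assms unfolding module_hom_def by auto

lemma module_hom_group_hom: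
  assumes "module R M" "module R N" "h \<in> module_hom R M N"
  shows "group_hom (add_monoid M) (add_monoid N) h"
proof -
  interpret M: module R M by fact
  interpret N: module R N by fact
  show ?thesis using assms(3)
    by unfold_locales (auto simp: hom_def module_hom_def)
qed

lemma module_hom_zero:
  assumes "module R M" "module R N" "h \<in> module_hom R M N"
  shows "h \<zero>\<^bsub>M\<^esub> = \<zero>\<^bsub>N\<^esub>"
  using group_hom.hom_one[OF module_hom_group_hom[OF assms]] by simp

lemma module_hom_minus:
  assumes "module R M" "module R N" "h \<in> module_hom R M N" "x \<in> carrier M" "y \<in> carrier M"
  shows "h (x \<ominus>\<^bsub>M\<^esub> y) = h x \<ominus>\<^bsub>N\<^esub> h y"
proof -
  interpret M: module R M by fact
  interpret N: module R N by fact
  have "h (\<ominus>\<^bsub>M\<^esub> y) = \<ominus>\<^bsub>N\<^esub> h y"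
    using group_hom.hom_inv[OF module_hom_group_hom[OF assms(1-3)], of y] assms(5)
    by (simp add: a_inv_def)
  then show ?thesis using assms module_homD[OF assms(3)] by (simp add: a_minus_def)
qed

lemma is_functorD:
  assumes "is_functor R Q F"
  shows "p \<in> Q \<Longrightarrow> module R (obj F p)"
    and "p \<in> Q \<Longrightarrow> q \<in> Q \<Longrightarrow> p \<le> q \<Longrightarrow> res F q p \<in> module_hom R (obj F q) (obj F p)"
    and "p \<in> Q \<Longrightarrow> x \<in> carrier (obj F p) \<Longrightarrow> res F p p x = x"
    and "p \<in> Q \<Longrightarrow> q \<in> Q \<Longrightarrow> r \<in> Q \<Longrightarrow> p \<le> q \<Longrightarrow> q \<le> r \<Longrightarrow> x \<in> carrier (obj F r)
      \<Longrightarrow> res F q p (res F r q x) = res F r p x"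
    and "p \<in> Q \<Longrightarrow> q \<in> Q \<Longrightarrow> p \<le> q \<Longrightarrow> x \<in> carrier (obj F q) \<Longrightarrow> res F q p x \<in> carrier (obj F p)"
  using assms unfolding is_functor_def by (auto dest: module_homD(1))

lemma res_zero:
  assumes "is_functor R Q F" "p \<in> Q" "q \<in> Q" "p \<le> q"
  shows "res F q p \<zero>\<^bsub>obj F q\<^esub> = \<zero>\<^bsub>obj F p\<^esub>"
  using assms by (meson is_functorD module_hom_zero)

lemma nat_transD:
  assumes "nat_trans R Q F G \<eta>"
  shows "p \<in> Q \<Longrightarrow> \<eta> p \<in> module_hom R (obj F p) (obj G p)"
    and "p \<in> Q \<Longrightarrow> q \<in> Q \<Longrightarrow> p \<le> q \<Longrightarrow> x \<in> carrier (obj F q) \<Longrightarrow> \<eta> p (res F q p x) = res G q p (\<eta> q x)"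
    and "p \<in> Q \<Longrightarrow> x \<in> carrier (obj F p) \<Longrightarrow> \<eta> p x \<in> carrier (obj G p)"
  using assms unfolding nat_trans_def by (auto dest: module_homD(1))

lemma nat_trans_zero:
  assumes "is_functor R Q F" "is_functor R Q G" "nat_trans R Q F G \<eta>" "p \<in> Q"
  shows "\<eta> p \<zero>\<^bsub>obj F p\<^esub> = \<zero>\<^bsub>obj G p\<^esub>"
  using assms by (meson is_functorD module_hom_zero nat_transD)

lemma nat_trans_id:
  assumes "is_functor R Q F"
  shows "nat_trans R Q F F (\<lambda>p x. x)"
  using is_functorD[OF assms] unfolding nat_trans_def module_hom_def by auto

lemma nat_trans_comp:
  assumes "nat_trans R Q F G \<eta>" "nat_trans R Q G H \<theta>"
  shows "nat_trans R Q F H (\<lambda>p x. \<theta> p (\<eta> p x))"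
  using assms unfolding nat_trans_def module_hom_def by (simp add: Pi_iff)

lemma nat_trans_diff:
  assumes F: "is_functor R Q F" and G: "is_functor R Q G"
    and \<eta>: "nat_trans R Q F G \<eta>" and \<theta>: "nat_trans R Q F G \<theta>"
  shows "nat_trans R Q F G (\<lambda>p x. \<eta> p x \<ominus>\<^bsub>obj G p\<^esub> \<theta> p x)"
  unfolding nat_trans_def
proof (intro conjI ballI impI)
  fix p assume p: "p \<in> Q"
  interpret Gp: module R "obj G p" by (rule is_functorD(1)[OF G p])
  note \<eta>p = module_homD[OF nat_transD(1)[OF \<eta> p]] and \<theta>p = module_homD[OF nat_transD(1)[OF \<theta> p]]
  show "(\<lambda>x. \<eta> p x \<ominus>\<^bsub>obj G p\<^esub> \<theta> p x) \<in> module_hom R (obj F p) (obj G p)"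
  proof (rule module_homI)
    fix x y assume "x \<in> carrier (obj F p)" "y \<in> carrier (obj F p)"
    then show "\<eta> p (x \<oplus>\<^bsub>obj F p\<^esub> y) \<ominus>\<^bsub>obj G p\<^esub> \<theta> p (x \<oplus>\<^bsub>obj F p\<^esub> y)
        = \<eta> p x \<ominus>\<^bsub>obj G p\<^esub> \<theta> p x \<oplus>\<^bsub>obj G p\<^esub> (\<eta> p y \<ominus>\<^bsub>obj G p\<^esub> \<theta> p y)"
      using \<eta>p \<theta>p by (simp add: a_minus_def Gp.M.minus_add Gp.M.a_ac)
  next
    fix a x assume "a \<in> carrier R" "x \<in> carrier (obj F p)"
    then show "\<eta> p (a \<odot>\<^bsub>obj F p\<^esub> x) \<ominus>\<^bsub>obj G p\<^esub> \<theta> p (a \<odot>\<^bsub>obj F p\<^esub> x)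
        = a \<odot>\<^bsub>obj G p\<^esub> (\<eta> p x \<ominus>\<^bsub>obj G p\<^esub> \<theta> p x)"
      using \<eta>p \<theta>p by (simp add: a_minus_def Gp.smult_r_distr Gp.smult_r_minus)
  qed (use \<eta>p \<theta>p in simp)
next
  fix p q x assume *: "p \<in> Q" "q \<in> Q" "p \<le> q" "x \<in> carrier (obj F q)"
  then show "\<eta> p (res F q p x) \<ominus>\<^bsub>obj G p\<^esub> \<theta> p (res F q p x)
      = res G q p (\<eta> q x \<ominus>\<^bsub>obj G q\<^esub> \<theta> q x)"
    using module_hom_minus[OF is_functorD(1)[OF G *(2)] is_functorD(1)[OF G *(1)] is_functorD(2)[OF G *(1-3)]]
      nat_transD(2)[OF \<eta> *] nat_transD(2)[OF \<theta> *] nat_transD(3)[OF \<eta>] nat_transD(3)[OF \<theta>] by simp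
qed

lemma nat_trans_inv:
  assumes F: "is_functor R Q F" and \<eta>: "nat_trans R Q F G \<eta>"
    and bij: "\<And>p. p \<in> Q \<Longrightarrow> bij_betw (\<eta> p) (carrier (obj F p)) (carrier (obj G p))"
  shows "nat_trans R Q G F (\<lambda>p. inv_into (carrier (obj F p)) (\<eta> p))"
proof -
  have inv_eq: "inv_into (carrier (obj F p)) (\<eta> p) y = x"
    if "p \<in> Q" "x \<in> carrier (obj F p)" "\<eta> p x = y" for p x y
    using bij[OF that(1)] that by (auto simp: bij_betw_def)
  have rep: "\<exists>x\<in>carrier (obj F p). \<eta> p x = y" if "p \<in> Q" "y \<in> carrier (obj G p)" for p y
    using bij[OF that(1)] that(2) unfolding bij_betw_def by (metis imageE)
  show ?thesis
    unfolding nat_trans_def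
  proof (intro conjI ballI impI)
    fix p assume p: "p \<in> Q"
    interpret Fp: module R "obj F p" by (rule is_functorD(1)[OF F p])
    note h = module_homD[OF nat_transD(1)[OF \<eta> p]]
    show "inv_into (carrier (obj F p)) (\<eta> p) \<in> module_hom R (obj G p) (obj F p)"
    proof (rule module_homI)
      fix x assume "x \<in> carrier (obj G p)"
      then show "inv_into (carrier (obj F p)) (\<eta> p) x \<in> carrier (obj F p)"
        using rep[OF p] inv_eq[OF p] by metis
    next
      fix x y assume "x \<in> carrier (obj G p)" "y \<in> carrier (obj G p)"
      then obtain x' y' where "x' \<in> carrier (obj F p)" "\<eta> p x' = x" "y' \<in> carrier (obj F p)" "\<eta> p y' = y"
        using rep[OF p] by meson
      then show "inv_into (carrier (obj F p)) (\<eta> p) (x \<oplus>\<^bsub>obj G p\<^esub> y)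
          = inv_into (carrier (obj F p)) (\<eta> p) x \<oplus>\<^bsub>obj F p\<^esub> inv_into (carrier (obj F p)) (\<eta> p) y"
        by (auto simp: inv_eq[OF p] h intro!: inv_eq[OF p])
    next
      fix a y assume a: "a \<in> carrier R" and "y \<in> carrier (obj G p)"
      then obtain y' where "y' \<in> carrier (obj F p)" "\<eta> p y' = y"
        using rep[OF p] by meson
      with a show "inv_into (carrier (obj F p)) (\<eta> p) (a \<odot>\<^bsub>obj G p\<^esub> y)
          = a \<odot>\<^bsub>obj F p\<^esub> inv_into (carrier (obj F p)) (\<eta> p) y"
        by (auto simp: inv_eq[OF p] h intro!: inv_eq[OF p])
    qed
  next
    fix p q y assume *: "p \<in> Q" "q \<in> Q" "p \<le> q" "y \<in> carrier (obj G q)"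
    then obtain x where x: "x \<in> carrier (obj F q)" "\<eta> q x = y" using rep by meson
    show "inv_into (carrier (obj F p)) (\<eta> p) (res G q p y) = res F q p (inv_into (carrier (obj F q)) (\<eta> q) y)"
      unfolding inv_eq[OF *(2) x]
      using nat_transD(2)[OF \<eta> *(1-3) x(1)] x is_functorD(5)[OF F *(1-3) x(1)] by (intro inv_eq) (use * in auto)
  qed
qed

lemma is_functor_mono:
  assumes "is_functor R P F" "Q \<subseteq> P"
  shows "is_functor R Q F"
  using assms unfolding is_functor_def by (meson subsetD)

lemma nat_trans_mono:
  assumes "nat_trans R P F G \<eta>" "Q \<subseteq> P"
  shows "nat_trans R Q F G \<eta>"
  using assms unfolding nat_trans_def by (meson subsetD)

text \<open>
  One construction serves for quotients and for isomorphic copies: \<open>\<rho>\<close> is either an injection into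
  another type, or a choice of a representative in every coset of a submodule. In the second case
  the quotient takes its elements from the same type as \<open>M\<close>.
\<close>

definition image_module :: "('v \<Rightarrow> 'w) \<Rightarrow> ('r, 'v) module \<Rightarrow> ('r, 'w) module" where
  "image_module \<rho> M =
     \<lparr>carrier = \<rho> ` carrier M, mult = undefined, one = undefined, ring.zero = \<rho> \<zero>\<^bsub>M\<^esub>,
      add = (\<lambda>x y. \<rho> (inv_into (carrier M) \<rho> x \<oplus>\<^bsub>M\<^esub> inv_into (carrier M) \<rho> y)),
      smult = (\<lambda>a x. \<rho> (a \<odot>\<^bsub>M\<^esub> inv_into (carrier M) \<rho> x))\<rparr>"

definition image_functor ::
  "('p \<Rightarrow> 'v \<Rightarrow> 'w) \<Rightarrow> ('p, 'r, 'v) pfunctor \<Rightarrow> ('p, 'r, 'w) pfunctor" where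
  "image_functor \<rho> G =
     \<lparr>obj = (\<lambda>p. image_module (\<rho> p) (obj G p)),
      res = (\<lambda>q p x. \<rho> p (res G q p (inv_into (carrier (obj G q)) (\<rho> q) x)))\<rparr>"

definition module_congruence :: "('r, 'x) ring_scheme \<Rightarrow> ('r, 'v) module \<Rightarrow> ('v \<Rightarrow> 'w) \<Rightarrow> bool" where
  "module_congruence R M \<rho> \<longleftrightarrow>
     (\<forall>x\<in>carrier M. \<forall>x'\<in>carrier M. \<rho> x = \<rho> x' \<longrightarrow>
        (\<forall>y\<in>carrier M. \<rho> (x \<oplus>\<^bsub>M\<^esub> y) = \<rho> (x' \<oplus>\<^bsub>M\<^esub> y)) \<and>
        (\<forall>a\<in>carrier R. \<rho> (a \<odot>\<^bsub>M\<^esub> x) = \<rho> (a \<odot>\<^bsub>M\<^esub> x')))"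

lemma image_module:
  assumes M: "module R M" and cong: "module_congruence R M \<rho>"
  shows "module R (image_module \<rho> M)" and "\<rho> \<in> module_hom R M (image_module \<rho> M)"
proof -
  interpret M: module R M by fact
  let ?N = "image_module \<rho> M"
  have sel: "inv_into (carrier M) \<rho> (\<rho> x) \<in> carrier M" "\<rho> (inv_into (carrier M) \<rho> (\<rho> x)) = \<rho> x"
    if "x \<in> carrier M" for x
    using that by (auto intro: inv_into_into f_inv_into_f)
  have add: "\<rho> x \<oplus>\<^bsub>?N\<^esub> \<rho> y = \<rho> (x \<oplus>\<^bsub>M\<^esub> y)" if xy: "x \<in> carrier M" "y \<in> carrier M" for x y
  proof -
    let ?x = "inv_into (carrier M) \<rho> (\<rho> x)" and ?y = "inv_into (carrier M) \<rho> (\<rho> y)"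
    have "\<rho> (?x \<oplus>\<^bsub>M\<^esub> ?y) = \<rho> (x \<oplus>\<^bsub>M\<^esub> ?y)"
      using cong sel[OF xy(1)] sel[OF xy(2)] xy unfolding module_congruence_def by blast
    also have "\<dots> = \<rho> (?y \<oplus>\<^bsub>M\<^esub> x)" using xy sel by (simp add: M.M.a_comm)
    also have "\<dots> = \<rho> (y \<oplus>\<^bsub>M\<^esub> x)"
      using cong sel[OF xy(2)] xy unfolding module_congruence_def by blast
    finally show ?thesis using xy by (simp add: image_module_def M.M.a_comm)
  qed
  have smult: "a \<odot>\<^bsub>?N\<^esub> \<rho> x = \<rho> (a \<odot>\<^bsub>M\<^esub> x)" if "a \<in> carrier R" "x \<in> carrier M" for a x
  proof -
    have "\<rho> (a \<odot>\<^bsub>M\<^esub> inv_into (carrier M) \<rho> (\<rho> x)) = \<rho> (a \<odot>\<^bsub>M\<^esub> x)"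
      using cong sel[OF that(2)] that unfolding module_congruence_def by blast
    then show ?thesis by (simp add: image_module_def)
  qed
  have zero: "\<zero>\<^bsub>?N\<^esub> = \<rho> \<zero>\<^bsub>M\<^esub>" and carr: "carrier ?N = \<rho> ` carrier M"
    by (simp_all add: image_module_def)
  show "\<rho> \<in> module_hom R M ?N"
    by (rule module_homI) (simp_all add: carr add smult)
  show "module R ?N"
  proof (rule moduleI)
    show "abelian_group ?N"
    proof (rule abelian_groupI)
      fix x assume "x \<in> carrier ?N"
      then obtain x' where x': "x' \<in> carrier M" "x = \<rho> x'" unfolding carr by blast
      then have "\<rho> (\<ominus>\<^bsub>M\<^esub> x') \<oplus>\<^bsub>?N\<^esub> x = \<zero>\<^bsub>?N\<^esub>" by (simp add: add zero M.M.l_neg)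
      then show "\<exists>y\<in>carrier ?N. y \<oplus>\<^bsub>?N\<^esub> x = \<zero>\<^bsub>?N\<^esub>" using x' by (auto simp: carr)
    qed (auto simp: carr zero add M.M.a_ac)
  qed (auto simp: carr add smult M.smult_l_distr M.smult_r_distr M.smult_assoc1 M.R.is_cring)
qed

lemma image_functor:
  assumes G: "is_functor R Q G"
    and cong: "\<And>p. p \<in> Q \<Longrightarrow> module_congruence R (obj G p) (\<rho> p)"
    and cong_res: "\<And>p q x y. p \<in> Q \<Longrightarrow> q \<in> Q \<Longrightarrow> p \<le> q \<Longrightarrow> x \<in> carrier (obj G q) \<Longrightarrow> y \<in> carrier (obj G q)
      \<Longrightarrow> \<rho> q x = \<rho> q y \<Longrightarrow> \<rho> p (res G q p x) = \<rho> p (res G q p y)"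
  shows "is_functor R Q (image_functor \<rho> G)" and "nat_trans R Q G (image_functor \<rho> G) \<rho>"
proof -
  let ?H = "image_functor \<rho> G"
  note mod = image_module[OF is_functorD(1)[OF G] cong]
  have objH: "obj ?H p = image_module (\<rho> p) (obj G p)" for p by (simp add: image_functor_def)
  have carr: "carrier (obj ?H p) = \<rho> p ` carrier (obj G p)" for p by (simp add: objH image_module_def)
  have resH: "res ?H q p (\<rho> q x) = \<rho> p (res G q p x)"
    if "p \<in> Q" "q \<in> Q" "p \<le> q" "x \<in> carrier (obj G q)" for p q x
    unfolding image_functor_def pfunctor.simps
    by (rule cong_res) (use that in \<open>auto intro: inv_into_into f_inv_into_f\<close>)
  show "nat_trans R Q G ?H \<rho>"
    unfolding nat_trans_def using mod(2) resH by (auto simp: objH)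
  show "is_functor R Q ?H"
    unfolding is_functor_def
  proof (intro conjI ballI impI)
    show "module R (obj ?H p)" if "p \<in> Q" for p unfolding objH by (rule mod(1)[OF that that])
    fix p assume p: "p \<in> Q"
    show "res ?H p p x = x" if "x \<in> carrier (obj ?H p)" for x
      using that p is_functorD(3)[OF G p] by (auto simp: carr resH)
    fix q assume q: "q \<in> Q" and pq: "p \<le> q"
    note hp = module_homD(2,3)[OF mod(2)[OF p p], folded objH, symmetric]
    note hq = module_homD(2,3)[OF mod(2)[OF q q], folded objH, symmetric]
    note rG = module_homD[OF is_functorD(2)[OF G p q pq]]
    interpret Gq: module R "obj G q" by (rule is_functorD(1)[OF G q])
    show "res ?H q p \<in> module_hom R (obj ?H q) (obj ?H p)"
      by (rule module_homI)
        (auto simp: carr resH p q pq rG hp hq)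
    fix r x assume r: "r \<in> Q" "q \<le> r" and x: "x \<in> carrier (obj ?H r)"
    then obtain y where "y \<in> carrier (obj G r)" "x = \<rho> r y" by (auto simp: carr)
    then show "res ?H q p (res ?H r q x) = res ?H r p x"
      using p q r pq order_trans[OF pq r(2)] by (simp add: resH is_functorD[OF G])
  qed
qed

lemma carrier_image_functor [simp]: "carrier (obj (image_functor \<rho> G) p) = \<rho> p ` carrier (obj G p)"
  by (simp add: image_functor_def image_module_def)

lemma image_functor_inj:
  assumes G: "is_functor R Q G"
    and inj: "\<And>p. p \<in> Q \<Longrightarrow> inj_on (\<rho> p) (carrier (obj G p))"
  shows "is_functor R Q (image_functor \<rho> G)" and "nat_trans R Q G (image_functor \<rho> G) \<rho>"
    and "nat_trans R Q (image_functor \<rho> G) G (\<lambda>p. inv_into (carrier (obj G p)) (\<rho> p))"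
proof -
  have cong: "module_congruence R (obj G p) (\<rho> p)" if "p \<in> Q" for p
    unfolding module_congruence_def using inj[OF that] by (auto dest: inj_onD)
  have r: "\<rho> p (res G q p x) = \<rho> p (res G q p y)"
    if "p \<in> Q" "q \<in> Q" "p \<le> q" "x \<in> carrier (obj G q)" "y \<in> carrier (obj G q)" "\<rho> q x = \<rho> q y" for p q x y
    using inj_onD[OF inj[OF that(2)] that(6,4,5)] by simp
  show "is_functor R Q (image_functor \<rho> G)"
    by (rule image_functor(1)[where \<rho> = \<rho>, OF G cong r])
  show \<rho>: "nat_trans R Q G (image_functor \<rho> G) \<rho>"
    by (rule image_functor(2)[where \<rho> = \<rho>, OF G cong r])
  show "nat_trans R Q (image_functor \<rho> G) G (\<lambda>p. inv_into (carrier (obj G p)) (\<rho> p))"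
    by (rule nat_trans_inv[OF G \<rho>]) (simp add: bij_betw_def inj)
qed

lemma submodule_range:
  assumes M: "module R M" and N: "module R N" and h: "h \<in> module_hom R M N"
  shows "submodule (h ` carrier M) R N"
proof -
  interpret M: module R M by fact
  interpret N: module R N by fact
  interpret h: group_hom "add_monoid M" "add_monoid N" h by (rule module_hom_group_hom[OF assms])
  show ?thesis
  proof (rule N.submoduleI)
    show "h ` carrier M \<subseteq> carrier N" using module_homD(1)[OF h] by auto
    show "\<zero>\<^bsub>N\<^esub> \<in> h ` carrier M" using module_hom_zero[OF assms] M.M.zero_closed by (metis imageI)
    show "\<ominus>\<^bsub>N\<^esub> a \<in> h ` carrier M" if a: "a \<in> h ` carrier M" for a
      using a subgroup.m_inv_closed[OF h.img_is_subgroup, of a] by (simp add: a_inv_def)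
    show "a \<oplus>\<^bsub>N\<^esub> b \<in> h ` carrier M" if "a \<in> h ` carrier M" "b \<in> h ` carrier M" for a b
      using subgroup.m_closed[OF h.img_is_subgroup, of a b] that by simp
    show "a \<odot>\<^bsub>N\<^esub> x \<in> h ` carrier M" if "a \<in> carrier R" "x \<in> h ` carrier M" for a x
      using that module_homD(3)[OF h, symmetric] by auto
  qed
qed

definition range_functor ::
  "('p, 'r, 'm) pfunctor \<Rightarrow> ('p, 'r, 'n) pfunctor \<Rightarrow> ('p \<Rightarrow> 'm \<Rightarrow> 'n) \<Rightarrow> ('p, 'r, 'n) pfunctor" where
  "range_functor X Y d =
     \<lparr>obj = (\<lambda>p. (obj Y p)\<lparr>carrier := d p ` carrier (obj X p)\<rparr>), res = res Y\<rparr>"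

lemma range_functor:
  assumes X: "is_functor R Q X" and Y: "is_functor R Q Y" and d: "nat_trans R Q X Y d"
  shows "is_functor R Q (range_functor X Y d)"
    and "nat_trans R Q (range_functor X Y d) Y (\<lambda>p x. x)"
proof -
  note dc = nat_transD(3)[OF d] and dr = nat_transD(2)[OF d]
  show "nat_trans R Q (range_functor X Y d) Y (\<lambda>p x. x)"
    unfolding nat_trans_def range_functor_def module_hom_def using dc by auto
  have m: "module R (obj (range_functor X Y d) p)" if "p \<in> Q" for p
    unfolding range_functor_def pfunctor.simps
    by (rule submodule.submodule_is_module[OF submodule_range])
      (use is_functorD[OF X] is_functorD[OF Y] nat_transD[OF d] that in auto)
  show "is_functor R Q (range_functor X Y d)"
    unfolding is_functor_def
  proof (intro conjI ballI impI)
    fix p assume p: "p \<in> Q"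
    show "module R (obj (range_functor X Y d) p)" by (rule m[OF p])
    show "res (range_functor X Y d) p p x = x" if "x \<in> carrier (obj (range_functor X Y d) p)" for x
      using that dc[OF p] is_functorD(3)[OF Y p] by (auto simp: range_functor_def)
    fix q assume q: "q \<in> Q" and pq: "p \<le> q"
    show "res (range_functor X Y d) q p \<in> module_hom R (obj (range_functor X Y d) q) (obj (range_functor X Y d) p)"
      using module_homD[OF is_functorD(2)[OF Y p q pq]] dc[OF q] dr[OF p q pq, symmetric] is_functorD(5)[OF X p q pq]
      by (intro module_homI) (auto simp: range_functor_def)
    fix r x assume "r \<in> Q" "q \<le> r" "x \<in> carrier (obj (range_functor X Y d) r)"
    then show "res (range_functor X Y d) q p (res (range_functor X Y d) r q x) = res (range_functor X Y d) r p x"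
      using is_functorD(4)[OF Y p q _ pq] dc by (auto simp: range_functor_def)
  qed
qed

section \<open>Injective functors\<close>

lemma injective_functorD:
  assumes "injective_functor R Q I"
  shows "is_functor R Q I"
  using assms unfolding injective_functor_def by blast

text \<open>
  A map \<open>f\<close> that kills the kernel of \<open>d\<close> descends to the range of \<open>d\<close>, a subfunctor of \<open>Y\<close>, and
  extends from there to \<open>Y\<close> because \<open>J\<close> is injective. All chain maps and homotopies between
  resolutions below arise in this way.
\<close>

lemma injective_functor_factor:
  fixes Y J :: "('p::order, 'r, 'u) pfunctor" and X :: "('p, 'r, 'v) pfunctor"
  assumes J: "injective_functor R Q J" and X: "is_functor R Q X" and Y: "is_functor R Q Y"
    and d: "nat_trans R Q X Y d" and f: "nat_trans R Q X J f"
    and ker: "\<And>p x. p \<in> Q \<Longrightarrow> x \<in> carrier (obj X p) \<Longrightarrow> d p x = \<zero>\<^bsub>obj Y p\<^esub> \<Longrightarrow> f p x = \<zero>\<^bsub>obj J p\<^esub>"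
  shows "\<exists>g. nat_trans R Q Y J g \<and> (\<forall>p\<in>Q. \<forall>x\<in>carrier (obj X p). g p (d p x) = f p x)"
proof -
  let ?A = "range_functor X Y d"
  note Jf = injective_functorD[OF J]
  note A = range_functor[OF X Y d]
  define h where "h p y = f p (inv_into (carrier (obj X p)) (d p) y)" for p y
  have hd: "h p (d p x) = f p x" if p: "p \<in> Q" and x: "x \<in> carrier (obj X p)" for p x
  proof -
    let ?x = "inv_into (carrier (obj X p)) (d p) (d p x)"
    interpret Xp: module R "obj X p" by (rule is_functorD(1)[OF X p])
    interpret Yp: module R "obj Y p" by (rule is_functorD(1)[OF Y p])
    interpret Jp: module R "obj J p" by (rule is_functorD(1)[OF Jf p])
    have x': "?x \<in> carrier (obj X p)" "d p ?x = d p x" using x by (auto intro: inv_into_into f_inv_into_f)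
    have "d p (?x \<ominus>\<^bsub>obj X p\<^esub> x) = \<zero>\<^bsub>obj Y p\<^esub>"
      using module_hom_minus[OF Xp.module_axioms Yp.module_axioms nat_transD(1)[OF d p] x'(1) x]
        x'(2) nat_transD(3)[OF d p x] by (simp add: a_minus_def Yp.M.r_neg)
    then have "f p (?x \<ominus>\<^bsub>obj X p\<^esub> x) = \<zero>\<^bsub>obj J p\<^esub>" using ker[OF p] x x' by simp
    then have "f p ?x \<ominus>\<^bsub>obj J p\<^esub> f p x = \<zero>\<^bsub>obj J p\<^esub>"
      using module_hom_minus[OF Xp.module_axioms Jp.module_axioms nat_transD(1)[OF f p] x'(1) x] by simp
    then show ?thesis
      unfolding h_def using nat_transD(3)[OF f p x] nat_transD(3)[OF f p x'(1)] by (simp add: Jp.M.minus_eq_zero_iff)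
  qed
  have "nat_trans R Q ?A J h"
    unfolding nat_trans_def
  proof (intro conjI ballI impI)
    fix p assume p: "p \<in> Q"
    interpret Xp: module R "obj X p" by (rule is_functorD(1)[OF X p])
    note dh = module_homD(2,3)[OF nat_transD(1)[OF d p], symmetric]
    note fh = module_homD[OF nat_transD(1)[OF f p]]
    show "h p \<in> module_hom R (obj ?A p) (obj J p)"
      by (rule module_homI) (auto simp: range_functor_def hd[OF p] dh fh)
    fix q y assume q: "q \<in> Q" "p \<le> q" and y: "y \<in> carrier (obj ?A q)"
    then obtain x where x: "x \<in> carrier (obj X q)" "y = d q x" by (auto simp: range_functor_def)
    show "h p (res ?A q p y) = res J q p (h q y)"
      using x p q hd[OF q(1) x(1)] nat_transD(2)[OF d p q x(1), symmetric] nat_transD(2)[OF f p q x(1)]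
        is_functorD(5)[OF X p q x(1)] hd[OF p] by (simp add: range_functor_def)
  qed
  moreover have "mono_trans Q ?A (\<lambda>p x. x)" unfolding mono_trans_def by simp
  ultimately obtain g where g: "nat_trans R Q Y J g"
    and gh: "\<And>p x. p \<in> Q \<Longrightarrow> x \<in> carrier (obj ?A p) \<Longrightarrow> g p x = h p x"
    using J A Y unfolding injective_functor_def by blast
  have "g p (d p x) = f p x" if "p \<in> Q" "x \<in> carrier (obj X p)" for p x
    using gh[OF that(1), of "d p x"] that hd by (simp add: range_functor_def)
  then show ?thesis using g by blast
qed

text \<open>
  Injectivity is tested on functors whose elements have the same type as those of \<open>I\<close>. The extension
  property for test functors on any smaller type follows, since only the target \<open>Y\<close> of
  \<open>injective_functor_factor\<close>, here a copy of \<open>B\<close>, has to live in that type.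
\<close>

lemma injective_functor_extend:
  fixes I :: "('p::order, 'r, 'u) pfunctor" and A B :: "('p, 'r, 'v) pfunctor" and c :: "'v \<Rightarrow> 'u"
  assumes I: "injective_functor R Q I" and c: "inj c"
    and A: "is_functor R Q A" and B: "is_functor R Q B"
    and i: "nat_trans R Q A B i" and mono: "mono_trans Q A i" and f: "nat_trans R Q A I f"
  shows "\<exists>g. nat_trans R Q B I g \<and> (\<forall>p\<in>Q. \<forall>x\<in>carrier (obj A p). g p (i p x) = f p x)"
proof -
  have cB: "inj_on c (carrier (obj B p))" for p using c by (rule inj_on_subset) simp
  let ?B = "image_functor (\<lambda>_. c) B"
  note B' = image_functor_inj[where \<rho> = "\<lambda>_. c", OF B cB]
  have d: "nat_trans R Q A ?B (\<lambda>p x. c (i p x))" by (rule nat_trans_comp[OF i B'(2)])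
  have "x = \<zero>\<^bsub>obj A p\<^esub>" if "p \<in> Q" "x \<in> carrier (obj A p)" "c (i p x) = \<zero>\<^bsub>obj ?B p\<^esub>" for p x
  proof -
    interpret Ap: module R "obj A p" by (rule is_functorD(1)[OF A that(1)])
    have "c (i p x) = c (i p \<zero>\<^bsub>obj A p\<^esub>)" using nat_trans_zero[OF A B'(1) d that(1)] that(3) by simp
    then have "i p x = i p \<zero>\<^bsub>obj A p\<^esub>" using c by (simp add: inj_eq)
    then show ?thesis using mono that Ap.M.zero_closed unfolding mono_trans_def by (blast dest: inj_onD)
  qed
  then have "\<exists>g. nat_trans R Q ?B I g \<and> (\<forall>p\<in>Q. \<forall>x\<in>carrier (obj A p). g p (c (i p x)) = f p x)"
    by (intro injective_functor_factor[OF I A B'(1) d f])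
      (use nat_trans_zero[OF A injective_functorD[OF I] f] in auto)
  then obtain g where "nat_trans R Q ?B I g" "\<forall>p\<in>Q. \<forall>x\<in>carrier (obj A p). g p (c (i p x)) = f p x"
    by blast
  then show ?thesis using nat_trans_comp[OF B'(2), of I g] by blast
qed

definition zero_mod :: "('r, 'v) module" where
  "zero_mod = \<lparr>carrier = {undefined}, mult = undefined, one = undefined, ring.zero = undefined,
     add = (\<lambda>_ _. undefined), smult = (\<lambda>_ _. undefined)\<rparr>"

lemma module_zero_mod: "cring R \<Longrightarrow> module R zero_mod"
  by (rule moduleI) (auto simp: zero_mod_def intro: abelian_groupI)

definition zero_extension :: "'p set \<Rightarrow> ('p, 'r, 'v) pfunctor \<Rightarrow> ('p, 'r, 'v) pfunctor" where
  "zero_extension S G =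
     \<lparr>obj = (\<lambda>p. if p \<in> S then obj G p else zero_mod),
      res = (\<lambda>q p x. if q \<in> S then res G q p x else if p \<in> S then \<zero>\<^bsub>obj G p\<^esub> else undefined)\<rparr>"

lemma is_functor_zero_extension:
  assumes R: "cring R" and G: "is_functor R (Q \<inter> S) G"
    and down: "\<And>p q. p \<in> Q \<Longrightarrow> q \<in> Q \<Longrightarrow> p \<le> q \<Longrightarrow> q \<in> S \<Longrightarrow> p \<in> S"
  shows "is_functor R Q (zero_extension S G)"
proof -
  let ?H = "zero_extension S G"
  have m: "module R (obj ?H p)" if "p \<in> Q" for p
    using that is_functorD(1)[OF G] by (simp add: zero_extension_def module_zero_mod[OF R])
  have z: "x = \<zero>\<^bsub>zero_mod\<^esub>" if "x \<in> carrier zero_mod" for x :: 'c using that by (simp add: zero_mod_def)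
  have off: "res ?H q p x = \<zero>\<^bsub>obj ?H p\<^esub>" if "q \<notin> S" for p q x
    using that by (simp add: zero_extension_def zero_mod_def)
  have hom: "res ?H q p \<in> module_hom R (obj ?H q) (obj ?H p)" if pq: "p \<in> Q" "q \<in> Q" "p \<le> q" for p q
  proof (cases "q \<in> S")
    case True
    then have "res ?H q p = res G q p" "obj ?H p = obj G p" "obj ?H q = obj G q"
      using down[OF pq] by (auto simp: zero_extension_def)
    then show ?thesis using is_functorD(2)[OF G] True down[OF pq] pq by simp
  next
    case False
    interpret Hp: module R "obj ?H p" by (rule m[OF pq(1)])
    show ?thesis by (rule module_homI) (simp_all add: off[OF False])
  qed
  show ?thesis
    unfolding is_functor_def
  proof (intro conjI ballI impI m hom)
    fix p x assume "p \<in> Q" "x \<in> carrier (obj ?H p)"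
    then show "res ?H p p x = x"
      using is_functorD(3)[OF G, of p] by (auto simp: zero_extension_def zero_mod_def split: if_splits)
  next
    fix p q r x assume *: "p \<in> Q" "q \<in> Q" "r \<in> Q" "p \<le> q" "q \<le> r" "x \<in> carrier (obj ?H r)"
    show "res ?H q p (res ?H r q x) = res ?H r p x"
    proof (cases "r \<in> S")
      case True
      then have "q \<in> S" "p \<in> S" using down * by blast+
      then show ?thesis using True * is_functorD(4)[OF G, of p q r] by (simp add: zero_extension_def)
    next
      case False
      then show ?thesis
        using module_hom_zero[OF m m hom, of q p] * by (simp add: off)
    qed
  qed
qed

lemma nat_trans_zero_extension:
  assumes R: "cring R" and G: "is_functor R (Q \<inter> S) G" and H: "is_functor R Q H"
    and down: "\<And>p q. p \<in> Q \<Longrightarrow> q \<in> Q \<Longrightarrow> p \<le> q \<Longrightarrow> q \<in> S \<Longrightarrow> p \<in> S"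
    and \<eta>: "nat_trans R (Q \<inter> S) G H \<eta>"
  shows "nat_trans R Q (zero_extension S G) H (\<lambda>p x. if p \<in> S then \<eta> p x else \<zero>\<^bsub>obj H p\<^esub>)"
    (is "nat_trans R Q ?G H ?\<eta>")
  unfolding nat_trans_def
proof (intro conjI ballI impI)
  fix p assume p: "p \<in> Q"
  interpret Hp: module R "obj H p" by (rule is_functorD(1)[OF H p])
  show "?\<eta> p \<in> module_hom R (obj ?G p) (obj H p)"
  proof (cases "p \<in> S")
    case True
    then show ?thesis using nat_transD(1)[OF \<eta>, of p] p by (simp add: zero_extension_def)
  next
    case False
    then show ?thesis by (intro module_homI) simp_all
  qed
  fix q x assume q: "q \<in> Q" "p \<le> q" and x: "x \<in> carrier (obj ?G q)"
  show "?\<eta> p (res ?G q p x) = res H q p (?\<eta> q x)"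
  proof (cases "q \<in> S")
    case True
    then have "p \<in> S" using down p q by blast
    then show ?thesis using True nat_transD(2)[OF \<eta>, of p q x] p q x by (simp add: zero_extension_def)
  next
    case False
    then show ?thesis
      using res_zero[OF H p q] nat_trans_zero[OF G is_functor_mono[OF H] \<eta>, of p] p
      by (auto simp: zero_extension_def)
  qed
qed

text \<open>
  Extension by zero is left adjoint to restriction to a down-closed subset, and it preserves
  monomorphisms. Hence restriction preserves injective objects.
\<close>

lemma injective_functor_restrict:
  fixes I :: "('p::order, 'r, 'u) pfunctor" and R :: "('r, 'x) ring_scheme"
  assumes R: "cring R" and I: "injective_functor R P I" and QP: "Q \<subseteq> P"
    and down: "\<And>p q. p \<in> P \<Longrightarrow> q \<in> Q \<Longrightarrow> p \<le> q \<Longrightarrow> p \<in> Q"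
  shows "injective_functor R Q I"
  unfolding injective_functor_def
proof (intro conjI allI impI)
  note If = injective_functorD[OF I]
  show "is_functor R Q I" by (rule is_functor_mono[OF If QP])
  fix A B :: "('p, 'r, 'u) pfunctor" and i f
  assume A: "is_functor R Q A" and B: "is_functor R Q B" and i: "nat_trans R Q A B i"
    and mono: "mono_trans Q A i" and f: "nat_trans R Q A I f"
  have PQ: "P \<inter> Q = Q" using QP by blast
  let ?A = "zero_extension Q A" and ?B = "zero_extension Q B"
  have d: "p \<in> Q" if "p \<in> P" "q \<in> P" "p \<le> q" "q \<in> Q" for p q by (rule down[OF that(1,4,3)])
  have A0: "is_functor R (P \<inter> Q) A" and B0: "is_functor R (P \<inter> Q) B" using A B PQ by simp_all
  have A': "is_functor R P ?A" and B': "is_functor R P ?B"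
    by (rule is_functor_zero_extension[OF R A0 d] is_functor_zero_extension[OF R B0 d]; assumption)+
  have iB: "nat_trans R Q A ?B i"
    using i unfolding nat_trans_def by (auto simp: zero_extension_def)
  have i': "nat_trans R P ?A ?B (\<lambda>p x. if p \<in> Q then i p x else \<zero>\<^bsub>obj ?B p\<^esub>)" (is "nat_trans R P _ _ ?i")
    by (rule nat_trans_zero_extension[OF R A0 B' d]) (simp_all add: PQ iB)
  have f': "nat_trans R P ?A I (\<lambda>p x. if p \<in> Q then f p x else \<zero>\<^bsub>obj I p\<^esub>)" (is "nat_trans R P _ _ ?f")
    by (rule nat_trans_zero_extension[OF R A0 If d]) (simp_all add: PQ f)
  have "mono_trans P ?A ?i"
    using mono unfolding mono_trans_def by (auto simp: zero_extension_def zero_mod_def)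
  then obtain g where g: "nat_trans R P ?B I g"
    and gi: "\<And>p x. p \<in> P \<Longrightarrow> x \<in> carrier (obj ?A p) \<Longrightarrow> g p (?i p x) = ?f p x"
    using I[unfolded injective_functor_def, THEN conjunct2, rule_format, OF A' B' i' _ f'] by blast
  have "nat_trans R Q B I g"
    using nat_trans_mono[OF g QP] unfolding nat_trans_def by (auto simp: zero_extension_def)
  moreover have "g p (i p x) = f p x" if "p \<in> Q" "x \<in> carrier (obj A p)" for p x
    using gi[of p x] that QP by (auto simp: zero_extension_def)
  ultimately show "\<exists>g. nat_trans R Q B I g \<and> (\<forall>p\<in>Q. \<forall>x\<in>carrier (obj A p). g p (i p x) = f p x)"
    by blast
qed

definition regular_module :: "('r, 'x) ring_scheme \<Rightarrow> ('r, 'r) module" where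
  "regular_module R = \<lparr>carrier = carrier R, mult = mult R, one = one R, ring.zero = \<zero>\<^bsub>R\<^esub>, add = add R, smult = mult R\<rparr>"

lemma module_regular_module:
  assumes "cring R" shows "module R (regular_module R)"
proof -
  interpret R: cring R by fact
  show ?thesis
  proof (rule moduleI)
    show "abelian_group (regular_module R)"
    proof (rule abelian_groupI)
      fix x assume "x \<in> carrier (regular_module R)"
      then show "\<exists>y\<in>carrier (regular_module R). y \<oplus>\<^bsub>regular_module R\<^esub> x = \<zero>\<^bsub>regular_module R\<^esub>"
        by (auto simp: regular_module_def intro: bexI[of _ "\<ominus>\<^bsub>R\<^esub> x"] R.l_neg)
    qed (auto simp: regular_module_def R.a_ac)
  qed (auto simp: regular_module_def R.l_distr R.r_distr R.m_assoc R.is_cring)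
qed

text \<open>
  A compatible family \<open>w\<close> below \<open>p\<close> is the same as a map to \<open>I\<close> from the functor that is \<open>R\<close> at the
  elements below \<open>p\<close> and zero elsewhere: it sends \<open>1\<close> at \<open>q\<close> to \<open>w q\<close>. This functor is contained in
  the one that is \<open>R\<close> also at \<open>p\<close>, and an extension of the map to the latter sends \<open>1\<close> at \<open>p\<close> to an
  element of \<open>I\<close> at \<open>p\<close> that restricts to \<open>w\<close>.
\<close>

lemma injective_functor_flasque:
  fixes I :: "('p::order, 'r, 'u) pfunctor" and R :: "('r, 'x) ring_scheme" and c :: "'r \<Rightarrow> 'u"
  assumes R: "cring R" and I: "injective_functor R P I" and c: "inj c" and p: "p \<in> P"
    and w: "w \<in> carrier (lim_module (below P p) I)"
  shows "\<exists>y\<in>carrier (obj I p). \<forall>q\<in>below P p. res I p q y = w q"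
proof -
  interpret R: cring R by fact
  note If = injective_functorD[OF I]
  have wc: "w q \<in> carrier (obj I q)" if "q \<in> P" "q < p" for q
    using w that by (auto simp: lim_module_def below_def)
  have wr: "res I r q (w r) = w q" if "q \<in> P" "r \<in> P" "r < p" "q \<le> r" for q r
    using w that by (auto simp: lim_module_def below_def)
  define C :: "('p, 'r, 'r) pfunctor" where "C = \<lparr>obj = \<lambda>_. regular_module R, res = \<lambda>_ _ x. x\<rparr>"
  have C: "is_functor R Q C" for Q
    using module_regular_module[OF R] by (auto simp: is_functor_def C_def module_hom_def)
  let ?A = "zero_extension {q. q < p} C" and ?B = "zero_extension {q. q \<le> p} C"
  have A: "is_functor R P ?A" and B: "is_functor R P ?B"
    by (rule is_functor_zero_extension[OF R C]; force)+
  have idB: "nat_trans R (P \<inter> {q. q < p}) C ?B (\<lambda>q x. x)"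
    by (auto simp: nat_trans_def zero_extension_def C_def module_hom_def)
  have i: "nat_trans R P ?A ?B (\<lambda>q x. if q \<in> {q. q < p} then x else \<zero>\<^bsub>obj ?B q\<^esub>)" (is "nat_trans R P _ _ ?i")
    by (rule nat_trans_zero_extension[OF R C B _ idB]) auto
  have "nat_trans R (P \<inter> {q. q < p}) C I (\<lambda>q x. x \<odot>\<^bsub>obj I q\<^esub> w q)"
    unfolding nat_trans_def
  proof (intro conjI ballI impI)
    fix q assume q: "q \<in> P \<inter> {q. q < p}"
    then interpret Iq: module R "obj I q" using is_functorD(1)[OF If] by blast
    show "(\<lambda>x. x \<odot>\<^bsub>obj I q\<^esub> w q) \<in> module_hom R (obj C q) (obj I q)"
      using q wc by (intro module_homI) (auto simp: C_def regular_module_def Iq.smult_l_distr Iq.smult_assoc1)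
    fix r x assume r: "r \<in> P \<inter> {q. q < p}" "q \<le> r" and x: "x \<in> carrier (obj C r)"
    show "res C r q x \<odot>\<^bsub>obj I q\<^esub> w q = res I r q (x \<odot>\<^bsub>obj I r\<^esub> w r)"
      using module_homD(3)[OF is_functorD(2)[OF If, of q r]] q r wc[of r] wr[of q r] x
      by (simp add: C_def regular_module_def)
  qed
  then have f: "nat_trans R P ?A I (\<lambda>q x. if q \<in> {q. q < p} then x \<odot>\<^bsub>obj I q\<^esub> w q else \<zero>\<^bsub>obj I q\<^esub>)"
    (is "nat_trans R P _ _ ?f")
    by (intro nat_trans_zero_extension[OF R C If]) auto
  have "mono_trans P ?A ?i" by (auto simp: mono_trans_def zero_extension_def zero_mod_def)
  from injective_functor_extend[OF I c A B i this f]
  obtain g where g: "nat_trans R P ?B I g"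
    and gi: "\<And>q x. q \<in> P \<Longrightarrow> x \<in> carrier (obj ?A q) \<Longrightarrow> g q (?i q x) = ?f q x" by blast
  have 1: "\<one>\<^bsub>R\<^esub> \<in> carrier (obj ?B p)" by (simp add: zero_extension_def C_def regular_module_def)
  show ?thesis
  proof (intro bexI ballI)
    show "g p \<one>\<^bsub>R\<^esub> \<in> carrier (obj I p)" by (rule nat_transD(3)[OF g p 1])
    fix q assume "q \<in> below P p"
    then have q: "q \<in> P" "q < p" by (auto simp: below_def)
    interpret Iq: module R "obj I q" by (rule is_functorD(1)[OF If q(1)])
    have "res I p q (g p \<one>\<^bsub>R\<^esub>) = g q (res ?B p q \<one>\<^bsub>R\<^esub>)"
      using nat_transD(2)[OF g q(1) p _ 1] q by simp
    also have "\<dots> = g q (?i q \<one>\<^bsub>R\<^esub>)" using q by (simp add: zero_extension_def C_def)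
    also have "\<dots> = ?f q \<one>\<^bsub>R\<^esub>"
      by (rule gi) (use q in \<open>auto simp: zero_extension_def C_def regular_module_def\<close>)
    also have "\<dots> = w q" using q wc by simp
    finally show "res I p q (g p \<one>\<^bsub>R\<^esub>) = w q" .
  qed
qed

section \<open>Enough injective functors\<close>

text \<open>
  The right adjoint of the functor that remembers only the underlying abelian groups of a functor on
  \<open>Q\<close>: its value at \<open>p\<close> is the product over \<open>q \<le> p\<close> of the groups \<open>Hom(R, D q)\<close> of additive maps, on
  which a scalar \<open>a\<close> acts by \<open>(a \<cdot> h) r = h (r a)\<close>. Families and maps are extensional, so that elements
  are equal as soon as they agree pointwise.
\<close>

definition coinduced_functor ::
  "('r, 'x) ring_scheme \<Rightarrow> 'p::order set \<Rightarrow> ('p \<Rightarrow> 'd monoid) \<Rightarrow> ('p, 'r, 'p \<Rightarrow> 'r \<Rightarrow> 'd) pfunctor" where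
  "coinduced_functor R Q D =
     \<lparr>obj = (\<lambda>p. \<lparr>carrier = (\<Pi>\<^sub>E q\<in>{q \<in> Q. q \<le> p}. hom (add_monoid R) (D q) \<inter> extensional (carrier R)),
        mult = undefined, one = undefined,
        ring.zero = (\<lambda>q\<in>{q \<in> Q. q \<le> p}. \<lambda>r\<in>carrier R. \<one>\<^bsub>D q\<^esub>),
        add = (\<lambda>s t. \<lambda>q\<in>{q \<in> Q. q \<le> p}. \<lambda>r\<in>carrier R. s q r \<otimes>\<^bsub>D q\<^esub> t q r),
        smult = (\<lambda>a s. \<lambda>q\<in>{q \<in> Q. q \<le> p}. \<lambda>r\<in>carrier R. s q (r \<otimes>\<^bsub>R\<^esub> a))\<rparr>),
      res = (\<lambda>p' p s. restrict s {q \<in> Q. q \<le> p})\<rparr>"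

lemma coinduced_functor_mem:
  "s \<in> carrier (obj (coinduced_functor R Q D) p) \<longleftrightarrow>
     s \<in> extensional {q \<in> Q. q \<le> p} \<and>
     (\<forall>q\<in>Q. q \<le> p \<longrightarrow> s q \<in> extensional (carrier R) \<and> (\<forall>r\<in>carrier R. s q r \<in> carrier (D q)) \<and>
       (\<forall>r\<in>carrier R. \<forall>r'\<in>carrier R. s q (r \<oplus>\<^bsub>R\<^esub> r') = s q r \<otimes>\<^bsub>D q\<^esub> s q r'))"
  by (auto simp: coinduced_functor_def PiE_def Pi_def hom_def)

lemma coinduced_functor_eqI:
  assumes "s \<in> carrier (obj (coinduced_functor R Q D) p)" "t \<in> carrier (obj (coinduced_functor R Q D) p)"
    and "\<And>q r. q \<in> Q \<Longrightarrow> q \<le> p \<Longrightarrow> r \<in> carrier R \<Longrightarrow> s q r = t q r"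
  shows "s = t"
proof (rule extensionalityI[where A = "{q \<in> Q. q \<le> p}"])
  fix q assume q: "q \<in> {q \<in> Q. q \<le> p}"
  then show "s q = t q"
    by (intro extensionalityI[where A = "carrier R"]) (use assms q in \<open>auto simp: coinduced_functor_mem\<close>)
qed (use assms in \<open>auto simp: coinduced_functor_mem\<close>)

lemma is_functor_coinduced_functor:
  assumes R: "cring R" and D: "\<And>q. q \<in> Q \<Longrightarrow> comm_group (D q)"
  shows "is_functor R Q (coinduced_functor R Q D)" (is "is_functor R Q ?C")
proof -
  interpret R: cring R by fact
  note mem = coinduced_functor_mem[of _ R Q D]
  have Dg: "group (D q)" "comm_monoid (D q)" "monoid (D q)" if "q \<in> Q" for q
    using D[OF that] by (simp_all add: comm_group_def group.is_monoid)
  have add: "(s \<oplus>\<^bsub>obj ?C p\<^esub> t) q r = s q r \<otimes>\<^bsub>D q\<^esub> t q r"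
    and zero: "\<zero>\<^bsub>obj ?C p\<^esub> q r = \<one>\<^bsub>D q\<^esub>"
    and smult: "(a \<odot>\<^bsub>obj ?C p\<^esub> s) q r = s q (r \<otimes>\<^bsub>R\<^esub> a)"
    and res: "res ?C p' p s q r = s q r"
    if "q \<in> Q" "q \<le> p" "r \<in> carrier R" for s t p p' q r a
    using that by (auto simp: coinduced_functor_def)
  have add_cl: "s \<oplus>\<^bsub>obj ?C p\<^esub> t \<in> carrier (obj ?C p)"
    if "s \<in> carrier (obj ?C p)" "t \<in> carrier (obj ?C p)" for s t p
  proof -
    have "s \<oplus>\<^bsub>obj ?C p\<^esub> t \<in> extensional {q \<in> Q. q \<le> p}"
      "\<And>q. q \<in> Q \<Longrightarrow> q \<le> p \<Longrightarrow> (s \<oplus>\<^bsub>obj ?C p\<^esub> t) q \<in> extensional (carrier R)"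
      by (simp_all add: coinduced_functor_def)
    then show ?thesis
      using that unfolding mem
      by (auto simp: add Dg monoid.m_closed comm_monoid.m_ac)
  qed
  have zero_cl: "\<zero>\<^bsub>obj ?C p\<^esub> \<in> carrier (obj ?C p)" for p
  proof -
    have "\<zero>\<^bsub>obj ?C p\<^esub> \<in> extensional {q \<in> Q. q \<le> p}"
      "\<And>q. q \<in> Q \<Longrightarrow> q \<le> p \<Longrightarrow> \<zero>\<^bsub>obj ?C p\<^esub> q \<in> extensional (carrier R)"
      by (simp_all add: coinduced_functor_def)
    then show ?thesis unfolding mem by (auto simp: zero Dg monoid.one_closed monoid.l_one)
  qed
  have smult_cl: "a \<odot>\<^bsub>obj ?C p\<^esub> s \<in> carrier (obj ?C p)"
    if "a \<in> carrier R" "s \<in> carrier (obj ?C p)" for a s p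
  proof -
    have "a \<odot>\<^bsub>obj ?C p\<^esub> s \<in> extensional {q \<in> Q. q \<le> p}"
      "\<And>q. q \<in> Q \<Longrightarrow> q \<le> p \<Longrightarrow> (a \<odot>\<^bsub>obj ?C p\<^esub> s) q \<in> extensional (carrier R)"
      by (simp_all add: coinduced_functor_def)
    then show ?thesis using that unfolding mem by (auto simp: smult R.l_distr)
  qed
  have res_cl: "res ?C q p s \<in> carrier (obj ?C p)" if "p \<le> q" "s \<in> carrier (obj ?C q)" for p q s
    using that order_trans[OF _ that(1)] unfolding mem by (auto simp: coinduced_functor_def)
  have inv: "\<exists>t\<in>carrier (obj ?C p). t \<oplus>\<^bsub>obj ?C p\<^esub> s = \<zero>\<^bsub>obj ?C p\<^esub>" if s: "s \<in> carrier (obj ?C p)" for p s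
  proof -
    define t where "t = (\<lambda>q\<in>{q \<in> Q. q \<le> p}. \<lambda>r\<in>carrier R. inv\<^bsub>D q\<^esub> s q r)"
    have t: "t \<in> carrier (obj ?C p)"
      using s D unfolding mem t_def by (auto simp: Dg group.inv_closed comm_group.inv_mult)
    moreover have "t \<oplus>\<^bsub>obj ?C p\<^esub> s = \<zero>\<^bsub>obj ?C p\<^esub>"
      by (rule coinduced_functor_eqI[OF add_cl[OF t s] zero_cl])
        (use s in \<open>simp add: add zero t_def mem Dg group.l_inv\<close>)
    ultimately show ?thesis by blast
  qed
  have sc: "s q r \<in> carrier (D q)" if "s \<in> carrier (obj ?C p)" "q \<in> Q" "q \<le> p" "r \<in> carrier R" for s p q r
    using that unfolding mem by blast
  have mod: "module R (obj ?C p)" for p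
  proof (rule moduleI[OF R])
    show "abelian_group (obj ?C p)"
    proof (rule abelian_groupI[OF add_cl zero_cl])
      fix x y z assume x: "x \<in> carrier (obj ?C p)" and y: "y \<in> carrier (obj ?C p)" and z: "z \<in> carrier (obj ?C p)"
      show "x \<oplus>\<^bsub>obj ?C p\<^esub> y \<oplus>\<^bsub>obj ?C p\<^esub> z = x \<oplus>\<^bsub>obj ?C p\<^esub> (y \<oplus>\<^bsub>obj ?C p\<^esub> z)"
        by (rule coinduced_functor_eqI[of _ R Q D p]) (use x y z in \<open>auto simp: add add_cl sc Dg monoid.m_assoc\<close>)
    next
      fix x y assume x: "x \<in> carrier (obj ?C p)" and y: "y \<in> carrier (obj ?C p)"
      show "x \<oplus>\<^bsub>obj ?C p\<^esub> y = y \<oplus>\<^bsub>obj ?C p\<^esub> x"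
        by (rule coinduced_functor_eqI[of _ R Q D p]) (use x y in \<open>auto simp: add add_cl sc Dg comm_monoid.m_comm\<close>)
    next
      fix x assume x: "x \<in> carrier (obj ?C p)"
      show "\<zero>\<^bsub>obj ?C p\<^esub> \<oplus>\<^bsub>obj ?C p\<^esub> x = x"
        by (rule coinduced_functor_eqI[of _ R Q D p]) (use x in \<open>auto simp: add zero zero_cl add_cl sc Dg monoid.l_one\<close>)
    qed (auto intro: inv)
    fix a b x assume a: "a \<in> carrier R" and b: "b \<in> carrier R" and x: "x \<in> carrier (obj ?C p)"
    show "(a \<oplus>\<^bsub>R\<^esub> b) \<odot>\<^bsub>obj ?C p\<^esub> x = a \<odot>\<^bsub>obj ?C p\<^esub> x \<oplus>\<^bsub>obj ?C p\<^esub> b \<odot>\<^bsub>obj ?C p\<^esub> x"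
      by (rule coinduced_functor_eqI[of _ R Q D p])
        (use a b x in \<open>auto simp: add smult add_cl smult_cl R.r_distr, simp add: mem\<close>)
  next
    fix a x y assume a: "a \<in> carrier R" and x: "x \<in> carrier (obj ?C p)" and y: "y \<in> carrier (obj ?C p)"
    show "a \<odot>\<^bsub>obj ?C p\<^esub> (x \<oplus>\<^bsub>obj ?C p\<^esub> y) = a \<odot>\<^bsub>obj ?C p\<^esub> x \<oplus>\<^bsub>obj ?C p\<^esub> a \<odot>\<^bsub>obj ?C p\<^esub> y"
      by (rule coinduced_functor_eqI[of _ R Q D p]) (use a x y in \<open>auto simp: add smult add_cl smult_cl\<close>)
  next
    fix a b x assume a: "a \<in> carrier R" and b: "b \<in> carrier R" and x: "x \<in> carrier (obj ?C p)"
    show "(a \<otimes>\<^bsub>R\<^esub> b) \<odot>\<^bsub>obj ?C p\<^esub> x = a \<odot>\<^bsub>obj ?C p\<^esub> (b \<odot>\<^bsub>obj ?C p\<^esub> x)"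
      by (rule coinduced_functor_eqI[of _ R Q D p]) (use a b x in \<open>auto simp: smult smult_cl R.m_assoc\<close>)
  next
    fix x assume x: "x \<in> carrier (obj ?C p)"
    show "\<one>\<^bsub>R\<^esub> \<odot>\<^bsub>obj ?C p\<^esub> x = x"
      by (rule coinduced_functor_eqI[of _ R Q D p]) (use x in \<open>auto simp: smult smult_cl\<close>)
  qed (rule smult_cl)
  show ?thesis
    unfolding is_functor_def
  proof (intro conjI ballI impI mod)
    fix p assume p: "p \<in> Q"
    show "res ?C p p x = x" if "x \<in> carrier (obj ?C p)" for x
      by (rule coinduced_functor_eqI[of _ R Q D p]) (use that in \<open>auto simp: res res_cl\<close>)
    fix q assume q: "q \<in> Q" and pq: "p \<le> q"
    show "res ?C q p \<in> module_hom R (obj ?C q) (obj ?C p)"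
    proof (rule module_homI)
      fix x y assume "x \<in> carrier (obj ?C q)" "y \<in> carrier (obj ?C q)"
      then show "res ?C q p (x \<oplus>\<^bsub>obj ?C q\<^esub> y) = res ?C q p x \<oplus>\<^bsub>obj ?C p\<^esub> res ?C q p y"
        by (intro coinduced_functor_eqI[of _ R Q D p]) (use pq in \<open>auto simp: res add add_cl res_cl\<close>)
    next
      fix a x assume "a \<in> carrier R" "x \<in> carrier (obj ?C q)"
      then show "res ?C q p (a \<odot>\<^bsub>obj ?C q\<^esub> x) = a \<odot>\<^bsub>obj ?C p\<^esub> res ?C q p x"
        by (intro coinduced_functor_eqI[of _ R Q D p]) (use pq in \<open>auto simp: res smult smult_cl res_cl\<close>)
    qed (rule res_cl[OF pq])
    fix r x assume "r \<in> Q" "q \<le> r" "x \<in> carrier (obj ?C r)"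
    then show "res ?C q p (res ?C r q x) = res ?C r p x"
      by (intro coinduced_functor_eqI[of _ R Q D p]) (use pq in \<open>auto simp: res res_cl\<close>)
  qed
qed

text \<open>
  The transpose, under this adjunction, of a family \<open>\<phi>\<close> of additive maps.
\<close>

definition coinduced_trans ::
  "('r, 'x) ring_scheme \<Rightarrow> 'p::order set \<Rightarrow> ('p, 'r, 'v) pfunctor \<Rightarrow> ('p \<Rightarrow> 'v \<Rightarrow> 'd)
     \<Rightarrow> 'p \<Rightarrow> 'v \<Rightarrow> 'p \<Rightarrow> 'r \<Rightarrow> 'd" where
  "coinduced_trans R Q B \<phi> =
     (\<lambda>p x. \<lambda>q\<in>{q \<in> Q. q \<le> p}. \<lambda>r\<in>carrier R. \<phi> q (r \<odot>\<^bsub>obj B q\<^esub> res B p q x))"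

lemma nat_trans_coinduced_trans:
  assumes R: "cring R" and D: "\<And>q. q \<in> Q \<Longrightarrow> comm_group (D q)" and B: "is_functor R Q B"
    and \<phi>: "\<And>q. q \<in> Q \<Longrightarrow> \<phi> q \<in> hom (add_monoid (obj B q)) (D q)"
  shows "nat_trans R Q B (coinduced_functor R Q D) (coinduced_trans R Q B \<phi>)"
proof -
  interpret R: cring R by fact
  let ?C = "coinduced_functor R Q D" and ?\<eta> = "coinduced_trans R Q B \<phi>"
  have C: "is_functor R Q ?C" by (rule is_functor_coinduced_functor[OF R D])
  have \<phi>c: "\<phi> q x \<in> carrier (D q)" if "q \<in> Q" "x \<in> carrier (obj B q)" for q x
    using \<phi>[OF that(1)] that(2) by (auto simp: hom_def)
  have \<phi>a: "\<phi> q (x \<oplus>\<^bsub>obj B q\<^esub> y) = \<phi> q x \<otimes>\<^bsub>D q\<^esub> \<phi> q y"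
    if "q \<in> Q" "x \<in> carrier (obj B q)" "y \<in> carrier (obj B q)" for q x y
    using \<phi>[OF that(1)] that(2,3) by (auto simp: hom_def)
  have Bm: "module R (obj B q)" if "q \<in> Q" for q using is_functorD(1)[OF B that] .
  note Bres = is_functorD(5)[OF B]
  have cl: "?\<eta> p x \<in> carrier (obj ?C p)" if "p \<in> Q" "x \<in> carrier (obj B p)" for p x
    unfolding coinduced_functor_mem coinduced_trans_def
    using that Bres by (auto simp: \<phi>c \<phi>a[symmetric] module.smult_closed[OF Bm] module.smult_l_distr[OF Bm])
  show ?thesis
    unfolding nat_trans_def
  proof (intro conjI ballI impI)
    fix p assume p: "p \<in> Q"
    interpret Cp: module R "obj ?C p" by (rule is_functorD(1)[OF C p])
    interpret Bp: module R "obj B p" by (rule Bm[OF p])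
    show "?\<eta> p \<in> module_hom R (obj B p) (obj ?C p)"
    proof (rule module_homI)
      show "?\<eta> p x \<in> carrier (obj ?C p)" if "x \<in> carrier (obj B p)" for x by (rule cl[OF p that])
    next
      fix x y assume xy: "x \<in> carrier (obj B p)" "y \<in> carrier (obj B p)"
      show "?\<eta> p (x \<oplus>\<^bsub>obj B p\<^esub> y) = ?\<eta> p x \<oplus>\<^bsub>obj ?C p\<^esub> ?\<eta> p y"
      proof (rule coinduced_functor_eqI[of _ R Q D p])
        fix q r assume q: "q \<in> Q" "q \<le> p" and r: "r \<in> carrier R"
        show "?\<eta> p (x \<oplus>\<^bsub>obj B p\<^esub> y) q r = (?\<eta> p x \<oplus>\<^bsub>obj ?C p\<^esub> ?\<eta> p y) q r"
          using q r xy p Bres[OF q(1) p q(2)] module_homD(2)[OF is_functorD(2)[OF B q(1) p q(2)] xy]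
          by (simp add: coinduced_trans_def coinduced_functor_def module.smult_r_distr[OF Bm] module.smult_closed[OF Bm] \<phi>a)
      qed (use p xy in \<open>auto intro!: cl\<close>)
    next
      fix a x assume a: "a \<in> carrier R" and x: "x \<in> carrier (obj B p)"
      show "?\<eta> p (a \<odot>\<^bsub>obj B p\<^esub> x) = a \<odot>\<^bsub>obj ?C p\<^esub> ?\<eta> p x"
      proof (rule coinduced_functor_eqI[of _ R Q D p])
        fix q r assume q: "q \<in> Q" "q \<le> p" and r: "r \<in> carrier R"
        show "?\<eta> p (a \<odot>\<^bsub>obj B p\<^esub> x) q r = (a \<odot>\<^bsub>obj ?C p\<^esub> ?\<eta> p x) q r"
          using q r a x p Bres[OF q(1) p q(2)] module_homD(3)[OF is_functorD(2)[OF B q(1) p q(2)] a x]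
          by (simp add: coinduced_trans_def coinduced_functor_def module.smult_assoc1[OF Bm])
      qed (use p a x in \<open>auto intro!: cl\<close>)
    qed
    fix q x assume q: "q \<in> Q" and pq: "p \<le> q" and x: "x \<in> carrier (obj B q)"
    show "?\<eta> p (res B q p x) = res ?C q p (?\<eta> q x)"
    proof (rule coinduced_functor_eqI[of _ R Q D p])
      show "?\<eta> p (res B q p x) \<in> carrier (obj ?C p)" by (rule cl[OF p Bres[OF p q pq x]])
      show "res ?C q p (?\<eta> q x) \<in> carrier (obj ?C p)" by (rule is_functorD(5)[OF C p q pq cl[OF q x]])
      fix s r assume s: "s \<in> Q" "s \<le> p" and r: "r \<in> carrier R"
      then show "?\<eta> p (res B q p x) s r = res ?C q p (?\<eta> q x) s r"
        using is_functorD(4)[OF B s(1) p q s(2) pq x] pq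
        by (auto simp: coinduced_trans_def coinduced_functor_def)
    qed
  qed
qed

text \<open>
  By adjunction, \<open>f\<close> amounts to the additive maps \<open>x \<mapsto> f q x q 1\<close> from \<open>A q\<close> to \<open>D q\<close>, one for every
  \<open>q\<close>. These extend along \<open>i q\<close>, independently of each other, because \<open>D q\<close> is divisible; the transpose of the
  extensions extends \<open>f\<close>.
\<close>

lemma coinduced_functor_extend:
  fixes A B :: "('p::order, 'r, 'v) pfunctor" and D :: "'p \<Rightarrow> 'd monoid"
  assumes R: "cring R" and D: "\<And>q. q \<in> Q \<Longrightarrow> comm_group (D q)" and div: "\<And>q. q \<in> Q \<Longrightarrow> divisible (D q)"
    and A: "is_functor R Q A" and B: "is_functor R Q B"
    and i: "nat_trans R Q A B i" and mono: "mono_trans Q A i"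
    and f: "nat_trans R Q A (coinduced_functor R Q D) f"
  shows "\<exists>g. nat_trans R Q B (coinduced_functor R Q D) g \<and> (\<forall>p\<in>Q. \<forall>x\<in>carrier (obj A p). g p (i p x) = f p x)"
proof -
  interpret R: cring R by fact
  let ?C = "coinduced_functor R Q D"
  have C: "is_functor R Q ?C" by (rule is_functor_coinduced_functor[OF R D])
  have mem: "f q x \<in> carrier (obj ?C q)" if "q \<in> Q" "x \<in> carrier (obj A q)" for q x
    by (rule nat_transD(3)[OF f that])
  have "\<exists>\<psi>. \<psi> \<in> hom (add_monoid (obj B q)) (D q) \<and> (\<forall>x\<in>carrier (obj A q). \<psi> (i q x) = f q x q \<one>\<^bsub>R\<^esub>)"
    if q: "q \<in> Q" for q
  proof -
    interpret Aq: module R "obj A q" by (rule is_functorD(1)[OF A q])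
    interpret Bq: module R "obj B q" by (rule is_functorD(1)[OF B q])
    have hi: "i q \<in> hom (add_monoid (obj A q)) (add_monoid (obj B q))"
      using module_homD[OF nat_transD(1)[OF i q]] by (auto simp: hom_def)
    have hj: "inj_on (i q) (carrier (add_monoid (obj A q)))" using mono q by (simp add: mono_trans_def)
    have hf: "(\<lambda>x. f q x q \<one>\<^bsub>R\<^esub>) \<in> hom (add_monoid (obj A q)) (D q)"
    proof (rule homI)
      show "f q x q \<one>\<^bsub>R\<^esub> \<in> carrier (D q)" if "x \<in> carrier (add_monoid (obj A q))" for x
        using mem[OF q, of x] that q by (simp add: coinduced_functor_mem)
      fix x y assume "x \<in> carrier (add_monoid (obj A q))" "y \<in> carrier (add_monoid (obj A q))"
      then show "f q (x \<otimes>\<^bsub>add_monoid (obj A q)\<^esub> y) q \<one>\<^bsub>R\<^esub> = f q x q \<one>\<^bsub>R\<^esub> \<otimes>\<^bsub>D q\<^esub> f q y q \<one>\<^bsub>R\<^esub>"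
        using module_homD(2)[OF nat_transD(1)[OF f q], of x y] q by (simp add: coinduced_functor_def)
    qed
    obtain g where "g \<in> hom (add_monoid (obj B q)) (D q)"
      "\<And>x. x \<in> carrier (add_monoid (obj A q)) \<Longrightarrow> g (i q x) = f q x q \<one>\<^bsub>R\<^esub>"
      using divisible_extension[OF Aq.a_group Bq.a_comm_group D[OF q] div[OF q] hi hj hf] by metis
    then show ?thesis by auto
  qed
  then obtain \<psi> where \<psi>: "\<And>q. q \<in> Q \<Longrightarrow> \<psi> q \<in> hom (add_monoid (obj B q)) (D q)"
    and \<psi>i: "\<And>q x. q \<in> Q \<Longrightarrow> x \<in> carrier (obj A q) \<Longrightarrow> \<psi> q (i q x) = f q x q \<one>\<^bsub>R\<^esub>"
    by metis
  let ?g = "coinduced_trans R Q B \<psi>"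
  have g: "nat_trans R Q B ?C ?g" by (rule nat_trans_coinduced_trans[OF R D B \<psi>])
  have "?g p (i p x) = f p x" if p: "p \<in> Q" and x: "x \<in> carrier (obj A p)" for p x
  proof (rule coinduced_functor_eqI[of _ R Q D p])
    show "f p x \<in> carrier (obj ?C p)" by (rule mem[OF p x])
    show "?g p (i p x) \<in> carrier (obj ?C p)" by (rule nat_transD(3)[OF g p nat_transD(3)[OF i p x]])
    fix q r assume q: "q \<in> Q" "q \<le> p" and r: "r \<in> carrier R"
    interpret Aq: module R "obj A q" by (rule is_functorD(1)[OF A q(1)])
    let ?x = "res A p q x"
    have x': "?x \<in> carrier (obj A q)" by (rule is_functorD(5)[OF A q(1) p q(2) x])
    have "?g p (i p x) q r = \<psi> q (r \<odot>\<^bsub>obj B q\<^esub> res B p q (i p x))"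
      using q r by (simp add: coinduced_trans_def)
    also have "\<dots> = \<psi> q (i q (r \<odot>\<^bsub>obj A q\<^esub> ?x))"
      using nat_transD(2)[OF i q(1) p q(2) x] module_homD(3)[OF nat_transD(1)[OF i q(1)] r x'] by simp
    also have "\<dots> = f q (r \<odot>\<^bsub>obj A q\<^esub> ?x) q \<one>\<^bsub>R\<^esub>" by (rule \<psi>i[OF q(1)]) (use r x' in simp)
    also have "\<dots> = (r \<odot>\<^bsub>obj ?C q\<^esub> f q ?x) q \<one>\<^bsub>R\<^esub>"
      using module_homD(3)[OF nat_transD(1)[OF f q(1)] r x'] by simp
    also have "\<dots> = f q ?x q r" using q r by (simp add: coinduced_functor_def)
    also have "\<dots> = res ?C p q (f p x) q r" using nat_transD(2)[OF f q(1) p q(2) x] by simp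
    also have "\<dots> = f p x q r" using q by (simp add: coinduced_functor_def)
    finally show "?g p (i p x) q r = f p x q r" .
  qed
  then show ?thesis using g by blast
qed

text \<open>
  Embed every \<open>G q\<close> into a divisible group \<open>D q\<close>; the transpose of these embeddings is a monomorphism
  into the functor coinduced from \<open>D\<close>. The injection \<open>c\<close> expresses that \<open>'u\<close> is large enough to
  carry this functor as well: it encodes a family of cosets by the family of their representatives.
\<close>

lemma injective_embedding:
  fixes G :: "('p::order, 'r, 'u) pfunctor" and c :: "('p \<Rightarrow> 'r \<Rightarrow> ('u \<Rightarrow>\<^sub>0 rat)) \<Rightarrow> 'u"
  assumes R: "cring R" and c: "inj c" and G: "is_functor R Q G"
  shows "\<exists>(I :: ('p, 'r, 'u) pfunctor) \<eta>. injective_functor R Q I \<and> nat_trans R Q G I \<eta> \<and> mono_trans Q G \<eta>"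
proof -
  interpret R: cring R by fact
  have "\<exists>(D :: ('u \<Rightarrow>\<^sub>0 rat) set monoid) e. comm_group D \<and> divisible D \<and> e \<in> hom (add_monoid (obj G q)) D
    \<and> inj_on e (carrier (obj G q)) \<and> inj_on (\<lambda>C. SOME c. c \<in> C) (carrier D)" if q: "q \<in> Q" for q
  proof -
    interpret Gq: module R "obj G q" by (rule is_functorD(1)[OF G q])
    show ?thesis using divisible_embedding[OF Gq.a_comm_group] by simp
  qed
  then obtain D :: "'p \<Rightarrow> ('u \<Rightarrow>\<^sub>0 rat) set monoid" and e
    where D: "\<And>q. q \<in> Q \<Longrightarrow> comm_group (D q)" and div: "\<And>q. q \<in> Q \<Longrightarrow> divisible (D q)"
      and e: "\<And>q. q \<in> Q \<Longrightarrow> e q \<in> hom (add_monoid (obj G q)) (D q)"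
      and e_inj: "\<And>q. q \<in> Q \<Longrightarrow> inj_on (e q) (carrier (obj G q))"
      and rep: "\<And>q. q \<in> Q \<Longrightarrow> inj_on (\<lambda>C. SOME c. c \<in> C) (carrier (D q))"
    by metis
  let ?C = "coinduced_functor R Q D"
  have C: "is_functor R Q ?C" by (rule is_functor_coinduced_functor[OF R D])
  \<comment> \<open>On the values of the coinduced functor, \<open>\<kappa>\<close> is injective, since cosets are determined by representatives.\<close>
  define \<kappa> where "\<kappa> s = c (\<lambda>q r. SOME x. x \<in> s q r)" for s :: "'p \<Rightarrow> 'r \<Rightarrow> ('u \<Rightarrow>\<^sub>0 rat) set"
  have \<kappa>: "inj_on \<kappa> (carrier (obj ?C p))" if "p \<in> Q" for p
  proof (rule inj_onI)
    fix s t assume s: "s \<in> carrier (obj ?C p)" and t: "t \<in> carrier (obj ?C p)" and "\<kappa> s = \<kappa> t"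
    then have "(\<lambda>q r. SOME x. x \<in> s q r) = (\<lambda>q r. SOME x. x \<in> t q r)"
      unfolding \<kappa>_def by (blast dest: injD[OF c])
    then have eq: "(SOME x. x \<in> s q r) = (SOME x. x \<in> t q r)" for q r by metis
    show "s = t"
    proof (rule coinduced_functor_eqI[OF s t])
      fix q r assume "q \<in> Q" "q \<le> p" "r \<in> carrier R"
      then show "s q r = t q r"
        using inj_onD[OF rep[of q], of "s q r" "t q r"] eq s t by (simp add: coinduced_functor_mem)
    qed
  qed
  let ?I = "image_functor (\<lambda>_. \<kappa>) ?C"
  note I = image_functor_inj[where \<rho> = "\<lambda>_. \<kappa>", OF C \<kappa>]
  have inj: "injective_functor R Q ?I"
    unfolding injective_functor_def
  proof (intro conjI allI impI I(1))
    fix A B :: "('p, 'r, 'u) pfunctor" and i f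
    assume A: "is_functor R Q A" and B: "is_functor R Q B" and i: "nat_trans R Q A B i"
      and mono: "mono_trans Q A i" and f: "nat_trans R Q A ?I f"
    obtain g where g: "nat_trans R Q B ?C g"
      and gi: "\<And>p x. p \<in> Q \<Longrightarrow> x \<in> carrier (obj A p) \<Longrightarrow> g p (i p x) = inv_into (carrier (obj ?C p)) \<kappa> (f p x)"
      using coinduced_functor_extend[OF R D div A B i mono nat_trans_comp[OF f I(3)]] by blast
    have "\<kappa> (g p (i p x)) = f p x" if "p \<in> Q" "x \<in> carrier (obj A p)" for p x
      using gi[OF that] nat_transD(3)[OF f that] by (simp add: f_inv_into_f)
    then show "\<exists>g. nat_trans R Q B ?I g \<and> (\<forall>p\<in>Q. \<forall>x\<in>carrier (obj A p). g p (i p x) = f p x)"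
      using nat_trans_comp[OF g I(2)] by blast
  qed
  let ?\<eta> = "coinduced_trans R Q G e"
  have \<eta>: "nat_trans R Q G ?C ?\<eta>" by (rule nat_trans_coinduced_trans[OF R D G e])
  have "mono_trans Q G (\<lambda>p x. \<kappa> (?\<eta> p x))"
    unfolding mono_trans_def
  proof (intro ballI inj_onI)
    fix p x y assume p: "p \<in> Q" and x: "x \<in> carrier (obj G p)" and y: "y \<in> carrier (obj G p)"
      and eq: "\<kappa> (?\<eta> p x) = \<kappa> (?\<eta> p y)"
    interpret Gp: module R "obj G p" by (rule is_functorD(1)[OF G p])
    have "?\<eta> p x = ?\<eta> p y"
      by (rule inj_onD[OF \<kappa>[OF p] eq nat_transD(3)[OF \<eta> p x] nat_transD(3)[OF \<eta> p y]])
    then have "?\<eta> p x p \<one>\<^bsub>R\<^esub> = ?\<eta> p y p \<one>\<^bsub>R\<^esub>" by simp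
    then have "e p x = e p y"
      using p x y is_functorD(3)[OF G p] by (simp add: coinduced_trans_def)
    then show "x = y" using e_inj[OF p] x y by (auto dest: inj_onD)
  qed
  then show ?thesis using inj nat_trans_comp[OF \<eta> I(2)] by blast
qed

lemma cokernel_functor:
  fixes G :: "('p::order, 'r, 'v) pfunctor" and I :: "('p, 'r, 'u) pfunctor"
  assumes G: "is_functor R Q G" and I: "is_functor R Q I" and \<eta>: "nat_trans R Q G I \<eta>"
  shows "\<exists>(C :: ('p, 'r, 'u) pfunctor) \<pi>. is_functor R Q C \<and> nat_trans R Q I C \<pi> \<and>
     (\<forall>p\<in>Q. \<pi> p ` carrier (obj I p) = carrier (obj C p)) \<and>
     (\<forall>p\<in>Q. \<forall>x\<in>carrier (obj I p). \<pi> p x = \<zero>\<^bsub>obj C p\<^esub> \<longleftrightarrow> x \<in> \<eta> p ` carrier (obj G p))"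
proof -
  define N where "N p = \<eta> p ` carrier (obj G p)" for p
  \<comment> \<open>Congruence modulo the range of \<open>\<eta>\<close>; \<open>\<pi>\<close> picks one element of each class.\<close>
  define E where "E p x y \<longleftrightarrow> y \<in> carrier (obj I p) \<and> x \<ominus>\<^bsub>obj I p\<^esub> y \<in> N p" for p x y
  define \<pi> where "\<pi> p x = (SOME y. E p x y)" for p x
  have N: "submodule (N p) R (obj I p)" if "p \<in> Q" for p
    unfolding N_def
    by (rule submodule_range[OF is_functorD(1)[OF G that] is_functorD(1)[OF I that] nat_transD(1)[OF \<eta> that]])
  have Nres: "res I q p x \<in> N p" if "p \<in> Q" "q \<in> Q" "p \<le> q" "x \<in> N q" for p q x
    using that nat_transD(2)[OF \<eta> that(1-3), symmetric] is_functorD(5)[OF G that(1-3)] by (auto simp: N_def)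
  have \<pi>_eq: "\<pi> p x = \<pi> p y \<longleftrightarrow> x \<ominus>\<^bsub>obj I p\<^esub> y \<in> N p"
    if p: "p \<in> Q" and x: "x \<in> carrier (obj I p)" and y: "y \<in> carrier (obj I p)" for p x y
  proof -
    interpret Ip: module R "obj I p" by (rule is_functorD(1)[OF I p])
    interpret Np: submodule "N p" R "obj I p" by (rule N[OF p])
    have sym: "b \<ominus>\<^bsub>obj I p\<^esub> a \<in> N p"
      if "a \<ominus>\<^bsub>obj I p\<^esub> b \<in> N p" "a \<in> carrier (obj I p)" "b \<in> carrier (obj I p)" for a b
    proof -
      have "\<ominus>\<^bsub>obj I p\<^esub> (a \<ominus>\<^bsub>obj I p\<^esub> b) \<in> N p" using Np.m_inv_closed[OF that(1)] by (simp add: a_inv_def)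
      then show ?thesis using that by (simp add: a_minus_def Ip.M.minus_add Ip.M.a_comm)
    qed
    have trans: "a \<ominus>\<^bsub>obj I p\<^esub> d \<in> N p"
      if ab: "a \<ominus>\<^bsub>obj I p\<^esub> b \<in> N p" and bd: "b \<ominus>\<^bsub>obj I p\<^esub> d \<in> N p"
        and c: "a \<in> carrier (obj I p)" "b \<in> carrier (obj I p)" "d \<in> carrier (obj I p)" for a b d
    proof -
      have "(a \<ominus>\<^bsub>obj I p\<^esub> b) \<oplus>\<^bsub>obj I p\<^esub> (b \<ominus>\<^bsub>obj I p\<^esub> d) \<in> N p" using Np.m_closed[OF ab bd] by simp
      moreover have "(a \<ominus>\<^bsub>obj I p\<^esub> b) \<oplus>\<^bsub>obj I p\<^esub> (b \<ominus>\<^bsub>obj I p\<^esub> d) = a \<ominus>\<^bsub>obj I p\<^esub> d"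
        using c by (simp add: a_minus_def Ip.M.a_assoc Ip.M.r_neg1)
      ultimately show ?thesis by simp
    qed
    have E\<pi>: "E p a (\<pi> p a)" if "a \<in> carrier (obj I p)" for a
      unfolding \<pi>_def
    proof (rule someI)
      show "E p a a" using that Np.one_closed by (simp add: E_def a_minus_def Ip.M.r_neg)
    qed
    show ?thesis
    proof
      assume "\<pi> p x = \<pi> p y"
      then have "x \<ominus>\<^bsub>obj I p\<^esub> \<pi> p x \<in> N p" "y \<ominus>\<^bsub>obj I p\<^esub> \<pi> p x \<in> N p" "\<pi> p x \<in> carrier (obj I p)"
        using E\<pi>[OF x] E\<pi>[OF y] by (simp_all add: E_def)
      then show "x \<ominus>\<^bsub>obj I p\<^esub> y \<in> N p" using trans sym x y by blast
    next
      assume xy: "x \<ominus>\<^bsub>obj I p\<^esub> y \<in> N p"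
      have "E p x = E p y"
        unfolding E_def fun_eq_iff using trans sym[OF xy x y] xy x y by blast
      then show "\<pi> p x = \<pi> p y" by (simp add: \<pi>_def)
    qed
  qed
  have cong: "module_congruence R (obj I p) (\<pi> p)" if p: "p \<in> Q" for p
    unfolding module_congruence_def
  proof (intro ballI impI conjI)
    interpret Ip: module R "obj I p" by (rule is_functorD(1)[OF I p])
    interpret Np: submodule "N p" R "obj I p" by (rule N[OF p])
    fix x x' assume x: "x \<in> carrier (obj I p)" "x' \<in> carrier (obj I p)" and "\<pi> p x = \<pi> p x'"
    then have n: "x \<ominus>\<^bsub>obj I p\<^esub> x' \<in> N p" using \<pi>_eq[OF p] by blast
    show "\<pi> p (x \<oplus>\<^bsub>obj I p\<^esub> y) = \<pi> p (x' \<oplus>\<^bsub>obj I p\<^esub> y)" if y: "y \<in> carrier (obj I p)" for y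
    proof -
      have "(x \<oplus>\<^bsub>obj I p\<^esub> y) \<ominus>\<^bsub>obj I p\<^esub> (x' \<oplus>\<^bsub>obj I p\<^esub> y) = x \<ominus>\<^bsub>obj I p\<^esub> x'"
        using x y by (simp add: a_minus_def Ip.M.minus_add Ip.M.a_assoc Ip.M.a_lcomm[of y] Ip.M.r_neg)
      then show ?thesis using n \<pi>_eq[OF p] x y by simp
    qed
    show "\<pi> p (a \<odot>\<^bsub>obj I p\<^esub> x) = \<pi> p (a \<odot>\<^bsub>obj I p\<^esub> x')" if a: "a \<in> carrier R" for a
    proof -
      have "a \<odot>\<^bsub>obj I p\<^esub> x \<ominus>\<^bsub>obj I p\<^esub> a \<odot>\<^bsub>obj I p\<^esub> x' = a \<odot>\<^bsub>obj I p\<^esub> (x \<ominus>\<^bsub>obj I p\<^esub> x')"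
        using x a by (simp add: a_minus_def Ip.smult_r_distr Ip.smult_r_minus)
      then show ?thesis using Np.smult_closed[OF a n] \<pi>_eq[OF p] x a by simp
    qed
  qed
  have cong_res: "\<pi> p (res I q p x) = \<pi> p (res I q p y)"
    if pq: "p \<in> Q" "q \<in> Q" "p \<le> q" and xy: "x \<in> carrier (obj I q)" "y \<in> carrier (obj I q)" and "\<pi> q x = \<pi> q y"
    for p q x y
  proof -
    have "res I q p (x \<ominus>\<^bsub>obj I q\<^esub> y) \<in> N p" using Nres[OF pq] \<pi>_eq[OF pq(2) xy] that by blast
    then show ?thesis
      using module_hom_minus[OF is_functorD(1)[OF I pq(2)] is_functorD(1)[OF I pq(1)] is_functorD(2)[OF I pq] xy]
        \<pi>_eq[OF pq(1)] is_functorD(5)[OF I pq] xy by simp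
  qed
  let ?C = "image_functor \<pi> I"
  have C: "is_functor R Q ?C" "nat_trans R Q I ?C \<pi>"
    by (rule image_functor[where \<rho> = \<pi>, OF I cong cong_res]; assumption)+
  have "\<pi> p x = \<zero>\<^bsub>obj ?C p\<^esub> \<longleftrightarrow> x \<in> \<eta> p ` carrier (obj G p)"
    if p: "p \<in> Q" and x: "x \<in> carrier (obj I p)" for p x
  proof -
    interpret Ip: module R "obj I p" by (rule is_functorD(1)[OF I p])
    have "\<pi> p x = \<zero>\<^bsub>obj ?C p\<^esub> \<longleftrightarrow> \<pi> p x = \<pi> p \<zero>\<^bsub>obj I p\<^esub>"
      by (simp add: image_functor_def image_module_def)
    also have "\<dots> \<longleftrightarrow> x \<in> N p"
    proof -
      have "x \<ominus>\<^bsub>obj I p\<^esub> \<zero>\<^bsub>obj I p\<^esub> = x"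
        using x by (metis Ip.M.minus_equality Ip.M.r_zero Ip.M.zero_closed a_minus_def)
      then show ?thesis using \<pi>_eq[OF p x Ip.M.zero_closed] by simp
    qed
    finally show ?thesis by (simp add: N_def)
  qed
  then show ?thesis using C by (intro exI[of _ ?C] exI[of _ \<pi>]) simp
qed

lemma a_kernel_eq: "a_kernel M N h = {x \<in> carrier M. h x = \<zero>\<^bsub>N\<^esub>}"
  by (simp add: a_kernel_def kernel_def)

text \<open>
  Alternate between embedding a functor \<open>G n\<close> into an injective functor \<open>I n\<close> and passing to the
  cokernel \<open>G (Suc n)\<close>. The differential is the composite of \<open>I n \<rightarrow> G (Suc n)\<close> and
  \<open>G (Suc n) \<rightarrow> I (Suc n)\<close>.
\<close>

lemma injective_resolution_exists:
  fixes F :: "('p::order, 'r, 'm) pfunctor" and R :: "('r, 'x) ring_scheme"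
    and c :: "('p \<Rightarrow> 'r \<Rightarrow> ('u \<Rightarrow>\<^sub>0 rat)) \<Rightarrow> 'u" and c' :: "'m \<Rightarrow> 'u"
  assumes R: "cring R" and c: "inj c" and c': "inj c'" and F: "is_functor R Q F"
  shows "\<exists>e (I :: nat \<Rightarrow> ('p, 'r, 'u) pfunctor) d. injective_resolution R Q F e I d"
proof -
  have c'i: "inj_on c' (carrier (obj F p))" for p using c' by (rule inj_on_subset) simp
  \<comment> \<open>The construction takes place among functors with values in \<open>'u\<close>, to which \<open>c'\<close> moves \<open>F\<close>.\<close>
  let ?F = "image_functor (\<lambda>_. c') F"
  note F' = image_functor_inj[where \<rho> = "\<lambda>_. c'", OF F c'i]
  \<comment> \<open>One stage consists of \<open>G\<close>, its embedding \<open>\<eta>\<close> into \<open>I\<close>, and the cokernel \<open>\<pi>\<close> from \<open>I\<close> to \<open>C\<close>.\<close>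
  define good where
    "good = (\<lambda>(G :: ('p, 'r, 'u) pfunctor, I :: ('p, 'r, 'u) pfunctor, \<eta> :: 'p \<Rightarrow> 'u \<Rightarrow> 'u,
        C :: ('p, 'r, 'u) pfunctor, \<pi> :: 'p \<Rightarrow> 'u \<Rightarrow> 'u).
      is_functor R Q G \<and> injective_functor R Q I \<and> nat_trans R Q G I \<eta> \<and> mono_trans Q G \<eta> \<and>
      is_functor R Q C \<and> nat_trans R Q I C \<pi> \<and> (\<forall>p\<in>Q. \<pi> p ` carrier (obj I p) = carrier (obj C p)) \<and>
      (\<forall>p\<in>Q. \<forall>x\<in>carrier (obj I p). \<pi> p x = \<zero>\<^bsub>obj C p\<^esub> \<longleftrightarrow> x \<in> \<eta> p ` carrier (obj G p)))"
  have step: "\<exists>I \<eta> C \<pi>. good (G, I, \<eta>, C, \<pi>)" if G: "is_functor R Q G" for G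
  proof -
    obtain I :: "('p, 'r, 'u) pfunctor" and \<eta> where I: "injective_functor R Q I" "nat_trans R Q G I \<eta>" "mono_trans Q G \<eta>"
      using injective_embedding[OF R c G] by blast
    obtain C :: "('p, 'r, 'u) pfunctor" and \<pi> where "is_functor R Q C" "nat_trans R Q I C \<pi>"
      "\<forall>p\<in>Q. \<pi> p ` carrier (obj I p) = carrier (obj C p)"
      "\<forall>p\<in>Q. \<forall>x\<in>carrier (obj I p). \<pi> p x = \<zero>\<^bsub>obj C p\<^esub> \<longleftrightarrow> x \<in> \<eta> p ` carrier (obj G p)"
      using cokernel_functor[OF G injective_functorD[OF I(1)] I(2)] by blast
    then show ?thesis using G I unfolding good_def by blast
  qed
  have "\<exists>f. \<forall>n. (good (f n) \<and> (n = 0 \<longrightarrow> fst (f n) = ?F)) \<and>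
    fst (f (Suc n)) = fst (snd (snd (snd (f n))))"
  proof (rule dependent_nat_choice)
    show "\<exists>x. good x \<and> (0 = (0::nat) \<longrightarrow> fst x = ?F)" using step[OF F'(1)] by fastforce
    fix x and n :: nat assume x: "good x \<and> (n = 0 \<longrightarrow> fst x = ?F)"
    obtain G I \<eta> C \<pi> where xe: "x = (G, I, \<eta>, C, \<pi>)" by (cases x)
    then have "is_functor R Q C" using x unfolding good_def by simp
    from step[OF this] obtain y where "good y" "fst y = C" by (metis fst_conv)
    then show "\<exists>y. (good y \<and> (Suc n = 0 \<longrightarrow> fst y = ?F)) \<and> fst y = fst (snd (snd (snd x)))"
      using xe by (intro exI[of _ y]) simp
  qed
  then obtain f where f: "\<And>n. good (f n)" "fst (f 0) = ?F" "\<And>n. fst (f (Suc n)) = fst (snd (snd (snd (f n))))"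
    by blast
  define G where "G n = fst (f n)" for n
  define I where "I n = fst (snd (f n))" for n
  define \<eta> where "\<eta> n = fst (snd (snd (f n)))" for n
  define \<pi> where "\<pi> n = snd (snd (snd (snd (f n))))" for n
  have fn: "f n = (G n, I n, \<eta> n, G (Suc n), \<pi> n)" for n
    using f(3)[of n] by (simp add: G_def I_def \<eta>_def \<pi>_def)
  have G0: "G 0 = ?F" using f(2) by (simp add: G_def)
  have G: "is_functor R Q (G n)" and I: "injective_functor R Q (I n)" and \<eta>: "nat_trans R Q (G n) (I n) (\<eta> n)"
    and mono: "mono_trans Q (G n) (\<eta> n)" and \<pi>: "nat_trans R Q (I n) (G (Suc n)) (\<pi> n)"
    and surj: "\<And>p. p \<in> Q \<Longrightarrow> \<pi> n p ` carrier (obj (I n) p) = carrier (obj (G (Suc n)) p)"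
    and ker: "\<And>p x. p \<in> Q \<Longrightarrow> x \<in> carrier (obj (I n) p) \<Longrightarrow>
      \<pi> n p x = \<zero>\<^bsub>obj (G (Suc n)) p\<^esub> \<longleftrightarrow> x \<in> \<eta> n p ` carrier (obj (G n) p)" for n
    using f(1)[of n] unfolding fn good_def by auto
  define d where "d n p x = \<eta> (Suc n) p (\<pi> n p x)" for n p x
  have kerd: "a_kernel (obj (I n) p) (obj (I (Suc n)) p) (d n p) = \<eta> n p ` carrier (obj (G n) p)"
    if p: "p \<in> Q" for n p
  proof -
    interpret Gp: module R "obj (G (Suc n)) p" by (rule is_functorD(1)[OF G p])
    have "d n p x = \<zero>\<^bsub>obj (I (Suc n)) p\<^esub> \<longleftrightarrow> x \<in> \<eta> n p ` carrier (obj (G n) p)"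
      if x: "x \<in> carrier (obj (I n) p)" for x
    proof -
      have "d n p x = \<zero>\<^bsub>obj (I (Suc n)) p\<^esub> \<longleftrightarrow> \<eta> (Suc n) p (\<pi> n p x) = \<eta> (Suc n) p \<zero>\<^bsub>obj (G (Suc n)) p\<^esub>"
        using nat_trans_zero[OF G injective_functorD[OF I] \<eta> p] by (simp add: d_def)
      also have "\<dots> \<longleftrightarrow> \<pi> n p x = \<zero>\<^bsub>obj (G (Suc n)) p\<^esub>"
        using mono p nat_transD(3)[OF \<pi> p x] Gp.M.zero_closed unfolding mono_trans_def by (simp add: inj_on_eq_iff[of "\<eta> (Suc n) p" "carrier (obj (G (Suc n)) p)"])
      finally show ?thesis using ker[OF p x] by simp
    qed
    then show ?thesis unfolding a_kernel_eq using nat_transD(3)[OF \<eta> p] by blast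
  qed
  have "injective_resolution R Q F (\<lambda>p x. \<eta> 0 p (c' x)) I d"
    unfolding injective_resolution_def
  proof (intro conjI allI ballI I)
    show "nat_trans R Q F (I 0) (\<lambda>p x. \<eta> 0 p (c' x))"
      using nat_trans_comp[OF F'(2)] \<eta>[of 0] G0 by simp
    show "nat_trans R Q (I k) (I (Suc k)) (d k)" for k
      using nat_trans_comp[OF \<pi> \<eta>] by (simp add: d_def[abs_def])
    show "mono_trans Q F (\<lambda>p x. \<eta> 0 p (c' x))"
      using mono[of 0] c' unfolding mono_trans_def G0
      by (auto simp: inj_on_def)
    fix p assume p: "p \<in> Q"
    show "(\<lambda>x. \<eta> 0 p (c' x)) ` carrier (obj F p) = a_kernel (obj (I 0) p) (obj (I 1) p) (d 0 p)"
      using kerd[OF p, of 0] by (simp add: G0 image_image)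
    show "d k p ` carrier (obj (I k) p)
        = a_kernel (obj (I (Suc k)) p) (obj (I (Suc (Suc k))) p) (d (Suc k) p)" for k
      unfolding kerd[OF p] surj[OF p, symmetric] d_def by (simp add: image_image)
  qed
  then show ?thesis by blast
qed

text \<open>
  Let \<open>X\<close> be \<open>'p \<times> 'r \<times> nat\<close> and let \<open>U\<close> be the set of functions from \<open>X\<close> to \<open>'m option\<close>. As \<open>X\<close> is
  infinite, \<open>X \<times> X\<close> is equipotent to \<open>X\<close>, so functions from \<open>X\<close> to \<open>U\<close> are encoded in \<open>U\<close> by
  uncurrying. As \<open>U\<close> is infinite too, it also encodes the pairs and the finite subsets of its
  elements, hence the graphs of finitely supported rational functions on \<open>U\<close>.
\<close>

lemma resolvent_absorbs:
  "\<exists>c :: ('p \<Rightarrow> 'r \<Rightarrow> (('p, 'r, 'm) resolvent \<Rightarrow>\<^sub>0 rat)) \<Rightarrow> ('p, 'r, 'm) resolvent. inj c"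
proof -
  have "infinite (range (\<lambda>n. (undefined, undefined, n) :: 'p \<times> 'r \<times> nat))"
    by (rule range_inj_infinite) (simp add: inj_def)
  then have X: "infinite (UNIV :: ('p \<times> 'r \<times> nat) set)" by (rule infinite_super[OF subset_UNIV])
  have "\<exists>f :: ('p \<times> 'r \<times> nat) \<times> ('p \<times> 'r \<times> nat) \<Rightarrow> 'p \<times> 'r \<times> nat. bij_betw f (UNIV \<times> UNIV) UNIV"
    using card_of_Times_same_infinite[OF X] by (simp only: card_of_ordIso)
  then obtain f :: "('p \<times> 'r \<times> nat) \<times> ('p \<times> 'r \<times> nat) \<Rightarrow> 'p \<times> 'r \<times> nat" where "bij f"
    by (simp only: UNIV_Times_UNIV, blast)
  then obtain \<pi> :: "'p \<times> 'r \<times> nat \<Rightarrow> ('p \<times> 'r \<times> nat) \<times> ('p \<times> 'r \<times> nat)" where \<pi>: "surj \<pi>"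
    using bij_imp_bij_inv bij_is_surj by blast
  define code :: "nat \<Rightarrow> ('p, 'r, 'm) resolvent" where
    "code n = (\<lambda>(p, r, m). if m = n then None else Some undefined)" for n
  have code: "inj code"
  proof (rule injI)
    fix a b assume "code a = code b"
    then have "code a (undefined, undefined, a) = code b (undefined, undefined, a)" by simp
    then show "a = b" by (simp add: code_def split: if_splits)
  qed
  then have U: "infinite (UNIV :: ('p, 'r, 'm) resolvent set)"
    by (rule infinite_super[OF subset_UNIV range_inj_infinite])
  have "\<exists>f :: ('p, 'r, 'm) resolvent \<times> ('p, 'r, 'm) resolvent \<Rightarrow> ('p, 'r, 'm) resolvent. bij_betw f (UNIV \<times> UNIV) UNIV"
    using card_of_Times_same_infinite[OF U] by (simp only: card_of_ordIso)
  then obtain pr :: "('p, 'r, 'm) resolvent \<times> ('p, 'r, 'm) resolvent \<Rightarrow> ('p, 'r, 'm) resolvent"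
    where pr: "inj pr" by (simp only: UNIV_Times_UNIV bij_betw_def, blast)
  from eqpoll_Fpow[OF U]
  obtain fs :: "('p, 'r, 'm) resolvent set \<Rightarrow> ('p, 'r, 'm) resolvent" where fs: "inj_on fs (Fpow UNIV)"
    by (auto simp: eqpoll_def bij_betw_def)
  define graph where
    "graph f = (\<lambda>x. pr (x, code (to_nat (Poly_Mapping.lookup f x)))) ` Poly_Mapping.keys f"
    for f :: "('p, 'r, 'm) resolvent \<Rightarrow>\<^sub>0 rat"
  have sub: "Poly_Mapping.lookup f x = Poly_Mapping.lookup g x"
    if "graph f = graph g" "x \<in> Poly_Mapping.keys f" for f g x
  proof -
    have "pr (x, code (to_nat (Poly_Mapping.lookup f x))) \<in> graph g" using that unfolding graph_def by blast
    then obtain y where "pr (x, code (to_nat (Poly_Mapping.lookup f x))) = pr (y, code (to_nat (Poly_Mapping.lookup g y)))"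
      unfolding graph_def by blast
    then have "(x, code (to_nat (Poly_Mapping.lookup f x))) = (y, code (to_nat (Poly_Mapping.lookup g y)))"
      by (rule injD[OF pr])
    then show ?thesis using inj_eq[OF code] inj_to_nat by (metis Pair_inject injD)
  qed
  have graph_inj: "f = g" if "graph f = graph g" for f g
  proof (rule poly_mapping_eqI)
    fix x
    show "Poly_Mapping.lookup f x = Poly_Mapping.lookup g x"
      using sub[OF that] sub[OF that[symmetric]] by (metis in_keys_iff)
  qed
  define c1 where "c1 f = fs (graph f)" for f
  have "graph f \<in> Fpow UNIV" for f by (simp add: Fpow_def graph_def)
  then have c1: "f = g" if "c1 f = c1 g" for f g
    using that graph_inj inj_onD[OF fs] unfolding c1_def by blast
  define c where "c s = (\<lambda>x. case \<pi> x of ((p, r, n), y) \<Rightarrow> c1 (s p r) y)" for s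
  have "inj c"
  proof (rule injI)
    fix s t assume eq: "c s = c t"
    have "c1 (s p r) y = c1 (t p r) y" for p r y
    proof -
      obtain x where "\<pi> x = ((p, r, 0), y)" using \<pi> by (metis surjD)
      then show ?thesis using fun_cong[OF eq, of x] by (simp add: c_def)
    qed
    then show "s = t" using c1 by (intro ext) blast
  qed
  then show ?thesis by blast
qed

section \<open>Cohomology of the limit\<close>

lemma lim_module_mem:
  "s \<in> carrier (lim_module Q F) \<longleftrightarrow> s \<in> extensional Q \<and> (\<forall>p\<in>Q. s p \<in> carrier (obj F p)) \<and>
     (\<forall>p\<in>Q. \<forall>q\<in>Q. p \<le> q \<longrightarrow> res F q p (s q) = s p)"
  by (auto simp: lim_module_def PiE_def Pi_def)

lemma lim_module_apply:
  assumes "p \<in> Q"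
  shows "\<zero>\<^bsub>lim_module Q F\<^esub> p = \<zero>\<^bsub>obj F p\<^esub>"
    and "(s \<oplus>\<^bsub>lim_module Q F\<^esub> t) p = s p \<oplus>\<^bsub>obj F p\<^esub> t p"
    and "(a \<odot>\<^bsub>lim_module Q F\<^esub> s) p = a \<odot>\<^bsub>obj F p\<^esub> s p"
    and "lim_map Q \<eta> s p = \<eta> p (s p)"
  using assms by (simp_all add: lim_module_def lim_map_def)

lemma lim_module_eqI:
  assumes "s \<in> carrier (lim_module Q F)" "t \<in> carrier (lim_module Q F)" "\<And>p. p \<in> Q \<Longrightarrow> s p = t p"
  shows "s = t"
  by (rule extensionalityI[where A = Q]) (use assms in \<open>auto simp: lim_module_mem\<close>)

lemma module_lim_module:
  assumes R: "cring R" and F: "is_functor R Q F"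
  shows "module R (lim_module Q F)"
proof -
  let ?L = "lim_module Q F"
  note m = is_functorD(1)[OF F]
  have ab: "abelian_group (obj F p)" if "p \<in> Q" for p using m[OF that] by (simp add: module_def)
  have mon: "abelian_monoid (obj F p)" if "p \<in> Q" for p using ab[OF that] by (simp add: abelian_group_def)
  note res_hom = module_homD[OF is_functorD(2)[OF F]]
  have sc: "s p \<in> carrier (obj F p)" if "s \<in> carrier ?L" "p \<in> Q" for s p
    using that by (simp add: lim_module_mem)
  have add_cl: "s \<oplus>\<^bsub>?L\<^esub> t \<in> carrier ?L" if "s \<in> carrier ?L" "t \<in> carrier ?L" for s t
  proof -
    have "s \<oplus>\<^bsub>?L\<^esub> t \<in> extensional Q" by (simp add: lim_module_def)
    then show ?thesis using that
      by (simp add: lim_module_mem lim_module_apply res_hom abelian_monoid.a_closed[OF mon])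
  qed
  have zero_cl: "\<zero>\<^bsub>?L\<^esub> \<in> carrier ?L"
  proof -
    have "\<zero>\<^bsub>?L\<^esub> \<in> extensional Q" by (simp add: lim_module_def)
    then show ?thesis
      by (simp add: lim_module_mem lim_module_apply res_zero[OF F] abelian_monoid.zero_closed[OF mon])
  qed
  have smult_cl: "a \<odot>\<^bsub>?L\<^esub> s \<in> carrier ?L" if "a \<in> carrier R" "s \<in> carrier ?L" for a s
  proof -
    have "a \<odot>\<^bsub>?L\<^esub> s \<in> extensional Q" by (simp add: lim_module_def)
    then show ?thesis using that
      by (simp add: lim_module_mem lim_module_apply res_hom module.smult_closed[OF m])
  qed
  show ?thesis
  proof (rule moduleI[OF R])
    show "abelian_group ?L"
    proof (rule abelian_groupI[OF add_cl zero_cl])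
      fix x y z assume x: "x \<in> carrier ?L" and y: "y \<in> carrier ?L" and z: "z \<in> carrier ?L"
      show "x \<oplus>\<^bsub>?L\<^esub> y \<oplus>\<^bsub>?L\<^esub> z = x \<oplus>\<^bsub>?L\<^esub> (y \<oplus>\<^bsub>?L\<^esub> z)"
        by (rule lim_module_eqI[of _ Q F])
          (use x y z in \<open>auto simp: lim_module_apply add_cl sc abelian_monoid.a_assoc[OF mon]\<close>)
    next
      fix x y assume x: "x \<in> carrier ?L" and y: "y \<in> carrier ?L"
      show "x \<oplus>\<^bsub>?L\<^esub> y = y \<oplus>\<^bsub>?L\<^esub> x"
        by (rule lim_module_eqI[of _ Q F])
          (use x y in \<open>auto simp: lim_module_apply add_cl sc abelian_monoid.a_comm[OF mon]\<close>)
    next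
      fix x assume x: "x \<in> carrier ?L"
      show "\<zero>\<^bsub>?L\<^esub> \<oplus>\<^bsub>?L\<^esub> x = x"
        by (rule lim_module_eqI[of _ Q F])
          (use x in \<open>auto simp: lim_module_apply add_cl zero_cl sc abelian_monoid.l_zero[OF mon]\<close>)
      define y where "y = (\<lambda>p\<in>Q. \<zero>\<^bsub>obj F p\<^esub> \<ominus>\<^bsub>obj F p\<^esub> x p)"
      have zm: "\<zero>\<^bsub>obj F p\<^esub> \<ominus>\<^bsub>obj F p\<^esub> a \<in> carrier (obj F p)" "(\<zero>\<^bsub>obj F p\<^esub> \<ominus>\<^bsub>obj F p\<^esub> a) \<oplus>\<^bsub>obj F p\<^esub> a = \<zero>\<^bsub>obj F p\<^esub>"
        if p: "p \<in> Q" "a \<in> carrier (obj F p)" for p a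
      proof -
        interpret Fp: module R "obj F p" by (rule m[OF p(1)])
        show "\<zero>\<^bsub>obj F p\<^esub> \<ominus>\<^bsub>obj F p\<^esub> a \<in> carrier (obj F p)" "(\<zero>\<^bsub>obj F p\<^esub> \<ominus>\<^bsub>obj F p\<^esub> a) \<oplus>\<^bsub>obj F p\<^esub> a = \<zero>\<^bsub>obj F p\<^esub>"
          using p by (simp_all add: a_minus_def Fp.M.l_neg)
      qed
      have "y \<in> carrier ?L"
        using x module_hom_minus[OF m m is_functorD(2)[OF F]]
        by (simp add: lim_module_mem y_def zm res_zero[OF F] abelian_monoid.zero_closed[OF mon])
      moreover have "y \<oplus>\<^bsub>?L\<^esub> x = \<zero>\<^bsub>?L\<^esub>"
        by (rule lim_module_eqI[OF add_cl[OF \<open>y \<in> carrier ?L\<close> x] zero_cl])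
          (simp add: lim_module_apply y_def zm sc[OF x])
      ultimately show "\<exists>y\<in>carrier ?L. y \<oplus>\<^bsub>?L\<^esub> x = \<zero>\<^bsub>?L\<^esub>" by blast
    qed auto
  next
    fix a b x assume a: "a \<in> carrier R" and b: "b \<in> carrier R" and x: "x \<in> carrier ?L"
    show "(a \<oplus>\<^bsub>R\<^esub> b) \<odot>\<^bsub>?L\<^esub> x = a \<odot>\<^bsub>?L\<^esub> x \<oplus>\<^bsub>?L\<^esub> b \<odot>\<^bsub>?L\<^esub> x"
      by (rule lim_module_eqI[of _ Q F])
        (use a b x cring.cring_simprules(1)[OF R] in \<open>auto simp: lim_module_apply add_cl smult_cl sc module.smult_l_distr[OF m]\<close>)
    show "(a \<otimes>\<^bsub>R\<^esub> b) \<odot>\<^bsub>?L\<^esub> x = a \<odot>\<^bsub>?L\<^esub> (b \<odot>\<^bsub>?L\<^esub> x)"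
      by (rule lim_module_eqI[of _ Q F])
        (use a b x cring.cring_simprules(5)[OF R] in \<open>auto simp: lim_module_apply add_cl smult_cl sc module.smult_assoc1[OF m]\<close>)
  next
    fix a x y assume a: "a \<in> carrier R" and x: "x \<in> carrier ?L" and y: "y \<in> carrier ?L"
    show "a \<odot>\<^bsub>?L\<^esub> (x \<oplus>\<^bsub>?L\<^esub> y) = a \<odot>\<^bsub>?L\<^esub> x \<oplus>\<^bsub>?L\<^esub> a \<odot>\<^bsub>?L\<^esub> y"
      by (rule lim_module_eqI[of _ Q F])
        (use a x y in \<open>auto simp: lim_module_apply add_cl smult_cl sc module.smult_r_distr[OF m]\<close>)
  next
    fix x assume x: "x \<in> carrier ?L"
    show "\<one>\<^bsub>R\<^esub> \<odot>\<^bsub>?L\<^esub> x = x"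
      by (rule lim_module_eqI[of _ Q F])
        (use x cring.cring_simprules(6)[OF R] in \<open>auto simp: lim_module_apply smult_cl sc module.smult_one[OF m]\<close>)
  qed (rule smult_cl)
qed

lemma lim_map_closed:
  assumes "nat_trans R Q F G \<eta>" "s \<in> carrier (lim_module Q F)"
  shows "lim_map Q \<eta> s \<in> carrier (lim_module Q G)"
proof -
  have "lim_map Q \<eta> s \<in> extensional Q" by (simp add: lim_map_def)
  then show ?thesis
    using assms(2) nat_transD(2,3)[OF assms(1)]
    by (auto simp: lim_module_mem lim_module_apply) metis
qed

lemma lim_map_module_hom:
  assumes R: "cring R" and F: "is_functor R Q F" and G: "is_functor R Q G" and \<eta>: "nat_trans R Q F G \<eta>"
  shows "lim_map Q \<eta> \<in> module_hom R (lim_module Q F) (lim_module Q G)"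
proof -
  interpret LF: module R "lim_module Q F" by (rule module_lim_module[OF R F])
  interpret LG: module R "lim_module Q G" by (rule module_lim_module[OF R G])
  note \<eta>h = module_homD[OF nat_transD(1)[OF \<eta>]]
  have sc: "s p \<in> carrier (obj F p)" if "s \<in> carrier (lim_module Q F)" "p \<in> Q" for s p
    using that by (simp add: lim_module_mem)
  show ?thesis
  proof (rule module_homI)
    fix x y assume "x \<in> carrier (lim_module Q F)" "y \<in> carrier (lim_module Q F)"
    then show "lim_map Q \<eta> (x \<oplus>\<^bsub>lim_module Q F\<^esub> y) = lim_map Q \<eta> x \<oplus>\<^bsub>lim_module Q G\<^esub> lim_map Q \<eta> y"
      by (intro lim_module_eqI[of _ Q G])
        (auto simp: lim_map_closed[OF \<eta>] lim_module_apply \<eta>h sc)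
  next
    fix a x assume "a \<in> carrier R" "x \<in> carrier (lim_module Q F)"
    then show "lim_map Q \<eta> (a \<odot>\<^bsub>lim_module Q F\<^esub> x) = a \<odot>\<^bsub>lim_module Q G\<^esub> lim_map Q \<eta> x"
      by (intro lim_module_eqI[of _ Q G])
        (auto simp: lim_map_closed[OF \<eta>] lim_module_apply \<eta>h sc)
  qed (rule lim_map_closed[OF \<eta>])
qed

lemma lim_cocycles_mem:
  "s \<in> lim_cocycles Q I d k \<longleftrightarrow> s \<in> carrier (lim_module Q (I k)) \<and> (\<forall>p\<in>Q. d k p (s p) = \<zero>\<^bsub>obj (I (Suc k)) p\<^esub>)"
proof -
  have "lim_map Q (d k) s = \<zero>\<^bsub>lim_module Q (I (Suc k))\<^esub> \<longleftrightarrow> (\<forall>p\<in>Q. d k p (s p) = \<zero>\<^bsub>obj (I (Suc k)) p\<^esub>)"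
    by (simp add: lim_map_def lim_module_def restrict_def fun_eq_iff) metis
  then show ?thesis by (simp add: lim_cocycles_def a_kernel_eq)
qed

lemma zero_module_lim_cohomology:
  assumes R: "cring R" and I: "\<And>k. is_functor R Q (I k)" and d: "\<And>k. nat_trans R Q (I k) (I (Suc k)) (d k)"
  shows "zero_module (lim_cohomology Q I d k) \<longleftrightarrow> lim_cocycles Q I d k \<subseteq> lim_coboundaries Q I d k"
proof -
  let ?L = "lim_module Q (I k)" and ?Z = "lim_cocycles Q I d k" and ?N = "lim_coboundaries Q I d k"
  interpret L: module R ?L by (rule module_lim_module[OF R I])
  have N: "subgroup ?N (add_monoid ?L)"
  proof (cases k)
    case 0
    then show ?thesis using L.M.add.triv_subgroup by simp
  next
    case (Suc j)
    then show ?thesis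
      using submodule_range[OF module_lim_module[OF R I] module_lim_module[OF R I] lim_map_module_hom[OF R I I d]]
      by (simp add: submodule_def)
  qed
  have Z: "?Z \<subseteq> carrier ?L" by (auto simp: lim_cocycles_mem)
  have "\<zero>\<^bsub>?L\<^esub> \<in> ?Z"
    using nat_trans_zero[OF I I d] by (auto simp: lim_cocycles_mem lim_module_apply)
  then have Z0: "?Z \<noteq> {}" by blast
  have "carrier (lim_cohomology Q I d k) = (\<Union>s\<in>?Z. {?N #>\<^bsub>add_monoid ?L\<^esub> s})"
    by (simp add: lim_cohomology_def quot_module_def A_RCOSETS_def RCOSETS_def r_coset_def)
  moreover have "\<zero>\<^bsub>lim_cohomology Q I d k\<^esub> = ?N"
    by (simp add: lim_cohomology_def quot_module_def)
  ultimately have "zero_module (lim_cohomology Q I d k) \<longleftrightarrow> (\<forall>s\<in>?Z. ?N #>\<^bsub>add_monoid ?L\<^esub> s = ?N)"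
    unfolding zero_module_def using Z0 by auto
  also have "\<dots> \<longleftrightarrow> (\<forall>s\<in>?Z. s \<in> ?N)"
  proof (rule ball_cong[OF refl])
    fix s assume "s \<in> ?Z"
    then have "s \<in> carrier (add_monoid ?L)" using Z by auto
    then show "?N #>\<^bsub>add_monoid ?L\<^esub> s = ?N \<longleftrightarrow> s \<in> ?N"
      using group.coset_join1[OF L.M.a_group _ _ N] group.coset_join2[OF L.M.a_group _ N] by blast
  qed
  finally show ?thesis by blast
qed

section \<open>Independence of the resolution\<close>

lemma injective_resolutionD:
  assumes "injective_resolution R Q F e I d"
  shows "injective_functor R Q (I k)" and "is_functor R Q (I k)"
    and "nat_trans R Q F (I 0) e" and "mono_trans Q F e"
    and "nat_trans R Q (I k) (I (Suc k)) (d k)"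
    and "p \<in> Q \<Longrightarrow> x \<in> carrier (obj F p) \<Longrightarrow> d 0 p (e p x) = \<zero>\<^bsub>obj (I (Suc 0)) p\<^esub>"
    and "p \<in> Q \<Longrightarrow> y \<in> carrier (obj (I 0) p) \<Longrightarrow> d 0 p y = \<zero>\<^bsub>obj (I (Suc 0)) p\<^esub>
      \<Longrightarrow> \<exists>x\<in>carrier (obj F p). y = e p x"
    and "p \<in> Q \<Longrightarrow> z \<in> carrier (obj (I k) p) \<Longrightarrow> d (Suc k) p (d k p z) = \<zero>\<^bsub>obj (I (Suc (Suc k))) p\<^esub>"
    and "p \<in> Q \<Longrightarrow> y \<in> carrier (obj (I (Suc k)) p) \<Longrightarrow> d (Suc k) p y = \<zero>\<^bsub>obj (I (Suc (Suc k))) p\<^esub>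
      \<Longrightarrow> \<exists>x\<in>carrier (obj (I k) p). y = d k p x"
proof -
  show "injective_functor R Q (I k)" "is_functor R Q (I k)" "nat_trans R Q F (I 0) e" "mono_trans Q F e"
    "nat_trans R Q (I k) (I (Suc k)) (d k)"
    using assms injective_functorD by (auto simp: injective_resolution_def)
  have e: "e p ` carrier (obj F p) = {x \<in> carrier (obj (I 0) p). d 0 p x = \<zero>\<^bsub>obj (I (Suc 0)) p\<^esub>}" if "p \<in> Q" for p
    using assms that by (simp add: injective_resolution_def a_kernel_eq)
  have d: "d k p ` carrier (obj (I k) p)
    = {x \<in> carrier (obj (I (Suc k)) p). d (Suc k) p x = \<zero>\<^bsub>obj (I (Suc (Suc k))) p\<^esub>}" if "p \<in> Q" for p
    using assms that by (simp add: injective_resolution_def a_kernel_eq)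
  show "d 0 p (e p x) = \<zero>\<^bsub>obj (I (Suc 0)) p\<^esub>" if "p \<in> Q" "x \<in> carrier (obj F p)"
    using e[OF that(1)] that(2) by blast
  show "\<exists>x\<in>carrier (obj F p). y = e p x"
    if "p \<in> Q" "y \<in> carrier (obj (I 0) p)" "d 0 p y = \<zero>\<^bsub>obj (I (Suc 0)) p\<^esub>"
    using e[OF that(1)] that(2,3) by blast
  show "d (Suc k) p (d k p z) = \<zero>\<^bsub>obj (I (Suc (Suc k))) p\<^esub>" if "p \<in> Q" "z \<in> carrier (obj (I k) p)"
    using d[OF that(1)] that(2) by blast
  show "\<exists>x\<in>carrier (obj (I k) p). y = d k p x"
    if "p \<in> Q" "y \<in> carrier (obj (I (Suc k)) p)" "d (Suc k) p y = \<zero>\<^bsub>obj (I (Suc (Suc k))) p\<^esub>"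
    using d[OF that(1)] that(2,3) by blast
qed

text \<open>
  The comparison theorem. The recursion carries along that \<open>\<phi> k\<close> maps the kernel of \<open>d k\<close> into the
  kernel of \<open>d' k\<close>: this is what lets \<open>d' k\<close> after \<open>\<phi> k\<close> factor through \<open>d k\<close>, and exactness of \<open>I\<close>
  passes it on to the next degree.
\<close>

lemma resolution_map_exists:
  fixes I J :: "nat \<Rightarrow> ('p::order, 'r, 'u) pfunctor"
  assumes F: "is_functor R Q F"
    and I: "injective_resolution R Q F e I d" and J: "injective_resolution R Q F e' J d'"
  shows "\<exists>\<phi>. (\<forall>k. nat_trans R Q (I k) (J k) (\<phi> k)) \<and>
    (\<forall>p\<in>Q. \<forall>x\<in>carrier (obj F p). \<phi> 0 p (e p x) = e' p x) \<and>
    (\<forall>k. \<forall>p\<in>Q. \<forall>x\<in>carrier (obj (I k) p). \<phi> (Suc k) p (d k p x) = d' k p (\<phi> k p x))"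
proof -
  note ID = injective_resolutionD[OF I] and JD = injective_resolutionD[OF J]
  define chain where "chain k \<phi> \<longleftrightarrow> nat_trans R Q (I k) (J k) \<phi> \<and>
    (\<forall>p\<in>Q. \<forall>x\<in>carrier (obj (I k) p). d k p x = \<zero>\<^bsub>obj (I (Suc k)) p\<^esub> \<longrightarrow> d' k p (\<phi> p x) = \<zero>\<^bsub>obj (J (Suc k)) p\<^esub>) \<and>
    (k = 0 \<longrightarrow> (\<forall>p\<in>Q. \<forall>x\<in>carrier (obj F p). \<phi> p (e p x) = e' p x))" for k \<phi>
  have "\<exists>\<phi>. \<forall>k. chain k (\<phi> k) \<and>
    (\<forall>p\<in>Q. \<forall>x\<in>carrier (obj (I k) p). \<phi> (Suc k) p (d k p x) = d' k p (\<phi> k p x))"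
  proof (rule dependent_nat_choice)
    have "x = \<zero>\<^bsub>obj F p\<^esub>" if "p \<in> Q" "x \<in> carrier (obj F p)" "e p x = \<zero>\<^bsub>obj (I 0) p\<^esub>" for p x
    proof -
      interpret Fp: module R "obj F p" by (rule is_functorD(1)[OF F that(1)])
      have "e p x = e p \<zero>\<^bsub>obj F p\<^esub>" using nat_trans_zero[OF F ID(2) ID(3) that(1)] that(3) by simp
      then show ?thesis using ID(4) that Fp.M.zero_closed unfolding mono_trans_def by (blast dest: inj_onD)
    qed
    then have "\<exists>g. nat_trans R Q (I 0) (J 0) g \<and> (\<forall>p\<in>Q. \<forall>x\<in>carrier (obj F p). g p (e p x) = e' p x)"
      using nat_trans_zero[OF F JD(2) JD(3)] by (intro injective_functor_factor[OF JD(1) F ID(2) ID(3) JD(3)]) blast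
    then obtain g where g: "nat_trans R Q (I 0) (J 0) g"
      and ge: "\<And>p x. p \<in> Q \<Longrightarrow> x \<in> carrier (obj F p) \<Longrightarrow> g p (e p x) = e' p x" by blast
    have "d' 0 p (g p y) = \<zero>\<^bsub>obj (J (Suc 0)) p\<^esub>"
      if y: "p \<in> Q" "y \<in> carrier (obj (I 0) p)" "d 0 p y = \<zero>\<^bsub>obj (I (Suc 0)) p\<^esub>" for p y
      using ID(7)[OF y] ge JD(6) y(1) by auto
    then show "\<exists>\<phi>. chain 0 \<phi>" unfolding chain_def using g ge by blast
  next
    fix \<phi> k assume \<phi>: "chain k \<phi>"
    then have nat\<phi>: "nat_trans R Q (I k) (J k) \<phi>" by (simp add: chain_def)
    have "\<exists>g. nat_trans R Q (I (Suc k)) (J (Suc k)) g \<and>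
      (\<forall>p\<in>Q. \<forall>x\<in>carrier (obj (I k) p). g p (d k p x) = d' k p (\<phi> p x))"
      using \<phi> by (intro injective_functor_factor[OF JD(1) ID(2) ID(2) ID(5) nat_trans_comp[OF nat\<phi> JD(5)]])
        (simp add: chain_def)
    then obtain g where g: "nat_trans R Q (I (Suc k)) (J (Suc k)) g"
      and gd: "\<And>p x. p \<in> Q \<Longrightarrow> x \<in> carrier (obj (I k) p) \<Longrightarrow> g p (d k p x) = d' k p (\<phi> p x)" by blast
    have "d' (Suc k) p (g p y) = \<zero>\<^bsub>obj (J (Suc (Suc k))) p\<^esub>"
      if y: "p \<in> Q" "y \<in> carrier (obj (I (Suc k)) p)" "d (Suc k) p y = \<zero>\<^bsub>obj (I (Suc (Suc k))) p\<^esub>" for p y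
      using ID(9)[OF y] gd[OF y(1)] JD(8)[OF y(1) nat_transD(3)[OF nat\<phi> y(1)]] by auto
    then show "\<exists>\<phi>'. chain (Suc k) \<phi>' \<and>
      (\<forall>p\<in>Q. \<forall>x\<in>carrier (obj (I k) p). \<phi>' p (d k p x) = d' k p (\<phi> p x))"
      unfolding chain_def using g gd by blast
  qed
  then obtain \<phi> where chain: "\<And>k. chain k (\<phi> k)"
    and comm: "\<forall>k. \<forall>p\<in>Q. \<forall>x\<in>carrier (obj (I k) p). \<phi> (Suc k) p (d k p x) = d' k p (\<phi> k p x)"
    by blast
  have "\<forall>k. nat_trans R Q (I k) (J k) (\<phi> k)" using chain by (simp add: chain_def)
  moreover have "\<forall>p\<in>Q. \<forall>x\<in>carrier (obj F p). \<phi> 0 p (e p x) = e' p x"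
    using chain[of 0] by (simp add: chain_def)
  ultimately show ?thesis using comm by (intro exI[of _ \<phi>] conjI)
qed

text \<open>
  A chain map \<open>\<theta>\<close> over the zero map is null-homotopic. The next homotopy is obtained by factoring
  \<open>\<theta> (Suc k) - d k h k\<close> through \<open>d (Suc k)\<close>. This is possible if the difference kills the kernel of
  \<open>d (Suc k)\<close>, the range of \<open>d k\<close>, which is what the recursion carries along.
\<close>

lemma resolution_homotopy_exists:
  fixes J :: "nat \<Rightarrow> ('p::order, 'r, 'u) pfunctor"
  assumes J: "injective_resolution R Q F e J d"
    and \<theta>: "\<And>k. nat_trans R Q (J k) (J k) (\<theta> k)"
    and \<theta>0: "\<And>p x. p \<in> Q \<Longrightarrow> x \<in> carrier (obj F p) \<Longrightarrow> \<theta> 0 p (e p x) = \<zero>\<^bsub>obj (J 0) p\<^esub>"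
    and \<theta>d: "\<And>k p x. p \<in> Q \<Longrightarrow> x \<in> carrier (obj (J k) p) \<Longrightarrow> \<theta> (Suc k) p (d k p x) = d k p (\<theta> k p x)"
  shows "\<exists>h. (\<forall>k. nat_trans R Q (J (Suc k)) (J k) (h k)) \<and>
    (\<forall>p\<in>Q. \<forall>x\<in>carrier (obj (J 0) p). h 0 p (d 0 p x) = \<theta> 0 p x) \<and>
    (\<forall>k. \<forall>p\<in>Q. \<forall>x\<in>carrier (obj (J (Suc k)) p).
      h (Suc k) p (d (Suc k) p x) = \<theta> (Suc k) p x \<ominus>\<^bsub>obj (J (Suc k)) p\<^esub> d k p (h k p x))"
proof -
  note JD = injective_resolutionD[OF J]
  define homotopy where "homotopy k h \<longleftrightarrow> nat_trans R Q (J (Suc k)) (J k) h \<and>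
    (\<forall>p\<in>Q. \<forall>x\<in>carrier (obj (J k) p). d k p (h p (d k p x)) = d k p (\<theta> k p x)) \<and>
    (k = 0 \<longrightarrow> (\<forall>p\<in>Q. \<forall>x\<in>carrier (obj (J 0) p). h p (d 0 p x) = \<theta> 0 p x))" for k h
  have "\<exists>h. \<forall>k. homotopy k (h k) \<and> (\<forall>p\<in>Q. \<forall>x\<in>carrier (obj (J (Suc k)) p).
      h (Suc k) p (d (Suc k) p x) = \<theta> (Suc k) p x \<ominus>\<^bsub>obj (J (Suc k)) p\<^esub> d k p (h k p x))"
  proof (rule dependent_nat_choice)
    have "\<exists>g. nat_trans R Q (J (Suc 0)) (J 0) g \<and> (\<forall>p\<in>Q. \<forall>x\<in>carrier (obj (J 0) p). g p (d 0 p x) = \<theta> 0 p x)"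
      by (intro injective_functor_factor[OF JD(1) JD(2) JD(2) JD(5) \<theta>]) (use JD(7) \<theta>0 in blast)
    then show "\<exists>h. homotopy 0 h" by (auto simp: homotopy_def)
  next
    fix h k assume h: "homotopy k h"
    then have nath: "nat_trans R Q (J (Suc k)) (J k) h"
      and hd: "\<And>p x. p \<in> Q \<Longrightarrow> x \<in> carrier (obj (J k) p) \<Longrightarrow> d k p (h p (d k p x)) = d k p (\<theta> k p x)"
      by (simp_all add: homotopy_def)
    let ?f = "\<lambda>p x. \<theta> (Suc k) p x \<ominus>\<^bsub>obj (J (Suc k)) p\<^esub> d k p (h p x)"
    have f: "nat_trans R Q (J (Suc k)) (J (Suc k)) ?f"
      by (rule nat_trans_diff[OF JD(2) JD(2) \<theta> nat_trans_comp[OF nath JD(5)]])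
    have "\<exists>g. nat_trans R Q (J (Suc (Suc k))) (J (Suc k)) g \<and>
      (\<forall>p\<in>Q. \<forall>x\<in>carrier (obj (J (Suc k)) p). g p (d (Suc k) p x) = ?f p x)"
    proof (rule injective_functor_factor[OF JD(1) JD(2) JD(2) JD(5) f])
      fix p y assume y: "p \<in> Q" "y \<in> carrier (obj (J (Suc k)) p)" "d (Suc k) p y = \<zero>\<^bsub>obj (J (Suc (Suc k))) p\<^esub>"
      interpret Jp: module R "obj (J (Suc k)) p" by (rule is_functorD(1)[OF JD(2) y(1)])
      obtain x where x: "x \<in> carrier (obj (J k) p)" "y = d k p x" using JD(9)[OF y] by blast
      show "?f p y = \<zero>\<^bsub>obj (J (Suc k)) p\<^esub>"
        using hd[OF y(1) x(1)] \<theta>d[OF y(1) x(1)] nat_transD(3)[OF \<theta> y(1) y(2)] x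
        by (simp add: a_minus_def Jp.M.r_neg)
    qed
    then obtain g where g: "nat_trans R Q (J (Suc (Suc k))) (J (Suc k)) g"
      and gd: "\<And>p x. p \<in> Q \<Longrightarrow> x \<in> carrier (obj (J (Suc k)) p) \<Longrightarrow> g p (d (Suc k) p x) = ?f p x" by blast
    have "d (Suc k) p (g p (d (Suc k) p x)) = d (Suc k) p (\<theta> (Suc k) p x)"
      if p: "p \<in> Q" and x: "x \<in> carrier (obj (J (Suc k)) p)" for p x
    proof -
      interpret Jp: module R "obj (J (Suc (Suc k))) p" by (rule is_functorD(1)[OF JD(2) p])
      have hx: "h p x \<in> carrier (obj (J k) p)" by (rule nat_transD(3)[OF nath p x])
      have \<theta>x: "\<theta> (Suc k) p x \<in> carrier (obj (J (Suc k)) p)" by (rule nat_transD(3)[OF \<theta> p x])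
      have "d (Suc k) p (g p (d (Suc k) p x))
        = d (Suc k) p (\<theta> (Suc k) p x) \<ominus>\<^bsub>obj (J (Suc (Suc k))) p\<^esub> d (Suc k) p (d k p (h p x))"
        unfolding gd[OF p x]
        by (rule module_hom_minus[OF is_functorD(1)[OF JD(2) p] is_functorD(1)[OF JD(2) p]
          nat_transD(1)[OF JD(5) p] \<theta>x nat_transD(3)[OF JD(5) p hx]])
      also have "\<dots> = d (Suc k) p (\<theta> (Suc k) p x)"
        using JD(8)[OF p hx] nat_transD(3)[OF JD(5) p \<theta>x]
        by (metis Jp.M.minus_equality Jp.M.r_zero Jp.M.zero_closed a_minus_def)
      finally show ?thesis .
    qed
    then show "\<exists>h'. homotopy (Suc k) h' \<and> (\<forall>p\<in>Q. \<forall>x\<in>carrier (obj (J (Suc k)) p). h' p (d (Suc k) p x) = ?f p x)"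
      unfolding homotopy_def using g gd by blast
  qed
  then obtain h where hom: "\<And>k. homotopy k (h k)"
    and comm: "\<forall>k. \<forall>p\<in>Q. \<forall>x\<in>carrier (obj (J (Suc k)) p).
      h (Suc k) p (d (Suc k) p x) = \<theta> (Suc k) p x \<ominus>\<^bsub>obj (J (Suc k)) p\<^esub> d k p (h k p x)"
    by blast
  have "\<forall>k. nat_trans R Q (J (Suc k)) (J k) (h k)" using hom by (simp add: homotopy_def)
  moreover have "\<forall>p\<in>Q. \<forall>x\<in>carrier (obj (J 0) p). h 0 p (d 0 p x) = \<theta> 0 p x"
    using hom[of 0] by (simp add: homotopy_def)
  ultimately show ?thesis using comm by (intro exI[of _ h] conjI)
qed

text \<open>
  Take chain maps \<open>\<phi>\<close> from \<open>J\<close> to \<open>I\<close> and \<open>\<psi>\<close> from \<open>I\<close> to \<open>J\<close> over the identity of \<open>F\<close>. The difference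
  of the identity and \<open>\<psi> \<phi>\<close> has a null-homotopy \<open>h\<close>, so that a cocycle \<open>s\<close> of \<open>lim J\<close> satisfies
  \<open>s = \<psi> \<phi> s + d' h s\<close>. If \<open>\<phi> s = d t\<close>, then \<open>s = d' (\<psi> t + h s)\<close>.
\<close>

lemma lim_exactness_independent:
  fixes I J :: "nat \<Rightarrow> ('p::order, 'r, 'u) pfunctor"
  assumes R: "cring R" and F: "is_functor R Q F"
    and I: "injective_resolution R Q F e I d" and J: "injective_resolution R Q F e' J d'"
    and exact: "lim_cocycles Q I d k \<subseteq> lim_coboundaries Q I d k"
  shows "lim_cocycles Q J d' k \<subseteq> lim_coboundaries Q J d' k"
proof
  note ID = injective_resolutionD[OF I] and JD = injective_resolutionD[OF J]
  obtain \<phi> where \<phi>: "\<And>k. nat_trans R Q (J k) (I k) (\<phi> k)"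
    and \<phi>0: "\<And>p x. p \<in> Q \<Longrightarrow> x \<in> carrier (obj F p) \<Longrightarrow> \<phi> 0 p (e' p x) = e p x"
    and \<phi>d: "\<And>k p x. p \<in> Q \<Longrightarrow> x \<in> carrier (obj (J k) p) \<Longrightarrow> \<phi> (Suc k) p (d' k p x) = d k p (\<phi> k p x)"
    using resolution_map_exists[OF F J I] by blast
  obtain \<psi> where \<psi>: "\<And>k. nat_trans R Q (I k) (J k) (\<psi> k)"
    and \<psi>0: "\<And>p x. p \<in> Q \<Longrightarrow> x \<in> carrier (obj F p) \<Longrightarrow> \<psi> 0 p (e p x) = e' p x"
    and \<psi>d: "\<And>k p x. p \<in> Q \<Longrightarrow> x \<in> carrier (obj (I k) p) \<Longrightarrow> \<psi> (Suc k) p (d k p x) = d' k p (\<psi> k p x)"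
    using resolution_map_exists[OF F I J] by blast
  \<comment> \<open>A chain map from \<open>J\<close> to itself that vanishes on \<open>F\<close>.\<close>
  define \<theta> where "\<theta> k = (\<lambda>p x. x \<ominus>\<^bsub>obj (J k) p\<^esub> \<psi> k p (\<phi> k p x))" for k
  have \<theta>: "nat_trans R Q (J k) (J k) (\<theta> k)" for k
    unfolding \<theta>_def by (rule nat_trans_diff[OF JD(2) JD(2) nat_trans_id[OF JD(2)] nat_trans_comp[OF \<phi> \<psi>]])
  have \<theta>0: "\<theta> 0 p (e' p x) = \<zero>\<^bsub>obj (J 0) p\<^esub>" if p: "p \<in> Q" and x: "x \<in> carrier (obj F p)" for p x
  proof -
    interpret Jp: module R "obj (J 0) p" by (rule is_functorD(1)[OF JD(2) p])
    show ?thesis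
      using nat_transD(3)[OF JD(3) p x] by (simp add: \<theta>_def \<phi>0[OF p x] \<psi>0[OF p x] a_minus_def Jp.M.r_neg)
  qed
  have \<theta>d: "\<theta> (Suc k) p (d' k p x) = d' k p (\<theta> k p x)" if p: "p \<in> Q" and x: "x \<in> carrier (obj (J k) p)" for k p x
    using module_hom_minus[OF is_functorD(1)[OF JD(2) p] is_functorD(1)[OF JD(2) p] nat_transD(1)[OF JD(5) p] x
        nat_transD(3)[OF \<psi> p nat_transD(3)[OF \<phi> p x]]]
    by (simp add: \<theta>_def \<phi>d[OF p x] \<psi>d[OF p nat_transD(3)[OF \<phi> p x]])
  obtain h where h: "\<And>k. nat_trans R Q (J (Suc k)) (J k) (h k)"
    and h0: "\<And>p x. p \<in> Q \<Longrightarrow> x \<in> carrier (obj (J 0) p) \<Longrightarrow> h 0 p (d' 0 p x) = \<theta> 0 p x"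
    and hS: "\<And>k p x. p \<in> Q \<Longrightarrow> x \<in> carrier (obj (J (Suc k)) p) \<Longrightarrow>
      h (Suc k) p (d' (Suc k) p x) = \<theta> (Suc k) p x \<ominus>\<^bsub>obj (J (Suc k)) p\<^esub> d' k p (h k p x)"
    using resolution_homotopy_exists[where \<theta> = \<theta>, OF J \<theta> \<theta>0 \<theta>d] by blast
  fix s assume "s \<in> lim_cocycles Q J d' k"
  then have s: "s \<in> carrier (lim_module Q (J k))" and ds: "\<And>p. p \<in> Q \<Longrightarrow> d' k p (s p) = \<zero>\<^bsub>obj (J (Suc k)) p\<^esub>"
    by (auto simp: lim_cocycles_mem)
  have sp: "s p \<in> carrier (obj (J k) p)" if "p \<in> Q" for p using s that by (simp add: lim_module_mem)
  have "lim_map Q (\<phi> k) s \<in> lim_cocycles Q I d k"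
    using lim_map_closed[OF \<phi> s] \<phi>d[OF _ sp, symmetric] ds nat_trans_zero[OF JD(2) ID(2) \<phi>]
    by (simp add: lim_cocycles_mem lim_module_apply)
  then have \<phi>s: "lim_map Q (\<phi> k) s \<in> lim_coboundaries Q I d k" using exact by blast
  show "s \<in> lim_coboundaries Q J d' k"
  proof (cases k)
    case 0
    have "s p = \<zero>\<^bsub>obj (J k) p\<^esub>" if p: "p \<in> Q" for p
    proof -
      interpret Jp: module R "obj (J k) p" by (rule is_functorD(1)[OF JD(2) p])
      have "lim_map Q (\<phi> k) s p = \<zero>\<^bsub>obj (I k) p\<^esub>" using \<phi>s p 0 by (simp add: lim_module_apply)
      then have "\<psi> k p (\<phi> k p (s p)) = \<zero>\<^bsub>obj (J k) p\<^esub>"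
        using p nat_trans_zero[OF ID(2) JD(2) \<psi> p] by (simp add: lim_module_apply)
      moreover have "\<theta> k p (s p) = \<zero>\<^bsub>obj (J k) p\<^esub>"
        using h0[of p "s p"] sp[OF p] ds[OF p] nat_trans_zero[OF JD(2) JD(2) h p] p 0 by simp
      ultimately show ?thesis using sp[OF p] by (simp add: \<theta>_def Jp.M.minus_eq_zero_iff)
    qed
    then have "s = \<zero>\<^bsub>lim_module Q (J k)\<^esub>"
      using s by (intro lim_module_eqI[OF s])
        (simp_all add: lim_module_apply abelian_monoid.zero_closed abelian_group.axioms module.axioms(2)[OF module_lim_module[OF R JD(2)]])
    then show ?thesis using 0 by simp
  next
    case (Suc j)
    interpret Lj: module R "lim_module Q (J j)" by (rule module_lim_module[OF R JD(2)])
    from \<phi>s Suc obtain t where t: "t \<in> carrier (lim_module Q (I j))"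
      and \<phi>t: "lim_map Q (\<phi> (Suc j)) s = lim_map Q (d j) t" by auto
    have tp: "t p \<in> carrier (obj (I j) p)" if "p \<in> Q" for p using t that by (simp add: lim_module_mem)
    have s': "s \<in> carrier (lim_module Q (J (Suc j)))" using s Suc by simp
    let ?u = "lim_map Q (\<psi> j) t \<oplus>\<^bsub>lim_module Q (J j)\<^esub> lim_map Q (h j) s"
    have u: "?u \<in> carrier (lim_module Q (J j))"
      using lim_map_closed[OF \<psi> t] lim_map_closed[OF h s'] by simp
    have "s = lim_map Q (d' j) ?u"
    proof (rule lim_module_eqI[OF s' lim_map_closed[OF JD(5) u]])
      fix p assume p: "p \<in> Q"
      interpret Jp: module R "obj (J (Suc j)) p" by (rule is_functorD(1)[OF JD(2) p])
      have sp': "s p \<in> carrier (obj (J (Suc j)) p)" using sp[OF p] Suc by simp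
      have hs: "h j p (s p) \<in> carrier (obj (J j) p)" by (rule nat_transD(3)[OF h p sp'])
      have \<psi>t: "\<psi> j p (t p) \<in> carrier (obj (J j) p)" by (rule nat_transD(3)[OF \<psi> p tp[OF p]])
      note c = nat_transD(3)[OF JD(5) p hs] nat_transD(3)[OF JD(5) p \<psi>t]
      have "\<theta> (Suc j) p (s p) \<ominus>\<^bsub>obj (J (Suc j)) p\<^esub> d' j p (h j p (s p)) = \<zero>\<^bsub>obj (J (Suc j)) p\<^esub>"
        using hS[OF p sp'] ds[OF p] nat_trans_zero[OF JD(2) JD(2) h p] Suc by simp
      then have 1: "\<theta> (Suc j) p (s p) = d' j p (h j p (s p))"
        using nat_transD(3)[OF \<theta> p sp'] c by (simp add: Jp.M.minus_eq_zero_iff)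
      have "\<phi> (Suc j) p (s p) = d j p (t p)" using fun_cong[OF \<phi>t, of p] p by (simp add: lim_module_apply)
      then have 2: "\<psi> (Suc j) p (\<phi> (Suc j) p (s p)) = d' j p (\<psi> j p (t p))"
        using \<psi>d[OF p tp[OF p]] by simp
      have "s p \<ominus>\<^bsub>obj (J (Suc j)) p\<^esub> d' j p (\<psi> j p (t p)) = d' j p (h j p (s p))"
        using 1 2 by (simp add: \<theta>_def)
      then have "s p = d' j p (h j p (s p)) \<oplus>\<^bsub>obj (J (Suc j)) p\<^esub> d' j p (\<psi> j p (t p))"
        using sp' c by (metis Jp.M.a_inv_closed Jp.M.a_assoc Jp.M.l_neg Jp.M.r_zero a_minus_def)
      also have "\<dots> = d' j p (\<psi> j p (t p) \<oplus>\<^bsub>obj (J j) p\<^esub> h j p (s p))"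
        using module_homD(2)[OF nat_transD(1)[OF JD(5) p] \<psi>t hs] c by (simp add: Jp.M.a_comm)
      finally show "s p = lim_map Q (d' j) ?u p" using p by (simp add: lim_module_apply)
    qed
    then show ?thesis using u Suc by auto
  qed
qed

text \<open>
  The existence of \<open>J\<close> ensures that the choice in the definition of \<open>Rlim\<close> picks an injective
  resolution, which may then be exchanged for \<open>J\<close>.
\<close>

lemma zero_module_Rlim_iff:
  fixes F :: "('p::order, 'r, 'm) pfunctor" and J :: "nat \<Rightarrow> ('p, 'r, ('p, 'r, 'm) resolvent) pfunctor"
  assumes R: "cring R" and F: "is_functor R Q F" and J: "injective_resolution R Q F e J d"
  shows "zero_module (Rlim R Q F k) \<longleftrightarrow> lim_cocycles Q J d k \<subseteq> lim_coboundaries Q J d k"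
proof -
  define res_of where "res_of = (\<lambda>(I :: nat \<Rightarrow> ('p, 'r, ('p, 'r, 'm) resolvent) pfunctor, d). \<exists>e. injective_resolution R Q F e I d)"
  obtain I d' where Id: "(SOME x. res_of x) = (I, d')" by fastforce
  have "res_of (J, d)" using J by (auto simp: res_of_def)
  then have "res_of (SOME x. res_of x)" by (rule someI)
  then obtain e' where I: "injective_resolution R Q F e' I d'" unfolding Id by (auto simp: res_of_def)
  have "Rlim R Q F k = lim_cohomology Q I d' k"
    using Id by (simp add: Rlim_def res_of_def)
  then have "zero_module (Rlim R Q F k) \<longleftrightarrow> lim_cocycles Q I d' k \<subseteq> lim_coboundaries Q I d' k"
    using zero_module_lim_cohomology[where I = I and d = d', OF R injective_resolutionD(2)[OF I] injective_resolutionD(5)[OF I]] by simp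
  then show ?thesis
    using lim_exactness_independent[OF R F I J] lim_exactness_independent[OF R F J I] by blast
qed

section \<open>Vanishing from vanishing below every element\<close>

lemma injective_resolution_restrict:
  assumes R: "cring R" and I: "injective_resolution R P F e I d" and QP: "Q \<subseteq> P"
    and down: "\<And>p q. p \<in> P \<Longrightarrow> q \<in> Q \<Longrightarrow> p \<le> q \<Longrightarrow> p \<in> Q"
  shows "injective_resolution R Q F e I d"
  unfolding injective_resolution_def
proof (intro conjI allI ballI)
  note ID = injective_resolutionD[OF I]
  show "injective_functor R Q (I k)" for k by (rule injective_functor_restrict[OF R ID(1) QP down])
  show "nat_trans R Q F (I 0) e" "nat_trans R Q (I k) (I (Suc k)) (d k)" for k
    by (rule nat_trans_mono[OF ID(3) QP] nat_trans_mono[OF ID(5) QP])+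
  show "mono_trans Q F e" using ID(4) QP by (auto simp: mono_trans_def)
  fix p assume "p \<in> Q"
  then have p: "p \<in> P" using QP by blast
  show "e p ` carrier (obj F p) = a_kernel (obj (I 0) p) (obj (I 1) p) (d 0 p)"
    using I p by (simp add: injective_resolution_def)
  show "d k p ` carrier (obj (I k) p)
      = a_kernel (obj (I (Suc k)) p) (obj (I (Suc (Suc k))) p) (d (Suc k) p)" for k
    using I p by (simp add: injective_resolution_def)
qed

lemma below_subset: "below P p \<subseteq> P"
  by (auto simp: below_def)

lemma below_down: "r \<in> P \<Longrightarrow> q \<in> below P p \<Longrightarrow> r \<le> q \<Longrightarrow> r \<in> below P p"
  by (auto simp: below_def)

text \<open>
  Exactness of the resolution at \<open>p\<close> yields some \<open>u\<close> with \<open>d u = s p\<close>, whose restrictions need not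
  agree with \<open>t\<close>. The difference of \<open>t\<close> and the restriction of \<open>u\<close> is a cocycle below \<open>p\<close>, hence zero
  if \<open>k = 0\<close> and of the form \<open>d w\<close> otherwise. Since injective functors are flasque, \<open>w\<close> lifts to an element \<open>z\<close> at \<open>p\<close>, and
  \<open>u + d z\<close> still maps to \<open>s p\<close> but now restricts to \<open>t\<close>.
\<close>

lemma cochain_extend_at:
  fixes I :: "nat \<Rightarrow> ('p::order, 'r, 'u) pfunctor" and c :: "'r \<Rightarrow> 'u"
  assumes R: "cring R" and c: "inj c" and I: "injective_resolution R P F e I d" and p: "p \<in> P"
    and exact: "lim_cocycles (below P p) I d k \<subseteq> lim_coboundaries (below P p) I d k"
    and s: "s \<in> lim_cocycles P I d (Suc k)"
    and t: "t \<in> carrier (lim_module (below P p) (I k))"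
    and dt: "\<And>q. q \<in> below P p \<Longrightarrow> d k q (t q) = s q"
  shows "\<exists>y\<in>carrier (obj (I k) p). d k p y = s p \<and> (\<forall>q\<in>below P p. res (I k) p q y = t q)"
proof -
  note ID = injective_resolutionD[OF I]
  let ?B = "below P p"
  have B: "q \<in> P" "q \<le> p" if "q \<in> ?B" for q using that by (auto simp: below_def)
  interpret Ip: module R "obj (I (Suc k)) p" by (rule is_functorD(1)[OF ID(2) p])
  have sP: "s \<in> carrier (lim_module P (I (Suc k)))"
    and ds: "\<And>q. q \<in> P \<Longrightarrow> d (Suc k) q (s q) = \<zero>\<^bsub>obj (I (Suc (Suc k))) q\<^esub>"
    using s by (auto simp: lim_cocycles_mem)
  have sc: "s q \<in> carrier (obj (I (Suc k)) q)" if "q \<in> P" for q using sP that by (simp add: lim_module_mem)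
  have sr: "res (I (Suc k)) p q (s p) = s q" if "q \<in> ?B" for q
    using sP p B[OF that] by (simp add: lim_module_mem)
  have tc: "t q \<in> carrier (obj (I k) q)" if "q \<in> ?B" for q using t that by (simp add: lim_module_mem)
  have tr: "res (I k) q r (t q) = t r" if "r \<in> ?B" "q \<in> ?B" "r \<le> q" for q r
    using t that by (simp add: lim_module_mem)
  obtain u where u: "u \<in> carrier (obj (I k) p)" "s p = d k p u" using ID(9)[OF p sc[OF p] ds[OF p]] by blast
  have uc: "res (I k) p q u \<in> carrier (obj (I k) q)" if "q \<in> ?B" for q
    by (rule is_functorD(5)[OF ID(2) B(1)[OF that] p B(2)[OF that] u(1)])
  have du: "d k q (res (I k) p q u) = s q" if "q \<in> ?B" for q
    using nat_transD(2)[OF ID(5) B(1)[OF that] p B(2)[OF that] u(1)] u(2) sr[OF that] by simp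
  define v where "v = (\<lambda>q\<in>?B. t q \<ominus>\<^bsub>obj (I k) q\<^esub> res (I k) p q u)"
  have "v \<in> lim_cocycles ?B I d k"
    unfolding lim_cocycles_mem lim_module_mem
  proof (intro conjI ballI impI)
    show "v \<in> extensional ?B" by (simp add: v_def)
    fix q assume q: "q \<in> ?B"
    interpret Iq: module R "obj (I k) q" by (rule is_functorD(1)[OF ID(2) B(1)[OF q]])
    interpret Iq': module R "obj (I (Suc k)) q" by (rule is_functorD(1)[OF ID(2) B(1)[OF q]])
    show "v q \<in> carrier (obj (I k) q)" using q tc uc by (simp add: v_def)
    show "d k q (v q) = \<zero>\<^bsub>obj (I (Suc k)) q\<^esub>"
      using module_hom_minus[OF Iq.module_axioms Iq'.module_axioms nat_transD(1)[OF ID(5) B(1)[OF q]] tc[OF q] uc[OF q]]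
        q dt du sc[OF B(1)[OF q]] by (simp add: v_def Iq'.M.minus_eq_zero_iff)
    fix r assume r: "r \<in> ?B" and qr: "q \<le> r"
    show "res (I k) r q (v r) = v q"
      using module_hom_minus[OF is_functorD(1)[OF ID(2) B(1)[OF r]] Iq.module_axioms
          is_functorD(2)[OF ID(2) B(1)[OF q] B(1)[OF r] qr] tc[OF r] uc[OF r]]
        tr[OF q r qr] is_functorD(4)[OF ID(2) B(1)[OF q] B(1)[OF r] p qr B(2)[OF r] u(1)] q r
      by (simp add: v_def)
  qed
  then have v: "v \<in> lim_coboundaries ?B I d k" using exact by blast
  show ?thesis
  proof (cases k)
    case 0
    have "res (I k) p q u = t q" if q: "q \<in> ?B" for q
    proof -
      interpret Iq: module R "obj (I k) q" by (rule is_functorD(1)[OF ID(2) B(1)[OF q]])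
      have "v q = \<zero>\<^bsub>obj (I k) q\<^esub>" using v 0 q by (simp add: lim_module_apply)
      then show ?thesis using q tc[OF q] uc[OF q] by (simp add: v_def Iq.M.minus_eq_zero_iff)
    qed
    then show ?thesis using u by auto
  next
    case (Suc j)
    from v Suc obtain w where w: "w \<in> carrier (lim_module ?B (I j))" and vw: "v = lim_map ?B (d j) w" by auto
    obtain z where z: "z \<in> carrier (obj (I j) p)" and zw: "\<And>q. q \<in> ?B \<Longrightarrow> res (I j) p q z = w q"
      using injective_functor_flasque[OF R ID(1) c p w] by blast
    interpret Ikp: module R "obj (I k) p" by (rule is_functorD(1)[OF ID(2) p])
    have dz: "d j p z \<in> carrier (obj (I k) p)" using nat_transD(3)[OF ID(5) p z] Suc by simp
    let ?y = "u \<oplus>\<^bsub>obj (I k) p\<^esub> d j p z"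
    have "d k p (d j p z) = \<zero>\<^bsub>obj (I (Suc k)) p\<^esub>" using ID(8)[OF p z] Suc by simp
    then have "d k p ?y = s p"
      using module_homD(2)[OF nat_transD(1)[OF ID(5) p] u(1) dz] u(2) sc[OF p] by simp
    moreover have "res (I k) p q ?y = t q" if q: "q \<in> ?B" for q
    proof -
      interpret Iq: module R "obj (I k) q" by (rule is_functorD(1)[OF ID(2) B(1)[OF q]])
      have "res (I k) p q (d j p z) = v q"
        using nat_transD(2)[OF ID(5) B(1)[OF q] p B(2)[OF q] z] zw[OF q] q Suc by (simp add: vw lim_module_apply)
      then have "res (I k) p q ?y = res (I k) p q u \<oplus>\<^bsub>obj (I k) q\<^esub> (t q \<ominus>\<^bsub>obj (I k) q\<^esub> res (I k) p q u)"
        using module_homD(2)[OF is_functorD(2)[OF ID(2) B(1)[OF q] p B(2)[OF q]] u(1) dz] q by (simp add: v_def)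
      also have "\<dots> = t q"
        using tc[OF q] uc[OF q] by (simp add: a_minus_def Iq.M.a_lcomm[of _ "t q"] Iq.M.r_neg)
      finally show ?thesis .
    qed
    ultimately show ?thesis using u(1) dz by blast
  qed
qed

text \<open>
  A cochain \<open>t\<close> with \<open>d t = s\<close> is chosen by recursion along \<open>P\<close>, where \<open>cochain_extend_at\<close> finds the
  value at \<open>p\<close> from the values below \<open>p\<close>. The recursion is well-founded because \<open>P\<close> is filtered.
  The degree goes up by one because the cocycle below \<open>p\<close> that obstructs the extension has the degree
  of \<open>t\<close>, one less than that of \<open>s\<close>.
\<close>

lemma lim_exact_from_below:
  fixes I :: "nat \<Rightarrow> ('p::order, 'r, 'u) pfunctor" and c :: "'r \<Rightarrow> 'u"
  assumes P: "filtered_poset P" and R: "cring R" and c: "inj c" and I: "injective_resolution R P F e I d"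
    and exact: "\<And>p. p \<in> P \<Longrightarrow> lim_cocycles (below P p) I d k \<subseteq> lim_coboundaries (below P p) I d k"
  shows "lim_cocycles P I d (Suc k) \<subseteq> lim_coboundaries P I d (Suc k)"
proof
  note ID = injective_resolutionD[OF I]
  fix s assume s: "s \<in> lim_cocycles P I d (Suc k)"
  obtain \<delta> :: "'p \<Rightarrow> nat" where \<delta>: "strict_mono_on P \<delta>" using P by (auto simp: filtered_poset_def)
  define r where "r = {(q, p). p \<in> P \<and> q \<in> below P p}"
  have "r \<subseteq> measure \<delta>" using \<delta> by (auto simp: r_def below_def strict_mono_on_def)
  then have wf: "wf r" by (rule wf_subset[OF wf_measure])
  define good where "good t p y \<longleftrightarrow> (p \<in> P \<longrightarrow> y \<in> carrier (obj (I k) p) \<and> d k p y = s p \<and>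
    (\<forall>q\<in>below P p. res (I k) p q y = t q))" for t p y
  have "\<exists>t. \<forall>p. good t p (t p)"
  proof (rule dependent_wf_choice[OF wf])
    fix t t' :: "'p \<Rightarrow> 'u" and p y assume "\<And>q. (q, p) \<in> r \<Longrightarrow> t q = t' q"
    then show "good t p y = good t' p y" by (auto simp: good_def r_def)
  next
    fix p and t :: "'p \<Rightarrow> 'u" assume IH: "\<And>q. (q, p) \<in> r \<Longrightarrow> good t q (t q)"
    show "\<exists>y. good t p y"
    proof (cases "p \<in> P")
      case True
      have g: "t q \<in> carrier (obj (I k) q)" "d k q (t q) = s q"
        "\<And>r. r \<in> below P q \<Longrightarrow> res (I k) q r (t q) = t r" if "q \<in> below P p" for q
        using IH[of q] that True below_subset[of P p] by (auto simp: r_def good_def)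
      have "res (I k) q r (t q) = t r" if "r \<in> below P p" "q \<in> below P p" "r \<le> q" for q r
      proof (cases "r = q")
        case True
        then show ?thesis using is_functorD(3)[OF ID(2), of q] g(1) that below_subset[of P p] by auto
      next
        case False
        then show ?thesis using g(3)[OF that(2), of r] that by (auto simp: below_def)
      qed
      then have "restrict t (below P p) \<in> carrier (lim_module (below P p) (I k))"
        using g(1) by (simp add: lim_module_mem)
      from cochain_extend_at[OF R c I True exact[OF True] s this]
      show ?thesis using g(2) by (auto simp: good_def)
    qed (simp add: good_def)
  qed
  then obtain t where t: "\<And>p. good t p (t p)" by blast
  have tc: "t p \<in> carrier (obj (I k) p)" "d k p (t p) = s p" if "p \<in> P" for p
    using t[of p] that by (auto simp: good_def)
  have "res (I k) q p (t q) = t p" if "p \<in> P" "q \<in> P" "p \<le> q" for p q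
    using t[of q] that is_functorD(3)[OF ID(2), of q "t q" k] tc(1)[of q]
    by (cases "p = q") (auto simp: good_def below_def)
  then have T: "restrict t P \<in> carrier (lim_module P (I k))" using tc by (simp add: lim_module_mem)
  moreover have "s = lim_map P (d k) (restrict t P)"
    by (rule lim_module_eqI[OF _ lim_map_closed[OF ID(5) T]])
      (use s tc in \<open>simp_all add: lim_cocycles_mem lim_module_apply\<close>)
  ultimately show "s \<in> lim_coboundaries P I d (Suc k)" by auto
qed

theorem theorem4p1:
  fixes P :: "'p::order set"
    and R :: "('r, 'x) ring_scheme"
    and F :: "('p, 'r, 'm) pfunctor"
    and n :: nat
  assumes "filtered_poset P"
    and "cring R"
    and "is_functor R P F"
    and "\<And>p k. p \<in> P \<Longrightarrow> k \<ge> n \<Longrightarrow> zero_module (Rlim R (below P p) F k)"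
  shows "\<forall>k>n. zero_module (Rlim R P F k)"
proof (intro allI impI)
  fix k assume "k > n"
  then obtain j where k: "k = Suc j" and j: "j \<ge> n" by (cases k) auto
  obtain c :: "('p \<Rightarrow> 'r \<Rightarrow> (('p, 'r, 'm) resolvent \<Rightarrow>\<^sub>0 rat)) \<Rightarrow> ('p, 'r, 'm) resolvent" where c: "inj c"
    using resolvent_absorbs by blast
  \<comment> \<open>The remaining size requirements: \<open>'m\<close> and \<open>'r\<close> embed into the resolvent type.\<close>
  have c\<^sub>m: "inj (\<lambda>x. (\<lambda>_. Some x) :: ('p, 'r, 'm) resolvent)" by (auto simp: inj_def fun_eq_iff)
  have c\<^sub>r: "inj (\<lambda>r. (\<lambda>(p, r', m). if r' = r then None else Some undefined) :: ('p, 'r, 'm) resolvent)"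
  proof (rule injI)
    fix a b :: 'r
    assume "(\<lambda>(p, r', m). if r' = a then None else Some undefined) =
      ((\<lambda>(p, r', m). if r' = b then None else Some undefined) :: ('p, 'r, 'm) resolvent)"
    from fun_cong[OF this, of "(undefined, a, undefined)"] show "a = b" by (simp split: if_splits)
  qed
  obtain e d and I :: "nat \<Rightarrow> ('p, 'r, ('p, 'r, 'm) resolvent) pfunctor"
    where I: "injective_resolution R P F e I d"
    using injective_resolution_exists[OF assms(2) c c\<^sub>m assms(3)] by blast
  have "lim_cocycles (below P p) I d j \<subseteq> lim_coboundaries (below P p) I d j" if p: "p \<in> P" for p
  proof -
    have "injective_resolution R (below P p) F e I d"
      by (rule injective_resolution_restrict[OF assms(2) I below_subset]) (rule below_down)
    then show ?thesis
      using zero_module_Rlim_iff[OF assms(2) is_functor_mono[OF assms(3) below_subset]] assms(4)[OF p j] by blast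
  qed
  then have "lim_cocycles P I d k \<subseteq> lim_coboundaries P I d k"
    unfolding k by (rule lim_exact_from_below[OF assms(1,2) c\<^sub>r I])
  then show "zero_module (Rlim R P F k)"
    using zero_module_Rlim_iff[OF assms(2,3) I] by blast
qed

end
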